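(* Let $N\ge 3$. Let $V:(0,+\infty)\to[0,+\infty)$ and $K:(0,+\infty)\to(0,+\infty)$ be continuous, and assume that there is $C>0$ such that $V(r)\le C/r^2$ for all $r\in(0,1)$. Let $q_1,q_2>1$ be such that $\mathcal{S}_0(q_1,R_1)<\infty$ and $\mathcal{S}_\infty(q_2,R_2)<\infty$ for some $R_1,R_2>0$. Let $g:\mathbb{R}\to\mathbb{R}$ be continuous, put $G(t)=\int_0^t g(s)\,ds$, and assume: (i) there exists $\theta>2$ such that $0\le 2\theta G(t)\le g(t)t$ for all $t\in\mathbb{R}$; (ii) there exists $t_0>0$ such that $G(t_0)>0$; (iii) there exists a constant $C>0$ such that $|g(t)|\le C\min\{|t|^{q_1-1},|t|^{q_2-1}\}$ for all $t\in\mathbb{R}$. Let $u\in E$ be a critical point of the functional $I:E\to\mathbb{R}$, $$I(u)=\frac12\int_{\mathbb{R}^N}|\nabla u|^2dx+\frac12\int_{\mathbb{R}^N}V(|x|)f(u)^2dx-\int_{\mathbb{R}^N}K(|x|)G(f(u))\,dx,$$ and set $w=f(u)$. Then $w\in C^2(\mathbb{R}^N\setminus\{0\})$ and $w$ is a classical solution in $\mathbb{R}^N\setminus\{0\}$ of the equation $$-\Delta w+V(|x|)w-w\,\Delta(w^2)=K(|x|)g(w).$$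
   Context: $f\in C^\infty(\mathbb{R},\mathbb{R})$ denotes the unique solution of the Cauchy problem $f'(t)=\frac{1}{\sqrt{1+2f(t)^2}}$ for $t\in\mathbb{R}$, $f(0)=0$. $C^\infty_{c,r}(\mathbb{R}^N)$ is the space of radial $C^\infty$ real functions with compact support in $\mathbb{R}^N$, and $D^{1,2}_r(\mathbb{R}^N)$ is its closure with respect to the norm $\|u\|_{1,2}=\left(\int_{\mathbb{R}^N}|\nabla u|^2dx\right)^{1/2}$. $E=\{u\in D^{1,2}_r(\mathbb{R}^N): \int_{\mathbb{R}^N}V(|x|)f(u)^2dx<+\infty\}$, endowed with the norm $\|u\|=\|u\|_{1,2}+\|u\|_o$, where $\|u\|_o=\inf_{k>0}\frac1k\left[1+\int_{\mathbb{R}^N}V(|x|)f(ku)^2dx\right]$; it is a Banach space. A critical point of $I$ is $u\in E$ with $I'(u)=0$ in the dual space $E'$, where $I'$ is the Fréchet differential. $B_R=\{x\in\mathbb{R}^N:|x|<R\}$. For $R>0$ and $q>1$, $\mathcal{S}_0(q,R)=\sup_{u\in E,\,\|u\|=1}\int_{B_R}K(|x|)|u|^q\,dx$ and $\mathcal{S}_\infty(q,R)=\sup_{u\in E,\,\|u\|=1}\int_{\mathbb{R}^N\setminus B_R}K(|x|)|u|^q\,dx$ (values in $[0,+\infty]$). As usual, functions are identified up to equality almost everywhere, so $w\in C^2$ means that $w$ has a $C^2$ representative. *)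

theory Defs
  imports "HOL-Analysis.Analysis"
begin

section \<open>The change of variable\<close>

definition chg :: "real \<Rightarrow> real" where
  "chg = (THE f. f 0 = 0 \<and>
     (\<forall>t. (f has_real_derivative 1 / sqrt (1 + 2 * (f t)\<^sup>2)) (at t)))"

text \<open>The Cauchy problem is uniquely solvable on the whole line, so \<open>chg\<close> is well defined. The
  solution is the inverse of a primitive of \<open>\<lambda>y. sqrt (1 + 2 * y\<^sup>2)\<close>.\<close>

lemma chg_ex1:
  "\<exists>!f. f 0 = 0 \<and>
     (\<forall>t. (f has_real_derivative 1 / sqrt (1 + 2 * (f t)\<^sup>2)) (at (t::real)))"
proof -
  define F :: "real \<Rightarrow> real" where
    "F = (\<lambda>y. y * sqrt (1 + 2 * y\<^sup>2) / 2 + arsinh (sqrt 2 * y) / (2 * sqrt 2))"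
  have pos: "1 + 2 * y\<^sup>2 > 0" for y :: real
    by (simp add: add_pos_nonneg)
  have F0: "F 0 = 0"
    by (simp add: F_def)
  have dF: "(F has_real_derivative sqrt (1 + 2 * y\<^sup>2)) (at y)" for y
  proof -
    define s where "s = sqrt (1 + 2 * y\<^sup>2)"
    have s: "s > 0" "s * s = 1 + 2 * y\<^sup>2"
      using pos[of y] by (auto simp: s_def)
    have "((\<lambda>y. sqrt (1 + 2 * y\<^sup>2)) has_real_derivative (4 * y) * (inverse s / 2)) (at y)"
      unfolding s_def using pos[of y]
      by (auto intro!: derivative_eq_intros simp: field_simps)
    then have d1: "((\<lambda>y. y * sqrt (1 + 2 * y\<^sup>2)) has_real_derivative
        s + y * ((4 * y) * (inverse s / 2))) (at y)"
      using DERIV_mult'[OF DERIV_ident] by (fastforce simp: s_def add.commute)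
    have "((\<lambda>y. sqrt 2 * y) has_real_derivative sqrt 2) (at y)"
      by (auto intro!: derivative_eq_intros)
    then have d2: "((\<lambda>y. arsinh (sqrt 2 * y)) has_real_derivative
        (1 / sqrt ((sqrt 2 * y)\<^sup>2 + 1)) * sqrt 2) (at y)"
      by (rule DERIV_chain2[OF arsinh_real_has_field_derivative])
    have "(F has_real_derivative
        (s + y * ((4 * y) * (inverse s / 2))) / 2
        + (1 / sqrt ((sqrt 2 * y)\<^sup>2 + 1)) * sqrt 2 / (2 * sqrt 2)) (at y)"
      unfolding F_def by (rule d1 d2 DERIV_add DERIV_cdivide)+
    moreover have "sqrt ((sqrt 2 * y)\<^sup>2 + 1) = s"
      by (simp add: s_def power_mult_distrib add.commute)
    moreover have "(s + y * ((4 * y) * (inverse s / 2))) / 2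
        + (1 / s) * sqrt 2 / (2 * sqrt 2) = (s * s + 2 * y\<^sup>2 + 1) / (2 * s)"
      using s(1) by (simp add: field_simps power2_eq_square)
    moreover have "\<dots> = s"
      using s by (simp add: field_simps)
    ultimately show ?thesis
      by (simp add: s_def)
  qed
  have contF: "isCont F y" for y
    using dF DERIV_isCont by blast
  have mono: "F a < F b" if "a < b" for a b
    by (rule DERIV_pos_imp_increasing[OF that]) (use dF pos in fastforce)
  have inj: "F a = F b \<Longrightarrow> a = b" for a b
    by (metis less_irrefl linorder_neqE mono)
  have sq: "sqrt (1 + 2 * y\<^sup>2) \<ge> 1" for y :: real
    by simp
  have up: "F y \<ge> y / 2" if "y \<ge> 0" for y
  proof -
    have "y * 1 \<le> y * sqrt (1 + 2 * y\<^sup>2)"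
      by (rule mult_left_mono[OF sq that])
    moreover have "arsinh (sqrt 2 * y) / sqrt 2 \<ge> 0"
      using that by (cases "y = 0") (auto simp: less_imp_le)
    ultimately show ?thesis
      by (simp add: F_def)
  qed
  have odd: "F (- y) = - F y" for y
    by (simp add: F_def)
  have surj: "\<exists>y. F y = t" for t
  proof -
    have "F (2 * \<bar>t\<bar>) \<ge> t" "F (- (2 * \<bar>t\<bar>)) \<le> t"
      using up[of "2 * \<bar>t\<bar>"] odd[of "2 * \<bar>t\<bar>"] by auto
    then show ?thesis
      using IVT[of F "- (2 * \<bar>t\<bar>)" t "2 * \<bar>t\<bar>"] contF by auto
  qed
  define f where "f = (\<lambda>t. THE y. F y = t)"
  have Ff: "F (f t) = t" for t
    unfolding f_def by (rule theI') (use surj inj in blast)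
  have fF: "f (F y) = y" for y
    using Ff inj by blast
  have contf: "isCont f t" for t
    using isCont_inverse_function[of 1 "f t" f F] fF contF Ff by auto
  have df: "(f has_real_derivative 1 / sqrt (1 + 2 * (f t)\<^sup>2)) (at t)" for t
  proof -
    have "(f has_real_derivative inverse (sqrt (1 + 2 * (f t)\<^sup>2))) (at t)"
      by (rule DERIV_inverse_function[where f = F and a = "t - 1" and b = "t + 1"])
        (use dF pos[of "f t"] Ff contf in auto)
    then show ?thesis
      by (simp add: inverse_eq_divide)
  qed
  have "f 0 = 0"
    using fF[of 0] F0 by simp
  moreover have "h = f"
    if h: "h 0 = 0" "\<And>t. (h has_real_derivative 1 / sqrt (1 + 2 * (h t)\<^sup>2)) (at t)" for h
  proof
    fix t
    have "((\<lambda>t. F (h t) - t) has_real_derivative 0) (at t)" for t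
    proof -
      have "((\<lambda>t. F (h t)) has_real_derivative
          sqrt (1 + 2 * (h t)\<^sup>2) * (1 / sqrt (1 + 2 * (h t)\<^sup>2))) (at t)"
        by (rule DERIV_chain2[OF dF h(2)])
      moreover have "sqrt (1 + 2 * (h t)\<^sup>2) * (1 / sqrt (1 + 2 * (h t)\<^sup>2)) = 1"
        using pos[of "h t"] by simp
      ultimately have "((\<lambda>t. F (h t)) has_real_derivative 1) (at t)"
        by metis
      then show ?thesis
        using DERIV_diff[OF _ DERIV_ident] by fastforce
    qed
    then have "F (h t) - t = F (h 0) - 0"
      using DERIV_isconst_all by blast
    then have "F (h t) = t"
      by (simp add: h F0)
    then show "h t = f t"
      using fF by metis
  qed
  ultimately show ?thesis
    using df by blast
qed

lemma chg_0: "chg 0 = 0"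
  and chg_deriv: "(chg has_real_derivative 1 / sqrt (1 + 2 * (chg t)\<^sup>2)) (at t)"
  using theI'[OF chg_ex1] unfolding chg_def[symmetric] by auto


section \<open>Smooth functions and classical differential operators\<close>

definition partial :: "'n \<Rightarrow> (real^'n \<Rightarrow> real) \<Rightarrow> real^'n \<Rightarrow> real" where
  "partial i w x = frechet_derivative w (at x) (axis i 1)"

definition laplacian :: "(real^'n \<Rightarrow> real) \<Rightarrow> real^'n \<Rightarrow> real" where
  "laplacian w x = (\<Sum>i\<in>UNIV. partial i (partial i w) x)"

text \<open>Only used for open \<open>S\<close>.\<close>

primrec Ck_on :: "nat \<Rightarrow> (real^'n \<Rightarrow> real) \<Rightarrow> (real^'n) set \<Rightarrow> bool" where
  "Ck_on 0 w S \<longleftrightarrow> continuous_on S w"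
| "Ck_on (Suc k) w S \<longleftrightarrow>
     (\<forall>x\<in>S. w differentiable (at x)) \<and> (\<forall>i. Ck_on k (partial i w) S)"

definition test_functions :: "(real^'n \<Rightarrow> real) set" where
  "test_functions = {\<phi>. (\<forall>k. Ck_on k \<phi> UNIV) \<and> compact (closure {x. \<phi> x \<noteq> 0})}"

definition radial_test_functions :: "(real^'n \<Rightarrow> real) set" where
  "radial_test_functions =
     {\<phi> \<in> test_functions. \<forall>x y. norm x = norm y \<longrightarrow> \<phi> x = \<phi> y}"


section \<open>The function spaces\<close>

definition weak_gradient :: "(real^'n \<Rightarrow> real) \<Rightarrow> (real^'n \<Rightarrow> real^'n) \<Rightarrow> bool" where
  "weak_gradient u v \<longleftrightarrow>
     (\<forall>S. compact S \<longrightarrow> u absolutely_integrable_on S \<and> v absolutely_integrable_on S) \<and>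
     (\<forall>\<phi>\<in>test_functions. \<forall>i.
        (LINT x|lebesgue. u x * partial i \<phi> x) = - (LINT x|lebesgue. v x $ i * \<phi> x))"

text \<open>The weak gradient is determined up to a null set.\<close>

definition wgrad :: "(real^'n \<Rightarrow> real) \<Rightarrow> real^'n \<Rightarrow> real^'n" where
  "wgrad u = (SOME v. weak_gradient u v)"

text \<open>The functions in \<open>L\<close> with exponent \<open>2N/(N-2)\<close> whose gradient is square integrable: the
  function space, for \<open>N \<ge> 3\<close>, in which \<open>dirichlet_norm\<close> is a norm and in which the closure of the
  radial test functions is taken. Elements are representatives; functions equal almost everywhere
  are never identified as terms, but all notions below are invariant under such a change.\<close>

definition D12 :: "(real^'n \<Rightarrow> real) set" where
  "D12 = {u \<in> borel_measurable lebesgue.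
     integrable lebesgue (\<lambda>x. \<bar>u x\<bar> powr (2 * real CARD('n) / (real CARD('n) - 2))) \<and>
     (\<exists>v. weak_gradient u v \<and> integrable lebesgue (\<lambda>x. (norm (v x))\<^sup>2))}"

definition dirichlet_norm :: "(real^'n \<Rightarrow> real) \<Rightarrow> real" where
  "dirichlet_norm u = sqrt (LINT x|lebesgue. (norm (wgrad u x))\<^sup>2)"

definition D12_rad :: "(real^'n \<Rightarrow> real) set" where
  "D12_rad = {u \<in> D12. \<forall>e>0. \<exists>\<phi>\<in>radial_test_functions. dirichlet_norm (\<lambda>x. u x - \<phi> x) < e}"

text \<open>The potentials \<open>V\<close> and \<open>K\<close> are only meaningful on \<open>{0<..}\<close>; in the integrals below their
  value at \<open>0\<close> is irrelevant, since it only enters at the origin of the space.\<close>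

definition Espace :: "(real \<Rightarrow> real) \<Rightarrow> (real^'n \<Rightarrow> real) set" where
  "Espace V = {u \<in> D12_rad.
     (\<integral>\<^sup>+ x. ennreal (V (norm x) * (chg (u x))\<^sup>2) \<partial>lebesgue) < \<infinity>}"

definition norm_o :: "(real \<Rightarrow> real) \<Rightarrow> (real^'n \<Rightarrow> real) \<Rightarrow> ennreal" where
  "norm_o V u = (INF k\<in>{0<..}. ennreal (1 / k) *
     (1 + (\<integral>\<^sup>+ x. ennreal (V (norm x) * (chg (k * u x))\<^sup>2) \<partial>lebesgue)))"

text \<open>On \<open>Espace V\<close> the infimum is finite (take \<open>k = 1\<close>).\<close>

definition Enorm :: "(real \<Rightarrow> real) \<Rightarrow> (real^'n \<Rightarrow> real) \<Rightarrow> real" where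
  "Enorm V u = dirichlet_norm u + enn2real (norm_o V u)"

definition S_zero ::
    "'n::finite itself \<Rightarrow> (real \<Rightarrow> real) \<Rightarrow> (real \<Rightarrow> real) \<Rightarrow> real \<Rightarrow> real \<Rightarrow> ennreal" where
  "S_zero _ V K q R = (SUP u\<in>{u \<in> Espace V. Enorm V u = 1}.
     \<integral>\<^sup>+ x\<in>ball (0::real^'n) R. ennreal (K (norm x) * \<bar>u x\<bar> powr q) \<partial>lebesgue)"

definition S_infty ::
    "'n::finite itself \<Rightarrow> (real \<Rightarrow> real) \<Rightarrow> (real \<Rightarrow> real) \<Rightarrow> real \<Rightarrow> real \<Rightarrow> ennreal" where
  "S_infty _ V K q R = (SUP u\<in>{u \<in> Espace V. Enorm V u = 1}.
     \<integral>\<^sup>+ x\<in>- ball (0::real^'n) R. ennreal (K (norm x) * \<bar>u x\<bar> powr q) \<partial>lebesgue)"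


section \<open>The functional and its critical points\<close>

definition primitive :: "(real \<Rightarrow> real) \<Rightarrow> real \<Rightarrow> real" where
  "primitive g t = (LBINT s=ereal 0..ereal t. g s)"

definition energy ::
    "(real \<Rightarrow> real) \<Rightarrow> (real \<Rightarrow> real) \<Rightarrow> (real \<Rightarrow> real) \<Rightarrow> (real^'n \<Rightarrow> real) \<Rightarrow> real" where
  "energy V K g u =
     (1/2) * (LINT x|lebesgue. (norm (wgrad u x))\<^sup>2)
     + (1/2) * (LINT x|lebesgue. V (norm x) * (chg (u x))\<^sup>2)
     - (LINT x|lebesgue. K (norm x) * primitive g (chg (u x)))"

text \<open>Elements of the dual of \<open>Espace V\<close>. Invariance under equality almost everywhere is a
  consequence of boundedness.\<close>

definition Edual :: "(real \<Rightarrow> real) \<Rightarrow> ((real^'n \<Rightarrow> real) \<Rightarrow> real) set" where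
  "Edual V = {L.
     (\<forall>h\<in>Espace V. \<forall>k\<in>Espace V. L (\<lambda>x. h x + k x) = L h + L k) \<and>
     (\<forall>c. \<forall>h\<in>Espace V. L (\<lambda>x. c * h x) = c * L h) \<and>
     (\<exists>M. \<forall>h\<in>Espace V. \<bar>L h\<bar> \<le> M * Enorm V h)}"

definition has_frechet_differential ::
    "(real \<Rightarrow> real) \<Rightarrow> ((real^'n \<Rightarrow> real) \<Rightarrow> real) \<Rightarrow> (real^'n \<Rightarrow> real)
      \<Rightarrow> ((real^'n \<Rightarrow> real) \<Rightarrow> real) \<Rightarrow> bool" where
  "has_frechet_differential V J u L \<longleftrightarrow> L \<in> Edual V \<and>
     (\<forall>e>0. \<exists>d>0. \<forall>h\<in>Espace V. Enorm V h < d \<longrightarrow>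
        \<bar>J (\<lambda>x. u x + h x) - J u - L h\<bar> \<le> e * Enorm V h)"

definition critical_point ::
    "(real \<Rightarrow> real) \<Rightarrow> ((real^'n \<Rightarrow> real) \<Rightarrow> real) \<Rightarrow> (real^'n \<Rightarrow> real) \<Rightarrow> bool" where
  "critical_point V J u \<longleftrightarrow> u \<in> Espace V \<and> has_frechet_differential V J u (\<lambda>_. 0)"

end

theory Submission
  imports Defs
begin

text \<open>The critical point \<open>u\<close> is radial, so testing the equation \<open>I'(u) = 0\<close> with radial functions already
  determines it: in the variable \<open>t = x \<bullet> x\<close> it becomes an ordinary differential equation, and
  regularity is a one-dimensional matter.

  Elements of \<open>D12_rad\<close> are limits of radial test functions, but only in the gradient norm. A radial
  test function \<open>\<phi>\<close> satisfies \<open>\<bar>\<phi> x\<bar> \<le> C * norm x powr ((2 - N) / 2) * dirichlet_norm \<phi>\<close>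
  (\<open>radial_test_decay\<close>), so an approximating sequence converges locally uniformly away from the origin,
  to some \<open>U (x \<bullet> x)\<close> with \<open>U\<close> continuous on the positive half-line. This limit has the same weak gradient
  as \<open>u\<close>, and functions that are small at infinity are determined by their weak gradient
  (\<open>AE_zero_if_weak_gradient_zero\<close>). Hence \<open>u\<close> equals \<open>U (x \<bullet> x)\<close> almost everywhere
  (\<open>radial_representative\<close>).

  On an annulus \<open>U\<close>, \<open>V\<close> and \<open>K\<close> are bounded, so the functional can be differentiated at \<open>u\<close> by dominated
  convergence along every radial test function \<open>h\<close> supported in an annulus. The assumptions on
  \<open>S_zero\<close> and \<open>S_infty\<close>, together with the growth of \<open>g\<close>, make the nonlinear term of the energy a
  convergent integral (\<open>nonlinear_term_integrable\<close>), which allows computing differences of energies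
  term by term. Moving both derivatives to \<open>h\<close>, the outcome is \<open>\<integral> u * laplacian h = \<integral> b * h\<close> with
  \<open>b = V * f(u) * f'(u) - K * g(f(u)) * f'(u)\<close>, a continuous function away from the origin
  (\<open>radial_euler_lagrange\<close>).

  Lebesgue measure has a density proportional to \<open>t powr (N / 2 - 1)\<close> in the variable \<open>t\<close>
  (\<open>distr_inner_self\<close>), so this is the weak form of \<open>4 * (t powr (N / 2) * U')' = t powr (N / 2 - 1) * b\<close>.
  Integrating the lower order terms, one obtains a continuous function \<open>D\<close> with \<open>\<integral> D * H'' = 0\<close> for
  all test functions \<open>H\<close>; such a \<open>D\<close> is affine (\<open>weakly_affine\<close>), and solving for \<open>U\<close> shows that \<open>U\<close> is
  twice continuously differentiable (\<open>radial_regularity\<close>). Finally, for \<open>w = f(u)\<close> the chain rule and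
  the identity \<open>f'\<^sup>2 * (1 + 2 * f\<^sup>2) = 1\<close> turn this equation into the quasilinear one.\<close>

section \<open>Smooth functions of one real variable\<close>

primrec n_times_differentiable :: "nat \<Rightarrow> (real \<Rightarrow> real) \<Rightarrow> bool" where
  "n_times_differentiable 0 f \<longleftrightarrow> True"
| "n_times_differentiable (Suc k) f \<longleftrightarrow>
     (\<exists>f'. (\<forall>t. (f has_real_derivative f' t) (at t)) \<and> n_times_differentiable k f')"

definition smooth :: "(real \<Rightarrow> real) \<Rightarrow> bool" where
  "smooth f \<longleftrightarrow> (\<forall>k. n_times_differentiable k f)"

lemma smooth_deriv:
  assumes "smooth f"
  shows "\<And>t. (f has_real_derivative deriv f t) (at t)" "smooth (deriv f)"
proof -
  obtain f' where f': "\<And>t. (f has_real_derivative f' t) (at t)"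
    using assms unfolding smooth_def by (metis n_times_differentiable.simps(2))
  then show D: "(f has_real_derivative deriv f t) (at t)" for t
    by (metis DERIV_imp_deriv)
  show "smooth (deriv f)"
    unfolding smooth_def
  proof
    fix k
    obtain h where h: "\<And>t. (f has_real_derivative h t) (at t)" "n_times_differentiable k h"
      using assms unfolding smooth_def by (metis n_times_differentiable.simps(2))
    then have "h = deriv f"
      by (metis DERIV_imp_deriv ext)
    then show "n_times_differentiable k (deriv f)"
      using h by simp
  qed
qed

lemma smooth_antiderivative:
  assumes "\<And>t. (F has_real_derivative f t) (at t)" "smooth f"
  shows "smooth F"
  unfolding smooth_def
proof
  fix k show "n_times_differentiable k F"
    using assms by (cases k) (auto simp: smooth_def)
qed

lemma smooth_continuous: "smooth f \<Longrightarrow> continuous_on S f"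
  using smooth_deriv(1) by (meson DERIV_continuous_on DERIV_subset subset_UNIV)

lemma n_times_differentiable_SucD:
  "n_times_differentiable (Suc k) f \<Longrightarrow> n_times_differentiable k f"
  by (induction k arbitrary: f) auto

lemma n_times_differentiable_add:
  "n_times_differentiable k f \<Longrightarrow> n_times_differentiable k h \<Longrightarrow>
   n_times_differentiable k (\<lambda>t. f t + h t)"
proof (induction k arbitrary: f h)
  case (Suc k)
  then obtain f' h' where "\<And>t. (f has_real_derivative f' t) (at t)" "n_times_differentiable k f'"
     "\<And>t. (h has_real_derivative h' t) (at t)" "n_times_differentiable k h'"
    by auto
  then show ?case
    by (auto intro!: exI[of _ "\<lambda>t. f' t + h' t"] DERIV_add Suc.IH)
qed simp

lemma n_times_differentiable_mult:
  "n_times_differentiable k f \<Longrightarrow> n_times_differentiable k h \<Longrightarrow>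
   n_times_differentiable k (\<lambda>t. f t * h t)"
proof (induction k arbitrary: f h)
  case (Suc k)
  then obtain f' h' where D: "\<And>t. (f has_real_derivative f' t) (at t)" "n_times_differentiable k f'"
     "\<And>t. (h has_real_derivative h' t) (at t)" "n_times_differentiable k h'"
    by auto
  have "n_times_differentiable k (\<lambda>t. f' t * h t + h' t * f t)"
    using Suc D by (intro n_times_differentiable_add Suc.IH)
      (auto dest: n_times_differentiable_SucD simp del: n_times_differentiable.simps)
  moreover have "\<And>t. ((\<lambda>t. f t * h t) has_real_derivative f' t * h t + h' t * f t) (at t)"
    by (intro DERIV_mult D)
  ultimately show ?case
    by (auto intro!: exI[of _ "\<lambda>t. f' t * h t + h' t * f t"])
qed simp

lemma n_times_differentiable_affine:
  "n_times_differentiable k f \<Longrightarrow> n_times_differentiable k (\<lambda>t. c * f (a * t + b))"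
proof (induction k arbitrary: f c)
  case (Suc k)
  then obtain f' where D: "\<And>t. (f has_real_derivative f' t) (at t)" "n_times_differentiable k f'"
    by auto
  have "((\<lambda>t. c * f (a * t + b)) has_real_derivative (c * a) * f' (a * t + b)) (at t)" for t
  proof -
    have "((\<lambda>t. f (a * t + b)) has_real_derivative f' (a * t + b) * a) (at t)"
      by (rule DERIV_chain2[OF D(1)]) (auto intro!: derivative_eq_intros)
    from DERIV_cmult[OF this, of c] show ?thesis
      by (simp add: mult_ac)
  qed
  then show ?case
    using Suc.IH[OF D(2), of "c * a"] by (auto intro!: exI[of _ "\<lambda>t. (c * a) * f' (a * t + b)"])
qed simp

lemma smooth_add: "smooth f \<Longrightarrow> smooth h \<Longrightarrow> smooth (\<lambda>t. f t + h t)"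
  and smooth_mult: "smooth f \<Longrightarrow> smooth h \<Longrightarrow> smooth (\<lambda>t. f t * h t)"
  and smooth_affine: "smooth f \<Longrightarrow> smooth (\<lambda>t. c * f (a * t + b))"
  by (auto simp: smooth_def n_times_differentiable_add n_times_differentiable_mult
      n_times_differentiable_affine)

lemma smooth_diff: "smooth f \<Longrightarrow> smooth h \<Longrightarrow> smooth (\<lambda>t. f t - h t)"
  using smooth_add[of f "\<lambda>t. - 1 * h (1 * t + 0)"] smooth_affine[of h "-1" 1 0] by simp

text \<open>The family of all \<open>p (1 / t) * exp (- 1 / t)\<close> with \<open>p\<close> a polynomial, extended by \<open>0\<close>, is closed
  under differentiation, since \<open>exp\<close> beats every power at the origin; this is why the flat function
  is smooth there.\<close>

lemma smooth_flat_poly: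
  "smooth (\<lambda>t. if t > 0 then poly p (1 / t) * exp (- (1 / t)) else 0)"
proof -
  have lim: "((\<lambda>y. poly p y * exp (- y)) \<longlongrightarrow> 0) at_top" for p :: "real poly"
  proof -
    have "((\<lambda>y. \<Sum>i\<le>degree p. coeff p i * (y ^ i / exp y)) \<longlongrightarrow> (\<Sum>i\<le>degree p. coeff p i * 0)) at_top"
      by (intro tendsto_intros tendsto_power_div_exp_0)
    then show ?thesis
      by (simp add: poly_altdef sum_divide_distrib exp_minus divide_inverse sum_distrib_right mult.assoc)
  qed
  have "n_times_differentiable k (\<lambda>t. if t > 0 then poly p (1 / t) * exp (- (1 / t)) else 0)" for k
  proof (induction k arbitrary: p)
    case (Suc k)
    define q where "q = [:0, 0, 1:] * (p - pderiv p)"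
    have "((\<lambda>t. if t > 0 then poly p (1 / t) * exp (- (1 / t)) else 0) has_real_derivative
        (if t > 0 then poly q (1 / t) * exp (- (1 / t)) else 0)) (at t)" for t
    proof (cases t "0 :: real" rule: linorder_cases)
      case less
      have "((\<lambda>t. 0) has_real_derivative 0) (at t)"
        by simp
      then show ?thesis
        using less has_field_derivative_transform_within_open[of "\<lambda>t. 0" 0 t "{..<0}"
            "\<lambda>t. if t > 0 then poly p (1 / t) * exp (- (1 / t)) else 0"] by auto
    next
      case equal
      let ?f = "\<lambda>t. if t > 0 then poly p (1 / t) * exp (- (1 / t)) else 0"
      have "((\<lambda>h. poly (pCons 0 p) (inverse h) * exp (- inverse h)) \<longlongrightarrow> 0) (at_right 0)"
        by (rule filterlim_compose[OF lim filterlim_inverse_at_top_right])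
      then have "((\<lambda>h. ?f h / h) \<longlongrightarrow> 0) (at_right 0)"
        by (rule Lim_transform_eventually)
          (auto simp: eventually_at_filter divide_inverse mult_ac intro!: always_eventually)
      moreover have "((\<lambda>h. ?f h / h) \<longlongrightarrow> 0) (at_left 0)"
        by (rule tendsto_eventually) (auto simp: eventually_at_filter intro!: always_eventually)
      ultimately have "((\<lambda>h. ?f h / h) \<longlongrightarrow> 0) (at 0)"
        by (simp add: filterlim_split_at)
      then show ?thesis
        by (simp add: equal DERIV_def cong: if_cong)
    next
      case greater
      have "((\<lambda>t. poly p (1 / t)) has_real_derivative poly (pderiv p) (1/t) * (- (1 / t^2))) (at t)"
        by (rule DERIV_chain2[OF poly_DERIV]) (use greater in \<open>auto intro!: derivative_eq_intros simp: power2_eq_square\<close>)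
      moreover have "((\<lambda>t. exp (- (1 / t))) has_real_derivative exp (-(1/t)) * (1 / t^2)) (at t)"
        by (rule DERIV_chain2[OF DERIV_exp]) (use greater in \<open>auto intro!: derivative_eq_intros simp: power2_eq_square\<close>)
      ultimately have "((\<lambda>t. poly p (1 / t) * exp (- (1 / t))) has_real_derivative
        poly (pderiv p) (1/t) * (- (1 / t^2)) * exp (- (1 / t)) + exp (-(1/t)) * (1 / t^2) * poly p (1/t)) (at t)"
        by (rule DERIV_mult)
      also have "poly (pderiv p) (1/t) * (- (1 / t^2)) * exp (- (1 / t)) + exp (-(1/t)) * (1 / t^2) * poly p (1/t)
         = poly q (1 / t) * exp (- (1 / t))"
        by (simp add: q_def algebra_simps power2_eq_square)
      finally have "((\<lambda>t. poly p (1 / t) * exp (- (1 / t))) has_real_derivative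
          poly q (1 / t) * exp (- (1 / t))) (at t)" .
      then show ?thesis
        using greater has_field_derivative_transform_within_open[of
            "\<lambda>t. poly p (1 / t) * exp (- (1 / t))" "poly q (1 / t) * exp (- (1 / t))" t "{0<..}"
            "\<lambda>t. if t > 0 then poly p (1 / t) * exp (- (1 / t)) else 0"] by auto
    qed
    then show ?case
      using Suc[of q]
      by (auto intro!: exI[of _ "\<lambda>t. if t > 0 then poly q (1 / t) * exp (- (1 / t)) else 0"])
  qed simp
  then show ?thesis
    by (simp add: smooth_def)
qed

definition flat :: "real \<Rightarrow> real" where
  "flat t = (if t > 0 then exp (- (1 / t)) else 0)"

lemma smooth_flat: "smooth flat"
proof -
  have "flat = (\<lambda>t. if t > 0 then poly 1 (1 / t) * exp (- (1 / t)) else 0)"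
    by (auto simp: flat_def)
  then show ?thesis
    using smooth_flat_poly[of 1] by metis
qed

lemma flat_bounds: "0 \<le> flat t" "flat t \<le> 1" "flat t = 0 \<longleftrightarrow> t \<le> 0"
  by (auto simp: flat_def)

lemma deriv_eq_0_outside:
  fixes f :: "real \<Rightarrow> real"
  assumes "open S" "\<And>t. t \<in> S \<Longrightarrow> f t = 0" "t \<in> S"
  shows "deriv f t = 0"
proof -
  have "((\<lambda>t. 0) has_real_derivative 0) (at t)"
    by simp
  then have "(f has_real_derivative 0) (at t)"
    by (rule has_field_derivative_transform_within_open[OF _ assms(1,3)]) (simp add: assms(2))
  then show ?thesis
    by (rule DERIV_imp_deriv)
qed

section \<open>Smooth functions of several variables\<close>

lemma partial_eqI:
  "(w has_derivative D) (at x) \<Longrightarrow> partial i w x = D (axis i 1)"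
  unfolding partial_def by (simp add: frechet_derivative_at[symmetric])

lemma Ck_on_SucD: "Ck_on (Suc k) w S \<Longrightarrow> Ck_on k w S"
proof (induction k arbitrary: w)
  case 0
  then show ?case
    by (auto intro!: continuous_at_imp_continuous_on differentiable_imp_continuous_within)
next
  case (Suc k)
  then show ?case
    by (metis Ck_on.simps(2))
qed

lemma Ck_on_const: "Ck_on k (\<lambda>x::real^'n. c) S"
proof (induction k arbitrary: c)
  case (Suc k)
  have "partial i (\<lambda>x. c) = (\<lambda>x. 0)" for i :: 'n and c
    by (rule ext) (simp add: partial_eqI[OF has_derivative_const])
  then show ?case
    using Suc by simp
qed simp

lemma Ck_on_component: "Ck_on k (\<lambda>x::real^'n. x $ i) S"
proof (cases k)
  case (Suc m)
  have D: "((\<lambda>x. x $ i) has_derivative (\<lambda>y. y $ i)) (at x)" for x :: "real^'n"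
    by (rule bounded_linear_imp_has_derivative[OF bounded_linear_vec_nth])
  have "partial j (\<lambda>x. x $ i) = (\<lambda>x. axis j 1 $ i)" for j :: 'n
    by (rule ext) (rule partial_eqI[OF D])
  then show ?thesis
    using D by (auto simp: Suc Ck_on_const differentiable_def)
qed (auto intro!: continuous_intros)

lemma partial_add:
  "w differentiable (at x) \<Longrightarrow> z differentiable (at x) \<Longrightarrow>
   partial i (\<lambda>x. w x + z x) x = partial i w x + partial i z x"
  unfolding partial_def
  by (subst frechet_derivative_at[OF has_derivative_add, symmetric])
    (auto simp: frechet_derivative_works[symmetric])

lemma partial_mult:
  "w differentiable (at x) \<Longrightarrow> z differentiable (at x) \<Longrightarrow>
   partial i (\<lambda>x. w x * z x) x = w x * partial i z x + partial i w x * z x"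
  unfolding partial_def
  by (subst frechet_derivative_at[OF has_derivative_mult, symmetric])
    (auto simp: frechet_derivative_works[symmetric])

lemma Ck_add: "Ck_on k w UNIV \<Longrightarrow> Ck_on k z UNIV \<Longrightarrow> Ck_on k (\<lambda>x. w x + z x) UNIV"
proof (induction k arbitrary: w z)
  case (Suc k)
  then have "partial i (\<lambda>x. w x + z x) = (\<lambda>x. partial i w x + partial i z x)" for i
    by (auto simp: partial_add)
  with Suc show ?case
    by (auto intro!: differentiable_add)
qed (auto intro!: continuous_intros)

lemma Ck_mult: "Ck_on k w UNIV \<Longrightarrow> Ck_on k z UNIV \<Longrightarrow> Ck_on k (\<lambda>x. w x * z x) UNIV"
proof (induction k arbitrary: w z)
  case (Suc k)
  have "Ck_on k (\<lambda>x. w x * partial i z x + partial i w x * z x) UNIV" for i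
    using Suc.prems Ck_on_SucD[OF Suc.prems(1)] Ck_on_SucD[OF Suc.prems(2)]
    by (intro Ck_add Suc.IH) auto
  moreover have "partial i (\<lambda>x. w x * z x) = (\<lambda>x. w x * partial i z x + partial i w x * z x)" for i
    using Suc.prems by (auto simp: partial_mult)
  ultimately show ?case
    using Suc.prems by (auto intro!: differentiable_mult)
qed (auto intro!: continuous_intros)

lemma Ck_prod: "(\<And>i. i \<in> I \<Longrightarrow> Ck_on k (w i) UNIV) \<Longrightarrow> Ck_on k (\<lambda>x. \<Prod>i\<in>I. w i x) UNIV"
  by (induction I rule: infinite_finite_induct) (auto intro: Ck_mult Ck_on_const)

lemma Ck_sum: "(\<And>i. i \<in> I \<Longrightarrow> Ck_on k (w i) UNIV) \<Longrightarrow> Ck_on k (\<lambda>x. \<Sum>i\<in>I. w i x) UNIV"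
  by (induction I rule: infinite_finite_induct) (auto intro: Ck_add Ck_on_const)

lemma has_derivative_real_comp:
  assumes "(f has_real_derivative f') (at (a x))" "(a has_derivative a') (at x)"
  shows "((\<lambda>x. f (a x)) has_derivative (\<lambda>y. f' * a' y)) (at x)"
  using has_derivative_compose[OF assms(2) assms(1)[unfolded has_field_derivative_def]]
  by simp

lemma Ck_comp: "smooth f \<Longrightarrow> Ck_on k a UNIV \<Longrightarrow> Ck_on k (\<lambda>x. f (a x)) UNIV"
proof (induction k arbitrary: f)
  case 0
  then show ?case
    using continuous_on_compose2[OF smooth_continuous[where S = UNIV], of f UNIV a] by auto
next
  case (Suc k)
  have D: "((\<lambda>x. f (a x)) has_derivative (\<lambda>y. deriv f (a x) * frechet_derivative a (at x) y)) (at x)" for x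
  proof -
    have "(a has_derivative frechet_derivative a (at x)) (at x)"
      using Suc.prems(2) by (simp add: frechet_derivative_works)
    from has_derivative_real_comp[of f "deriv f (a x)" a, OF smooth_deriv(1)[OF Suc.prems(1)] this]
    show ?thesis .
  qed
  have "partial i (\<lambda>x. f (a x)) = (\<lambda>x. deriv f (a x) * partial i a x)" for i
    using partial_eqI[OF D] by (auto simp: partial_def)
  moreover have "Ck_on k (\<lambda>x. deriv f (a x) * partial i a x) UNIV" for i
    using Ck_mult[OF Suc.IH[OF smooth_deriv(2)[OF Suc.prems(1)] Ck_on_SucD[OF Suc.prems(2)]]] Suc.prems(2)
    by simp
  ultimately show ?case
    using D by (auto simp: differentiable_def)
qed

lemma Ck_inner_self: "Ck_on k (\<lambda>x::real^'n. x \<bullet> x) UNIV"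
proof -
  have "Ck_on k (\<lambda>x::real^'n. \<Sum>i\<in>UNIV. x $ i * x $ i) UNIV"
    by (rule Ck_sum) (rule Ck_mult[OF Ck_on_component Ck_on_component])
  then show ?thesis
    by (simp add: inner_vec_def)
qed

section \<open>Test functions\<close>

lemma test_functions_iff:
  "\<phi> \<in> test_functions \<longleftrightarrow> (\<forall>k. Ck_on k \<phi> UNIV) \<and> bounded {x. \<phi> x \<noteq> 0}"
  by (simp add: test_functions_def)

lemma partial_eq_0_outside:
  assumes "open S" "\<And>x. x \<in> S \<Longrightarrow> \<phi> x = 0" "x \<in> S"
  shows "partial i \<phi> x = 0"
proof -
  have "(\<phi> has_derivative (\<lambda>y. 0)) (at x)"
    by (rule has_derivative_transform_within_open[OF has_derivative_const[of 0] assms(1,3)])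
      (simp add: assms(2))
  from partial_eqI[OF this] show ?thesis .
qed

lemma test_partial:
  assumes "\<phi> \<in> test_functions" shows "partial i \<phi> \<in> test_functions"
proof -
  have "partial i \<phi> x = 0" if "x \<in> - closure {x. \<phi> x \<noteq> 0}" for x
    by (rule partial_eq_0_outside[OF _ _ that]) (use closure_subset[of "{x. \<phi> x \<noteq> 0}"] in auto)
  then have "{x. partial i \<phi> x \<noteq> 0} \<subseteq> closure {x. \<phi> x \<noteq> 0}"
    by blast
  moreover have "bounded (closure {x. \<phi> x \<noteq> 0})"
    using assms by (auto simp: test_functions_iff)
  moreover have "Ck_on k (partial i \<phi>) UNIV" for k
    using assms unfolding test_functions_iff by (metis Ck_on.simps(2))
  ultimately show ?thesis
    unfolding test_functions_iff by (blast intro: bounded_subset)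
qed

lemma test_differentiable: "\<phi> \<in> test_functions \<Longrightarrow> \<phi> differentiable (at x)"
  unfolding test_functions_iff by (metis Ck_on.simps(2) UNIV_I)

lemma test_continuous: "\<phi> \<in> test_functions \<Longrightarrow> continuous_on S \<phi>"
  unfolding test_functions_iff by (metis Ck_on.simps(1) continuous_on_subset subset_UNIV)

lemma bounded_nonzero_subset:
  assumes "bounded {x. \<phi> x \<noteq> 0}" "\<And>x. \<phi> x = 0 \<Longrightarrow> \<psi> x = 0"
  shows "bounded {x. \<psi> x \<noteq> 0}"
  by (rule bounded_subset[OF assms(1)]) (use assms(2) in blast)

lemma test_mult: "\<phi> \<in> test_functions \<Longrightarrow> \<psi> \<in> test_functions \<Longrightarrow> (\<lambda>x. \<phi> x * \<psi> x) \<in> test_functions"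
  using bounded_nonzero_subset[of \<phi> "\<lambda>x. \<phi> x * \<psi> x"] by (simp add: test_functions_iff Ck_mult)

lemma test_cmult: "\<phi> \<in> test_functions \<Longrightarrow> (\<lambda>x. c * \<phi> x) \<in> test_functions"
  using bounded_nonzero_subset[of \<phi> "\<lambda>x. c * \<phi> x"] by (simp add: test_functions_iff Ck_mult Ck_on_const)

lemma test_add:
  assumes "\<phi> \<in> test_functions" "\<psi> \<in> test_functions"
  shows "(\<lambda>x. \<phi> x + \<psi> x) \<in> test_functions"
proof -
  have "bounded ({x. \<phi> x \<noteq> 0} \<union> {x. \<psi> x \<noteq> 0})"
    using assms by (simp add: test_functions_iff bounded_Un)
  then have "bounded {x. \<phi> x + \<psi> x \<noteq> 0}"
    by (rule bounded_subset) auto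
  then show ?thesis
    using assms by (simp add: test_functions_iff Ck_add)
qed

lemma test_support:
  assumes "\<phi> \<in> test_functions"
  shows "\<exists>R>0. \<forall>x. norm x > R \<longrightarrow> \<phi> x = 0"
proof -
  obtain R where "R > 0" and R: "\<forall>x\<in>{x. \<phi> x \<noteq> 0}. norm x \<le> R"
    using assms unfolding test_functions_iff bounded_pos by auto
  moreover have "\<phi> x = 0" if "norm x > R" for x
  proof (rule ccontr)
    assume "\<phi> x \<noteq> 0"
    with R have "norm x \<le> R" by simp
    with that show False by simp
  qed
  ultimately show ?thesis
    by blast
qed

lemma test_bounded:
  assumes "\<phi> \<in> test_functions"
  shows "\<exists>M>0. \<forall>x. \<bar>\<phi> x\<bar> \<le> M"
proof -
  obtain R where R: "\<forall>x. norm x > R \<longrightarrow> \<phi> x = 0"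
    using test_support[OF assms] by blast
  have "compact (\<phi> ` cball 0 R)"
    by (rule compact_continuous_image[OF test_continuous[OF assms] compact_cball])
  then obtain M where M: "M > 0" "\<forall>y\<in>\<phi> ` cball 0 R. norm y \<le> M"
    using compact_imp_bounded bounded_pos by metis
  have "\<bar>\<phi> x\<bar> \<le> M" for x
  proof (cases "norm x > R")
    case True
    then show ?thesis using R M(1) by simp
  next
    case False
    then have "\<phi> x \<in> \<phi> ` cball 0 R" by simp
    then show ?thesis using M(2) by force
  qed
  then show ?thesis
    using M(1) by blast
qed

text \<open>Composing with \<open>x \<bullet> x\<close> rather than with the norm gives a function that is smooth also at the origin.\<close>

lemma test_radial:
  assumes "smooth H" "\<And>t. t > T \<Longrightarrow> H t = 0"
  shows "(\<lambda>x::real^'n. H (x \<bullet> x)) \<in> radial_test_functions"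
proof -
  have "x \<in> cball 0 (sqrt T)" if "H (x \<bullet> x) \<noteq> 0" for x :: "real^'n"
  proof -
    have "x \<bullet> x \<le> T"
      using assms(2)[of "x \<bullet> x"] that by (meson not_le)
    then show ?thesis
      by (simp add: norm_eq_sqrt_inner)
  qed
  then have "{x::real^'n. H (x \<bullet> x) \<noteq> 0} \<subseteq> cball 0 (sqrt T)"
    by blast
  then have "bounded {x::real^'n. H (x \<bullet> x) \<noteq> 0}"
    by (rule bounded_subset[OF bounded_cball])
  moreover have "Ck_on k (\<lambda>x::real^'n. H (x \<bullet> x)) UNIV" for k
    using Ck_comp[OF assms(1) Ck_inner_self] .
  ultimately show ?thesis
    unfolding radial_test_functions_def test_functions_iff by (simp add: dot_square_norm)
qed

lemma test_box:
  fixes \<beta> :: "'n::finite \<Rightarrow> real \<Rightarrow> real"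
  assumes "\<And>i. smooth (\<beta> i)" "\<And>i t. \<bar>t\<bar> > R \<Longrightarrow> \<beta> i t = 0"
  shows "(\<lambda>x. \<Prod>i\<in>UNIV. \<beta> i (x $ i)) \<in> test_functions"
proof -
  have "x \<in> cbox (\<chi> i. - R) (\<chi> i. R)" if "(\<Prod>i\<in>UNIV. \<beta> i (x $ i)) \<noteq> 0" for x
  proof -
    have "\<bar>x $ i\<bar> \<le> R" for i
    proof -
      have "\<beta> i (x $ i) \<noteq> 0"
        using that by auto
      then show ?thesis
        using assms(2)[of "x $ i" i] by (meson not_le)
    qed
    then show ?thesis
      by (simp add: mem_box_cart abs_le_iff) (metis minus_le_iff)
  qed
  then have "{x. (\<Prod>i\<in>UNIV. \<beta> i (x $ i)) \<noteq> 0} \<subseteq> cbox (\<chi> i. - R) (\<chi> i. R)"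
    by blast
  then have "bounded {x. (\<Prod>i\<in>UNIV. \<beta> i (x $ i)) \<noteq> 0}"
    by (rule bounded_subset[OF bounded_cbox])
  moreover have "Ck_on k (\<lambda>x. \<Prod>i\<in>UNIV. \<beta> i (x $ i)) UNIV" for k
    using Ck_comp[OF assms(1) Ck_on_component] by (intro Ck_prod) blast
  ultimately show ?thesis
    by (simp add: test_functions_iff)
qed

lemma partial_box:
  fixes \<beta> :: "'n::finite \<Rightarrow> real \<Rightarrow> real"
  assumes "\<And>i. smooth (\<beta> i)"
  shows "partial j (\<lambda>x. \<Prod>i\<in>UNIV. \<beta> i (x $ i)) x = deriv (\<beta> j) (x $ j) * (\<Prod>i\<in>UNIV - {j}. \<beta> i (x $ i))"
proof -
  have D: "((\<lambda>x. \<beta> i (x $ i)) has_derivative (\<lambda>y. deriv (\<beta> i) (x $ i) * y $ i)) (at x)" for i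
    using has_derivative_real_comp[of "\<beta> i" "deriv (\<beta> i) (x $ i)" "\<lambda>x. x $ i", OF smooth_deriv(1)[OF assms]
        bounded_linear_imp_has_derivative[OF bounded_linear_vec_nth]] .
  have "((\<lambda>x. \<Prod>i\<in>UNIV. \<beta> i (x $ i)) has_derivative
    (\<lambda>y. \<Sum>i\<in>UNIV. deriv (\<beta> i) (x $ i) * y $ i * (\<Prod>k\<in>UNIV - {i}. \<beta> k (x $ k)))) (at x)"
    using has_derivative_prod[where I = UNIV and f = "\<lambda>i x. \<beta> i (x $ i)"
        and f' = "\<lambda>i y. deriv (\<beta> i) (x $ i) * y $ i"] D by blast
  from partial_eqI[OF this, of j]
  have "partial j (\<lambda>x. \<Prod>i\<in>UNIV. \<beta> i (x $ i)) x =
    (\<Sum>i\<in>UNIV. deriv (\<beta> i) (x $ i) * axis j 1 $ i * (\<Prod>k\<in>UNIV - {i}. \<beta> k (x $ k)))" .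
  also have "\<dots> = (\<Sum>i\<in>{j}. deriv (\<beta> i) (x $ i) * axis j 1 $ i * (\<Prod>k\<in>UNIV - {i}. \<beta> k (x $ k)))"
    by (rule sum.mono_neutral_right) (auto simp: axis_def)
  finally show ?thesis
    by (simp add: axis_def)
qed

section \<open>Radial functions of class \<open>C\<^sup>2\<close>\<close>

lemma has_derivative_radial:
  assumes "(W has_real_derivative W') (at (x \<bullet> x))"
  shows "((\<lambda>x::real^'n. W (x \<bullet> x)) has_derivative (\<lambda>y. W' * (2 * (x \<bullet> y)))) (at x)"
proof -
  have "((\<lambda>x. x \<bullet> x) has_derivative (\<lambda>y. 2 * (x \<bullet> y))) (at x)"
    by (auto intro!: derivative_eq_intros simp: inner_commute)
  from has_derivative_real_comp[of W W' "\<lambda>x. x \<bullet> x", OF assms this] show ?thesis .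
qed

lemma partial_radial:
  assumes "(W has_real_derivative W') (at (x \<bullet> x))"
  shows "partial i (\<lambda>x::real^'n. W (x \<bullet> x)) x = 2 * x $ i * W'"
  using partial_eqI[OF has_derivative_radial[OF assms]] by (simp add: inner_axis)

lemma has_derivative_partial_radial:
  fixes W W1 W2 :: "real \<Rightarrow> real" and x :: "real^'n"
  assumes W1: "\<And>t. t > 0 \<Longrightarrow> (W has_real_derivative W1 t) (at t)"
    and W2: "\<And>t. t > 0 \<Longrightarrow> (W1 has_real_derivative W2 t) (at t)" and x: "x \<noteq> 0"
  shows "(partial i (\<lambda>x::real^'n. W (x \<bullet> x)) has_derivative
      (\<lambda>y. 2 * x $ i * (W2 (x \<bullet> x) * (2 * (x \<bullet> y))) + 2 * y $ i * W1 (x \<bullet> x))) (at x)"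
proof -
  have A: "((\<lambda>x. 2 * x $ i) has_derivative (\<lambda>y. 2 * y $ i)) (at x)"
    by (intro has_derivative_mult_right bounded_linear_imp_has_derivative[OF bounded_linear_vec_nth])
  have B: "((\<lambda>x. W1 (x \<bullet> x)) has_derivative (\<lambda>y. W2 (x \<bullet> x) * (2 * (x \<bullet> y)))) (at x)"
    using has_derivative_radial[OF W2, of x] x by simp
  have eq: "2 * z $ i * W1 (z \<bullet> z) = partial i (\<lambda>x. W (x \<bullet> x)) z" if "z \<in> - {0}" for z
    using partial_radial[OF W1, of z i] that by simp
  show ?thesis
    by (rule has_derivative_transform_within_open[OF has_derivative_mult[OF A B] open_Compl[OF closed_singleton[of 0]]])
      (use x eq in auto)
qed

lemma partial_partial_radial:
  fixes W W1 W2 :: "real \<Rightarrow> real" and x :: "real^'n"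
  assumes W1: "\<And>t. t > 0 \<Longrightarrow> (W has_real_derivative W1 t) (at t)"
    and W2: "\<And>t. t > 0 \<Longrightarrow> (W1 has_real_derivative W2 t) (at t)" and x: "x \<noteq> 0"
  shows "partial j (partial i (\<lambda>x::real^'n. W (x \<bullet> x))) x =
      4 * x $ i * x $ j * W2 (x \<bullet> x) + (if i = j then 2 * W1 (x \<bullet> x) else 0)"
  using partial_eqI[OF has_derivative_partial_radial[OF W1 W2 x], of j i]
  by (auto simp: inner_axis) (auto simp: axis_def)

lemma laplacian_radial:
  fixes W W1 W2 :: "real \<Rightarrow> real" and x :: "real^'n"
  assumes W1: "\<And>t. t > 0 \<Longrightarrow> (W has_real_derivative W1 t) (at t)"
    and W2: "\<And>t. t > 0 \<Longrightarrow> (W1 has_real_derivative W2 t) (at t)" and x: "x \<noteq> 0"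
  shows "laplacian (\<lambda>x::real^'n. W (x \<bullet> x)) x =
    2 * real CARD('n) * W1 (x \<bullet> x) + 4 * (x \<bullet> x) * W2 (x \<bullet> x)"
proof -
  have "laplacian (\<lambda>x::real^'n. W (x \<bullet> x)) x =
      (\<Sum>i\<in>UNIV. 4 * x $ i * x $ i * W2 (x \<bullet> x) + 2 * W1 (x \<bullet> x))"
    unfolding laplacian_def by (rule sum.cong) (simp_all only: partial_partial_radial[OF W1 W2 x] refl if_True)
  also have "\<dots> = 4 * W2 (x \<bullet> x) * (\<Sum>i\<in>UNIV. x $ i * x $ i) + 2 * real CARD('n) * W1 (x \<bullet> x)"
    by (simp add: sum.distrib sum_distrib_left mult_ac)
  finally show ?thesis
    by (simp add: inner_vec_def)
qed

lemma C2_radial: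
  fixes W W1 W2 :: "real \<Rightarrow> real"
  assumes W1: "\<And>t. t > 0 \<Longrightarrow> (W has_real_derivative W1 t) (at t)"
    and W2: "\<And>t. t > 0 \<Longrightarrow> (W1 has_real_derivative W2 t) (at t)" and cont: "continuous_on {0<..} W2"
  shows "Ck_on 2 (\<lambda>x::real^'n. W (x \<bullet> x)) (- {0})"
proof -
  have W1_cont: "continuous_on {0<..} W1"
    using DERIV_isCont[OF W2] by (intro continuous_at_imp_continuous_on) auto
  have comp: "continuous_on (- {0}) (\<lambda>x::real^'n. h (x \<bullet> x))" if "continuous_on {0<..} h" for h :: "real \<Rightarrow> real"
    by (rule continuous_on_compose2[OF that]) (auto intro: continuous_intros)
  have "continuous_on (- {0}) (\<lambda>x::real^'n. 4 * x $ i * x $ j * W2 (x \<bullet> x) + (if i = j then 2 * W1 (x \<bullet> x) else 0))"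
    for i j
    by (cases "i = j") (auto intro!: continuous_intros comp cont W1_cont)
  then have "continuous_on (- {0}) (partial j (partial i (\<lambda>x::real^'n. W (x \<bullet> x))))" for i j
    by (rule continuous_on_eq) (simp add: partial_partial_radial[OF W1 W2])
  moreover have "(\<lambda>x::real^'n. W (x \<bullet> x)) differentiable (at x)" if "x \<noteq> 0" for x
    using has_derivative_radial[OF W1, of x] that unfolding differentiable_def by auto
  moreover have "partial i (\<lambda>x::real^'n. W (x \<bullet> x)) differentiable (at x)" if "x \<noteq> 0" for x i
    using has_derivative_partial_radial[OF W1 W2 that] unfolding differentiable_def by blast
  ultimately show ?thesis
    by (simp add: numeral_2_eq_2)
qed

section \<open>Local integrability\<close>

definition locally_integrable :: "('a::euclidean_space \<Rightarrow> 'b::euclidean_space) \<Rightarrow> bool" where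
  "locally_integrable z \<longleftrightarrow> (\<forall>S. compact S \<longrightarrow> z absolutely_integrable_on S)"

lemma borel_imp_lebesgue_measurable: "f \<in> borel_measurable borel \<Longrightarrow> f \<in> borel_measurable lebesgue"
  by (rule measurable_completion) simp

lemma locally_integrable_integrable:
  "locally_integrable z \<Longrightarrow> compact S \<Longrightarrow> integrable lebesgue (\<lambda>x. indicat_real S x *\<^sub>R z x)"
  by (simp add: locally_integrable_def set_integrable_def)

lemma locally_integrable_add:
  "locally_integrable z \<Longrightarrow> locally_integrable y \<Longrightarrow> locally_integrable (\<lambda>x. z x + y x)"
  by (simp add: locally_integrable_def set_integrable_def scaleR_add_right)

lemma locally_integrable_scale:
  "locally_integrable z \<Longrightarrow> locally_integrable (\<lambda>x. c *\<^sub>R z x)"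
  by (simp add: locally_integrable_def set_integral_scaleR_right)

lemma locally_integrable_component:
  fixes v :: "'a::euclidean_space \<Rightarrow> real^'n"
  assumes "locally_integrable v" shows "locally_integrable (\<lambda>x. v x $ i)"
  unfolding locally_integrable_def set_integrable_def
proof safe
  fix S :: "'a set" assume "compact S"
  from integrable_bounded_linear[OF bounded_linear_vec_nth locally_integrable_integrable[OF assms this], of i]
  show "integrable lebesgue (\<lambda>x. indicat_real S x *\<^sub>R v x $ i)"
    by simp
qed

lemma locally_integrable_continuous:
  fixes f :: "'a::euclidean_space \<Rightarrow> 'b::euclidean_space"
  assumes "continuous_on UNIV f" shows "locally_integrable f"
  unfolding locally_integrable_def set_integrable_def
proof safe
  fix S :: "'a set" assume S: "compact S"
  have I: "integrable lborel (\<lambda>x. indicat_real S x *\<^sub>R f x)"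
    by (rule borel_integrable_compact[OF S continuous_on_subset[OF assms]]) simp
  then show "integrable lebesgue (\<lambda>x. indicat_real S x *\<^sub>R f x)"
    using borel_measurable_integrable[OF I] by (simp add: integrable_completion)
qed

lemma integrable_mult_bounded_support:
  fixes z \<phi> :: "'a::euclidean_space \<Rightarrow> real"
  assumes z: "locally_integrable z" and \<phi>: "\<phi> \<in> borel_measurable borel"
    and M: "\<And>x. \<bar>\<phi> x\<bar> \<le> M" and R: "\<And>x. norm x > R \<Longrightarrow> \<phi> x = 0"
  shows "integrable lebesgue (\<lambda>x. z x * \<phi> x)"
proof -
  let ?z = "\<lambda>x. indicat_real (cball 0 R) x *\<^sub>R z x"
  have I: "integrable lebesgue ?z"
    by (rule locally_integrable_integrable[OF z compact_cball])
  have "integrable lebesgue (\<lambda>x. ?z x * \<phi> x)"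
  proof (rule Bochner_Integration.integrable_bound)
    show "integrable lebesgue (\<lambda>x. M *\<^sub>R ?z x)"
      by (rule integrable_scaleR_right) (rule I)
    show "(\<lambda>x. ?z x * \<phi> x) \<in> borel_measurable lebesgue"
      by (rule borel_measurable_times[OF borel_measurable_integrable[OF I] borel_imp_lebesgue_measurable[OF \<phi>]])
    have "\<bar>?z x * \<phi> x\<bar> \<le> \<bar>M * ?z x\<bar>" for x
      using mult_right_mono[OF M[of x], of "\<bar>?z x\<bar>"] M[of x] by (simp add: abs_mult mult.commute)
    then show "AE x in lebesgue. norm (?z x * \<phi> x) \<le> norm (M *\<^sub>R ?z x)"
      by simp
  qed
  moreover have "(\<lambda>x. ?z x * \<phi> x) = (\<lambda>x. z x * \<phi> x)"
    using R by (auto simp: fun_eq_iff indicator_def)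
  ultimately show ?thesis
    by simp
qed

lemma test_borel: "\<phi> \<in> test_functions \<Longrightarrow> \<phi> \<in> borel_measurable borel"
  by (rule borel_measurable_continuous_onI[OF test_continuous])

lemma integrable_mult_test:
  assumes "locally_integrable z" "\<phi> \<in> test_functions"
  shows "integrable lebesgue (\<lambda>x. z x * \<phi> x)"
proof -
  obtain R M where "\<forall>x. norm x > R \<longrightarrow> \<phi> x = 0" "\<forall>x. \<bar>\<phi> x\<bar> \<le> M"
    using test_support[OF assms(2)] test_bounded[OF assms(2)] by metis
  then show ?thesis
    by (intro integrable_mult_bounded_support[OF assms(1) test_borel[OF assms(2)], of M R]) auto
qed

lemma locally_integrable_test: "\<phi> \<in> test_functions \<Longrightarrow> locally_integrable \<phi>"
  by (rule locally_integrable_continuous[OF test_continuous])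

lemma integrable_test:
  assumes "\<phi> \<in> test_functions" shows "integrable lebesgue \<phi>"
  using integrable_mult_test[OF locally_integrable_continuous[OF continuous_on_const[of UNIV "1::real"]] assms]
  by simp

lemma integral_lebesgue_translation:
  fixes f :: "'a::euclidean_space \<Rightarrow> real"
  assumes "f \<in> borel_measurable borel"
  shows "(LINT x|lebesgue. f (c + x)) = (LINT x|lebesgue. f x)"
proof -
  have "(\<lambda>x. f (c + x)) \<in> borel_measurable borel"
    using assms by measurable
  then have "(LINT x|lebesgue. f (c + x)) = (LINT x|lborel. f (c + x))"
    by (simp add: integral_completion)
  also have "\<dots> = (LINT x|distr lborel borel ((+) c). f x)"
    by (rule integral_distr[symmetric]) (use assms in simp_all)
  also have "\<dots> = (LINT x|lebesgue. f x)"
    using assms by (simp add: lborel_distr_plus integral_completion)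
  finally show ?thesis .
qed

section \<open>The fundamental lemma of the calculus of variations\<close>

lemma flat_scaled_tendsto:
  "(\<lambda>k. flat (real (Suc k) * s)) \<longlonglongrightarrow> (if s > 0 then 1 else 0)"
proof (cases "s > 0")
  case True
  have "(\<lambda>k. exp (- ((1 / s) * inverse (real (Suc k))))) \<longlonglongrightarrow> exp (- ((1 / s) * 0))"
    by (intro tendsto_intros LIMSEQ_inverse_real_of_nat)
  moreover have "flat (real (Suc k) * s) = exp (- ((1 / s) * inverse (real (Suc k))))" for k
    using True by (simp add: flat_def divide_inverse mult.commute del: of_nat_Suc)
  ultimately show ?thesis
    using True by simp
next
  case False
  then have "real (Suc k) * s \<le> 0" for k
    by (simp add: mult_nonneg_nonpos)
  then have "flat (real (Suc k) * s) = 0" for k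
    using flat_bounds(3) by blast
  then show ?thesis
    using False by (simp del: of_nat_Suc)
qed

text \<open>Products of flat functions with growing slopes converge boundedly to the indicator function of
  an open box.\<close>

lemma integral_box_eq_0:
  fixes z :: "real^'n \<Rightarrow> real"
  assumes z: "locally_integrable z"
    and 0: "\<And>\<beta> R. (\<And>i. smooth (\<beta> i)) \<Longrightarrow> (\<And>i t. \<bar>t\<bar> > R \<Longrightarrow> \<beta> i t = 0) \<Longrightarrow>
      (LINT x|lebesgue. z x * (\<Prod>i\<in>UNIV. \<beta> i (x $ i))) = 0"
  shows "(LINT x|lebesgue. z x * indicator (box a b) x) = 0"
proof -
  define R where "R = norm a + norm b"
  define \<beta> where "\<beta> k i t = flat (real (Suc k) * (t - a $ i)) * flat (real (Suc k) * (b $ i - t))" for k i t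
  define \<phi> where "\<phi> k x = (\<Prod>i\<in>UNIV. \<beta> k i (x $ i))" for k and x :: "real^'n"
  have sm: "smooth (\<beta> k i)" for k i
    using smooth_mult[OF smooth_affine[OF smooth_flat, of 1 "real (Suc k)" "- real (Suc k) * a $ i"]
        smooth_affine[OF smooth_flat, of 1 "- real (Suc k)" "real (Suc k) * b $ i"]]
    unfolding \<beta>_def by (simp add: algebra_simps)
  have supp: "\<beta> k i t = 0" if "\<bar>t\<bar> > R" for k i t
  proof -
    have "\<bar>a $ i\<bar> \<le> R" "\<bar>b $ i\<bar> \<le> R"
      using component_le_norm_cart[of a i] component_le_norm_cart[of b i]
        norm_ge_zero[of a] norm_ge_zero[of b] unfolding R_def by linarith+
    then have "t - a $ i \<le> 0 \<or> b $ i - t \<le> 0"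
      using that by linarith
    then have "real (Suc k) * (t - a $ i) \<le> 0 \<or> real (Suc k) * (b $ i - t) \<le> 0"
      using mult_nonneg_nonpos[of "real (Suc k)"] by (meson of_nat_0_le_iff)
    then show ?thesis
      unfolding \<beta>_def by (metis flat_bounds(3) mult_eq_0_iff)
  qed
  have zero: "(LINT x|lebesgue. z x * \<phi> k x) = 0" for k
    unfolding \<phi>_def by (rule 0[of "\<beta> k", OF sm supp])
  have \<beta>_bounds: "0 \<le> \<beta> k i t" "\<beta> k i t \<le> 1" for k i t
    unfolding \<beta>_def using flat_bounds by (simp_all add: mult_le_one)
  have \<phi>_bounds: "\<bar>\<phi> k x\<bar> \<le> 1" for k x
    using prod_nonneg[of UNIV "\<lambda>i. \<beta> k i (x $ i)"] prod_le_1[of UNIV "\<lambda>i. \<beta> k i (x $ i)"] \<beta>_bounds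
    by (simp add: \<phi>_def)
  have lim: "(\<lambda>k. \<phi> k x) \<longlonglongrightarrow> indicator (box a b) x" for x
  proof -
    have "(\<lambda>k. \<phi> k x) \<longlonglongrightarrow> (\<Prod>i\<in>UNIV. (if x $ i - a $ i > 0 then 1 else 0) * (if b $ i - x $ i > 0 then 1 else 0))"
      unfolding \<phi>_def \<beta>_def by (intro tendsto_prod tendsto_mult flat_scaled_tendsto)
    also have "(\<Prod>i\<in>UNIV. (if x $ i - a $ i > 0 then 1 else 0) * (if b $ i - x $ i > 0 then 1 else (0::real)))
        = indicator (box a b) x"
    proof (cases "x \<in> box a b")
      case True
      then show ?thesis
        by (simp add: mem_box_cart)
    next
      case False
      then obtain i where "\<not> (x $ i - a $ i > 0 \<and> b $ i - x $ i > 0)"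
        by (auto simp: mem_box_cart)
      then show ?thesis
        using False by (subst prod_zero) auto
    qed
    finally show ?thesis .
  qed
  have \<phi>_out: "\<phi> k x = 0" if "norm x > R * real CARD('n)" for k x
  proof -
    have "\<exists>i. \<bar>x $ i\<bar> > R"
    proof (rule ccontr)
      assume "\<not> (\<exists>i. \<bar>x $ i\<bar> > R)"
      then have "(\<Sum>i\<in>UNIV. \<bar>x $ i\<bar>) \<le> (\<Sum>i\<in>(UNIV::'n set). R)"
        by (intro sum_mono) (simp add: not_less)
      with norm_le_l1_cart[of x] that show False
        by (simp add: mult.commute)
    qed
    then obtain i where "\<bar>x $ i\<bar> > R" ..
    from supp[OF this] show ?thesis
      unfolding \<phi>_def by (intro prod_zero) auto
  qed
  have meas: "\<phi> k \<in> borel_measurable borel" for k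
  proof -
    have "\<phi> k \<in> test_functions"
      using test_box[of "\<beta> k" R] sm supp unfolding \<phi>_def[abs_def] by blast
    then show ?thesis by (rule test_borel)
  qed
  have "(\<lambda>k. LINT x|lebesgue. z x * \<phi> k x) \<longlonglongrightarrow> (LINT x|lebesgue. z x * indicator (box a b) x)"
  proof (rule integral_dominated_convergence)
    let ?B = "cball (0::real^'n) (R * real CARD('n))"
    have I: "integrable lebesgue (\<lambda>x. z x * indicator ?B x)"
      using locally_integrable_integrable[OF z compact_cball] by (simp add: mult.commute)
    show "integrable lebesgue (\<lambda>x. norm (z x * indicator ?B x))"
      by (rule integrable_norm[OF I])
    show "AE x in lebesgue. (\<lambda>k. z x * \<phi> k x) \<longlonglongrightarrow> z x * indicator (box a b) x"
      by (intro always_eventually allI tendsto_mult_left lim)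
    have "\<bar>z x * \<phi> k x\<bar> \<le> \<bar>z x * indicator ?B x\<bar>" for k x
      using \<phi>_bounds[of k x] \<phi>_out[of x k] mult_left_mono[of "\<bar>\<phi> k x\<bar>" 1 "\<bar>z x\<bar>"]
      by (cases "norm x > R * real CARD('n)") (auto simp: abs_mult indicator_def)
    then show "\<And>k. AE x in lebesgue. norm (z x * \<phi> k x) \<le> norm (z x * indicator ?B x)"
      by simp
    show "(\<lambda>x. z x * \<phi> k x) \<in> borel_measurable lebesgue" for k
      using integrable_mult_bounded_support[OF z meas \<phi>_bounds \<phi>_out] by (rule borel_measurable_integrable)
    have "integrable lebesgue (\<lambda>x. z x * indicator (box a b) x)"
    proof (rule integrable_mult_bounded_support[OF z])
      show "\<bar>indicat_real (box a b) x\<bar> \<le> 1" for x by (simp add: indicator_def)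
      show "indicat_real (box a b) x = 0" if "norm x > R * real CARD('n)" for x
        using LIMSEQ_unique[OF lim[of x]] \<phi>_out[OF that] by auto
    qed simp
    then show "(\<lambda>x. z x * indicator (box a b) x) \<in> borel_measurable lebesgue"
      by (rule borel_measurable_integrable)
  qed
  then show ?thesis
    unfolding zero by (simp add: LIMSEQ_const_iff)
qed

text \<open>The sets over which an integrable function integrates to \<open>0\<close> form a Dynkin system, so it is
  enough to know boxes.\<close>

lemma AE_zero_if_box_integrals_zero:
  fixes f :: "'a::euclidean_space \<Rightarrow> real"
  assumes f: "integrable lebesgue f" and total: "(LINT x|lebesgue. f x) = 0"
    and box: "\<And>a b. (LINT x|lebesgue. f x * indicator (box a b) x) = 0"
  shows "AE x in lebesgue. f x = 0"
proof -
  obtain h where h: "h \<in> borel_measurable lborel" and fh: "AE x in lborel. f x = h x"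
    using completion_ex_borel_measurable_real[OF borel_measurable_integrable[OF f]] by blast
  have fh': "AE x in lebesgue. f x = h x"
    by (rule AE_completion[OF fh])
  have h': "h \<in> borel_measurable lebesgue"
    by (rule measurable_completion[OF h])
  have "integrable lebesgue h"
    using integrable_cong_AE[OF borel_measurable_integrable[OF f] h' fh'] f by simp
  then have hI: "integrable lborel h"
    using h by (simp add: integrable_completion)
  have tr: "(LINT x|lebesgue. f x * indicator A x) = (LINT x:A|lborel. h x)" if A: "A \<in> sets borel" for A
  proof -
    have mA: "indicat_real A \<in> borel_measurable lborel"
      using A by simp
    have "(LINT x|lebesgue. f x * indicator A x) = (LINT x|lebesgue. h x * indicator A x)"
      using fh' by (intro integral_cong_AE borel_measurable_times borel_measurable_integrable[OF f] h'
          measurable_completion[OF mA]) auto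
    also have "\<dots> = (LINT x|lborel. h x * indicator A x)"
      by (rule integral_completion) (intro borel_measurable_times h mA)
    finally show ?thesis
      by (simp add: set_lebesgue_integral_def mult.commute)
  qed
  have si: "set_integrable lborel A h" if "A \<in> sets borel" for A
    using integrable_mult_indicator[of A lborel h] that hI by (simp add: set_integrable_def)
  have tot: "(LINT x:UNIV|lborel. h x) = 0"
    using tr[of UNIV] total by simp
  let ?G = "range (\<lambda>(a, b). box a b :: 'a set)"
  have G: "?G \<subseteq> Pow UNIV"
    by simp
  have Int: "Int_stable ?G"
    by (auto simp: Int_stable_def box_Int_box)
  have "set_lebesgue_integral lborel A h = 0" if "A \<in> sigma_sets UNIV ?G" for A
    using Int G that
  proof (induction rule: sigma_sets_induct_disjoint[where \<Omega> = UNIV and G = ?G])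
    case (basic A)
    then obtain a b where "A = box a b" by auto
    then show ?case
      using tr[of "box a b"] box[of a b] by simp
  next
    case (compl A)
    then have A: "A \<in> sets borel"
      by (simp add: borel_eq_box)
    have "(LINT x:A \<union> (UNIV - A)|lborel. h x) = (LINT x:A|lborel. h x) + (LINT x:UNIV - A|lborel. h x)"
      by (rule set_integral_Un) (use A in \<open>auto intro!: si\<close>)
    then show ?case
      using compl tot by (simp add: Un_absorb1)
  next
    case (union A)
    then have A: "A i \<in> sets borel" for i
      by (auto simp: borel_eq_box)
    have "(LINT x:(\<Union>i. A i)|lborel. h x) = (\<Sum>i. (LINT x:(A i)|lborel. h x))"
    proof (rule lebesgue_integral_countable_add)
      show "A i \<in> sets lborel" for i using A by simp
      show "A i \<inter> A j = {}" if "i \<noteq> j" for i j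
        using union(1) that by (auto simp: disjoint_family_on_def)
      show "set_integrable lborel (\<Union>i. A i) h"
        using A by (intro si sets.countable_UN) auto
    qed
    then show ?case
      using union by simp
  qed (simp_all add: set_lebesgue_integral_def)
  then have "AE x in lborel. h x = 0"
    by (intro sigma_finite_measure.density_zero[OF sigma_finite_lborel hI]) (simp add: borel_eq_box)
  from AE_completion[OF this] fh' show ?thesis
    by eventually_elim simp
qed

lemma AE_zero_of_box_tests:
  fixes z :: "real^'n \<Rightarrow> real"
  assumes z: "locally_integrable z"
    and 0: "\<And>\<beta> R. (\<And>i. smooth (\<beta> i)) \<Longrightarrow> (\<And>i t. \<bar>t\<bar> > R \<Longrightarrow> \<beta> i t = 0) \<Longrightarrow>
      (LINT x|lebesgue. z x * (\<Prod>i\<in>UNIV. \<beta> i (x $ i))) = 0"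
  shows "AE x in lebesgue. z x = 0"
proof -
  define Q where "Q n = box (\<chi> i::'n. - real n) (\<chi> i. real n)" for n
  have box0: "(LINT x|lebesgue. z x * indicator (box a b) x) = 0" for a b
    by (rule integral_box_eq_0[OF z]) (rule 0)
  have Qb: "Q n \<inter> box a b = box (\<Sum>i\<in>Basis. max ((\<chi> i. - real n) \<bullet> i) (a \<bullet> i) *\<^sub>R i)
      (\<Sum>i\<in>Basis. min ((\<chi> i. real n) \<bullet> i) (b \<bullet> i) *\<^sub>R i)" for n a b
    by (simp add: Q_def box_Int_box)
  have "AE x in lebesgue. z x * indicator (Q n) x = 0" for n
  proof (rule AE_zero_if_box_integrals_zero)
    have "integrable lebesgue (\<lambda>x. indicat_real (cbox (\<chi> i. - real n) (\<chi> i. real n)) x *\<^sub>R z x)"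
      by (rule locally_integrable_integrable[OF z compact_cbox])
    from integrable_mult_indicator[OF _ this, of "Q n"]
    have "integrable lebesgue (\<lambda>x. indicat_real (Q n) x *\<^sub>R (indicat_real (cbox (\<chi> i. - real n) (\<chi> i. real n)) x *\<^sub>R z x))"
      by (simp add: Q_def)
    moreover have "(\<lambda>x. indicat_real (Q n) x *\<^sub>R (indicat_real (cbox (\<chi> i. - real n) (\<chi> i. real n)) x *\<^sub>R z x)) =
      (\<lambda>x. z x * indicator (Q n) x)"
      using box_subset_cbox by (auto simp: fun_eq_iff Q_def indicator_def)
    ultimately show "integrable lebesgue (\<lambda>x. z x * indicator (Q n) x)"
      by simp
    show "(LINT x|lebesgue. z x * indicator (Q n) x) = 0"
      unfolding Q_def by (rule box0)
    show "(LINT x|lebesgue. z x * indicator (Q n) x * indicator (box a b) x) = 0" for a b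
    proof -
      have "(\<lambda>x. z x * indicator (Q n) x * indicator (box a b) x) = (\<lambda>x. z x * indicator (Q n \<inter> box a b) x)"
        by (auto simp: fun_eq_iff indicator_def)
      then show ?thesis
        by (simp only: Qb box0)
    qed
  qed
  then have "AE x in lebesgue. \<forall>n. z x * indicator (Q n) x = 0"
    unfolding AE_all_countable by blast
  moreover have "\<exists>n. x \<in> Q n" for x :: "real^'n"
  proof -
    obtain n where "norm x < real n"
      using reals_Archimedean2 by blast
    then have "\<bar>x $ i\<bar> < real n" for i
      using component_le_norm_cart[of x i] by linarith
    then have "x \<in> Q n"
      by (simp add: Q_def mem_box_cart abs_less_iff) (metis minus_less_iff)
    then show ?thesis ..
  qed
  ultimately show ?thesis
    by (elim eventually_mono) (metis indicator_simps(1) mult.right_neutral)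
qed

section \<open>Weak gradients\<close>

lemma weak_gradient_locally_integrable:
  "weak_gradient u v \<longleftrightarrow> locally_integrable u \<and> locally_integrable v \<and>
     (\<forall>\<phi>\<in>test_functions. \<forall>i.
        (LINT x|lebesgue. u x * partial i \<phi> x) = - (LINT x|lebesgue. v x $ i * \<phi> x))"
  by (auto simp: weak_gradient_def locally_integrable_def)

lemma weak_gradient_unique:
  fixes u u' :: "real^'n \<Rightarrow> real"
  assumes v: "weak_gradient u v" and v': "weak_gradient u' v'" and uu': "AE x in lebesgue. u x = u' x"
  shows "AE x in lebesgue. v x = v' x"
proof -
  have "AE x in lebesgue. v x $ i + - 1 *\<^sub>R v' x $ i = 0" for i
  proof (rule AE_zero_of_box_tests)
    have l: "locally_integrable (\<lambda>x. v x $ i)" "locally_integrable (\<lambda>x. v' x $ i)"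
      using v v' by (simp_all add: weak_gradient_locally_integrable locally_integrable_component)
    show "locally_integrable (\<lambda>x. v x $ i + - 1 *\<^sub>R v' x $ i)"
      by (rule locally_integrable_add[OF l(1) locally_integrable_scale[OF l(2)]])
    fix \<beta> :: "'n \<Rightarrow> real \<Rightarrow> real" and R
    assume "\<And>i. smooth (\<beta> i)" "\<And>i t. \<bar>t\<bar> > R \<Longrightarrow> \<beta> i t = 0"
    then have t: "(\<lambda>x. \<Prod>i\<in>UNIV. \<beta> i (x $ i)) \<in> test_functions" (is "?\<phi> \<in> _")
      by (rule test_box)
    have lu: "locally_integrable u" "locally_integrable u'"
      using v v' by (simp_all add: weak_gradient_locally_integrable)
    have "(LINT x|lebesgue. u x * partial i ?\<phi> x) = (LINT x|lebesgue. u' x * partial i ?\<phi> x)"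
      using uu' integrable_mult_test[OF lu(1) test_partial[OF t]] integrable_mult_test[OF lu(2) test_partial[OF t]]
      by (intro integral_cong_AE borel_measurable_integrable) auto
    then have "(LINT x|lebesgue. v x $ i * ?\<phi> x) = (LINT x|lebesgue. v' x $ i * ?\<phi> x)"
      using v v' t by (simp add: weak_gradient_locally_integrable)
    moreover have "(LINT x|lebesgue. (v x $ i + - 1 *\<^sub>R v' x $ i) * ?\<phi> x) =
        (LINT x|lebesgue. v x $ i * ?\<phi> x) - (LINT x|lebesgue. v' x $ i * ?\<phi> x)"
      using Bochner_Integration.integral_diff[OF integrable_mult_test[OF l(1) t] integrable_mult_test[OF l(2) t]]
      by (simp add: left_diff_distrib)
    ultimately show "(LINT x|lebesgue. (v x $ i + - 1 *\<^sub>R v' x $ i) * ?\<phi> x) = 0"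
      by simp
  qed
  then have "AE x in lebesgue. \<forall>i\<in>UNIV. v x $ i + - 1 *\<^sub>R v' x $ i = 0"
    by (intro AE_finite_allI) auto
  then show ?thesis
    by (rule eventually_mono) (simp add: vec_eq_iff)
qed

lemma weak_gradient_add:
  assumes v: "weak_gradient u v" and v': "weak_gradient u' v'"
  shows "weak_gradient (\<lambda>x. u x + u' x) (\<lambda>x. v x + v' x)"
  unfolding weak_gradient_locally_integrable
proof (intro conjI ballI allI)
  note l = v[unfolded weak_gradient_locally_integrable] v'[unfolded weak_gradient_locally_integrable]
  show "locally_integrable (\<lambda>x. u x + u' x)" "locally_integrable (\<lambda>x. v x + v' x)"
    using l by (simp_all add: locally_integrable_add)
  fix \<phi> :: "real^'a \<Rightarrow> real" and i assume t: "\<phi> \<in> test_functions"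
  have "(LINT x|lebesgue. (u x + u' x) * partial i \<phi> x) =
      (LINT x|lebesgue. u x * partial i \<phi> x) + (LINT x|lebesgue. u' x * partial i \<phi> x)"
    using l test_partial[OF t] integrable_mult_test
    by (subst Bochner_Integration.integral_add[symmetric]) (auto simp: distrib_right)
  moreover have "(LINT x|lebesgue. (v x + v' x) $ i * \<phi> x) =
      (LINT x|lebesgue. v x $ i * \<phi> x) + (LINT x|lebesgue. v' x $ i * \<phi> x)"
    using l t integrable_mult_test locally_integrable_component
    by (subst Bochner_Integration.integral_add[symmetric]) (auto simp: distrib_right)
  ultimately show "(LINT x|lebesgue. (u x + u' x) * partial i \<phi> x) =
      - (LINT x|lebesgue. (v x + v' x) $ i * \<phi> x)"
    using l t by simp
qed

lemma weak_gradient_cmult: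
  assumes v: "weak_gradient u v"
  shows "weak_gradient (\<lambda>x. c * u x) (\<lambda>x. c *\<^sub>R v x)"
  using v locally_integrable_scale[of u c] locally_integrable_scale[of v c]
  unfolding weak_gradient_locally_integrable by (simp add: mult.assoc)

definition gradient :: "(real^'n \<Rightarrow> real) \<Rightarrow> real^'n \<Rightarrow> real^'n" where
  "gradient \<phi> x = (\<chi> i. partial i \<phi> x)"

lemma has_real_derivative_along_axis:
  assumes "\<phi> \<in> test_functions"
  shows "((\<lambda>s. \<phi> (x + s *\<^sub>R axis i 1)) has_real_derivative partial i \<phi> (x + s *\<^sub>R axis i 1)) (at s)"
proof -
  let ?D = "frechet_derivative \<phi> (at (x + s *\<^sub>R axis i 1))"
  have "(\<phi> has_derivative ?D) (at (x + s *\<^sub>R axis i 1))"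
    using test_differentiable[OF assms] by (simp add: frechet_derivative_works)
  moreover have "((\<lambda>s. x + s *\<^sub>R axis i 1) has_derivative (\<lambda>h. h *\<^sub>R axis i 1)) (at s)"
    by (auto intro!: derivative_eq_intros)
  ultimately have "((\<lambda>s. \<phi> (x + s *\<^sub>R axis i 1)) has_derivative (\<lambda>h. ?D (h *\<^sub>R axis i 1))) (at s)"
    using has_derivative_compose[of "\<lambda>s. x + s *\<^sub>R axis i 1" "\<lambda>h. h *\<^sub>R axis i 1" s UNIV \<phi> ?D] by blast
  moreover have "?D (h *\<^sub>R axis i 1) = partial i \<phi> (x + s *\<^sub>R axis i 1) * h" for h
    using linear_frechet_derivative[OF test_differentiable[OF assms]]
    by (simp add: partial_def linear_cmul)
  ultimately show ?thesis
    by (simp add: has_field_derivative_def)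
qed

text \<open>The difference quotients have integral \<open>0\<close> by translation invariance, hence so has their limit.\<close>

lemma integral_partial_eq_0:
  fixes \<phi> :: "real^'n \<Rightarrow> real"
  assumes t: "\<phi> \<in> test_functions"
  shows "(LINT x|lebesgue. partial i \<phi> x) = 0"
proof -
  let ?e = "axis i 1 :: real^'n"
  obtain R where R: "R > 0" "\<forall>x. norm x > R \<longrightarrow> \<phi> x = 0"
    using test_support[OF t] by blast
  obtain M where M: "\<forall>x. \<bar>partial i \<phi> x\<bar> \<le> M"
    using test_bounded[OF test_partial[OF t]] by blast
  have M0: "M \<ge> 0"
    using M abs_ge_zero order_trans by blast
  define h where "h n = inverse (real (Suc n))" for n
  have h: "0 < h n" "h n \<le> 1" for n
    by (simp_all add: h_def inverse_le_1_iff)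
  define D where "D n x = (\<phi> (h n *\<^sub>R ?e + x) - \<phi> x) / h n" for n x
  have meas: "(\<lambda>x. \<phi> (c + x)) \<in> borel_measurable borel" for c
    using test_borel[OF t] by measurable
  have int: "integrable lebesgue (\<lambda>x. \<phi> (c + x))" for c
  proof -
    have "integrable (distr lborel borel ((+) c)) \<phi>"
      using integrable_test[OF t] test_borel[OF t] by (simp add: lborel_distr_plus integrable_completion)
    then have "integrable lborel (\<lambda>x. \<phi> (c + x))"
      using test_borel[OF t] by (simp add: integrable_distr_eq)
    then show ?thesis
      using meas by (simp add: integrable_completion)
  qed
  have "(LINT x|lebesgue. D n x) = ((LINT x|lebesgue. \<phi> (h n *\<^sub>R ?e + x)) - (LINT x|lebesgue. \<phi> x)) / h n" for n
    unfolding D_def using int integrable_test[OF t] by simp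
  then have D0: "(LINT x|lebesgue. D n x) = 0" for n
    by (simp add: integral_lebesgue_translation[OF test_borel[OF t]])
  have "(\<lambda>n. LINT x|lebesgue. D n x) \<longlonglongrightarrow> (LINT x|lebesgue. partial i \<phi> x)"
  proof (rule integral_dominated_convergence)
    let ?B = "cball (0::real^'n) (R + 1)"
    show "integrable lebesgue (\<lambda>x. M * indicator ?B x)"
      using locally_integrable_integrable[OF locally_integrable_continuous[OF continuous_on_const[of UNIV M]] compact_cball[of "0::real^'n" "R + 1"]]
      by (simp add: mult.commute)
    show "partial i \<phi> \<in> borel_measurable lebesgue"
      by (rule borel_imp_lebesgue_measurable[OF test_borel[OF test_partial[OF t]]])
    show "D n \<in> borel_measurable lebesgue" for n
      unfolding D_def using int integrable_test[OF t]
      by (intro borel_measurable_divide borel_measurable_diff borel_measurable_const borel_measurable_integrable)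
    have "(\<lambda>n. D n x) \<longlonglongrightarrow> partial i \<phi> x" for x
    proof -
      have "((\<lambda>s. (\<phi> (x + (0 + s) *\<^sub>R ?e) - \<phi> (x + 0 *\<^sub>R ?e)) / s) \<longlongrightarrow> partial i \<phi> (x + 0 *\<^sub>R ?e)) (at 0)"
        using has_real_derivative_along_axis[OF t, of x i 0] unfolding DERIV_def .
      moreover have "filterlim h (at 0) sequentially"
        using LIMSEQ_inverse_real_of_nat h(1) unfolding h_def
        by (auto simp: filterlim_at simp del: of_nat_Suc)
      ultimately show ?thesis
        unfolding D_def by (auto dest: filterlim_compose simp: add.commute)
    qed
    then show "AE x in lebesgue. (\<lambda>n. D n x) \<longlonglongrightarrow> partial i \<phi> x"
      by simp
    have "\<bar>D n x\<bar> \<le> M * indicator ?B x" for n x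
    proof (cases "x \<in> ?B")
      case True
      have "\<exists>z>0. z < h n \<and> \<phi> (x + h n *\<^sub>R ?e) - \<phi> (x + 0 *\<^sub>R ?e) = (h n - 0) * partial i \<phi> (x + z *\<^sub>R ?e)"
        by (rule MVT2[OF h(1)]) (rule has_real_derivative_along_axis[OF t])
      then obtain z where "\<phi> (x + h n *\<^sub>R ?e) - \<phi> x = h n * partial i \<phi> (x + z *\<^sub>R ?e)"
        by auto
      then have "D n x = partial i \<phi> (x + z *\<^sub>R ?e)"
        using h(1)[of n] by (simp add: D_def add.commute)
      then show ?thesis
        using M True by simp
    next
      case False
      then have nx: "norm x > R + 1" by simp
      have "norm x \<le> norm (h n *\<^sub>R ?e + x) + norm (h n *\<^sub>R ?e)"
        using norm_triangle_ineq4[of "h n *\<^sub>R ?e + x" "h n *\<^sub>R ?e"] by simp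
      also have "norm (h n *\<^sub>R ?e) \<le> 1"
        using h[of n] by (simp add: norm_axis_1)
      finally have "norm (h n *\<^sub>R ?e + x) > R"
        using nx by linarith
      then show ?thesis
        using R nx M0 by (simp add: D_def)
    qed
    then show "AE x in lebesgue. norm (D n x) \<le> M * indicator ?B x" for n
      by simp
  qed
  then show ?thesis
    by (simp add: D0 LIMSEQ_const_iff)
qed

lemma weak_gradient_test:
  assumes t: "\<phi> \<in> test_functions"
  shows "weak_gradient \<phi> (gradient \<phi>)"
  unfolding weak_gradient_locally_integrable
proof (intro conjI ballI allI)
  show "locally_integrable \<phi>"
    by (rule locally_integrable_test[OF t])
  show "locally_integrable (gradient \<phi>)"
    unfolding gradient_def[abs_def]
    by (intro locally_integrable_continuous continuous_on_vec_lambda test_continuous test_partial t)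
  fix \<psi> :: "real^'a \<Rightarrow> real" and i assume s: "\<psi> \<in> test_functions"
  have "partial i (\<lambda>x. \<phi> x * \<psi> x) x = \<phi> x * partial i \<psi> x + partial i \<phi> x * \<psi> x" for x
    by (rule partial_mult) (rule test_differentiable[OF t], rule test_differentiable[OF s])
  then have "0 = (LINT x|lebesgue. \<phi> x * partial i \<psi> x + partial i \<phi> x * \<psi> x)"
    using integral_partial_eq_0[OF test_mult[OF t s], of i] by simp
  also have "\<dots> = (LINT x|lebesgue. \<phi> x * partial i \<psi> x) + (LINT x|lebesgue. partial i \<phi> x * \<psi> x)"
    by (rule Bochner_Integration.integral_add)
      (rule integrable_test[OF test_mult[OF t test_partial[OF s]]],
        rule integrable_test[OF test_mult[OF test_partial[OF t] s]])
  finally show "(LINT x|lebesgue. \<phi> x * partial i \<psi> x) = - (LINT x|lebesgue. gradient \<phi> x $ i * \<psi> x)"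
    by (simp add: gradient_def)
qed

lemma continuous_antiderivative:
  fixes f :: "real \<Rightarrow> real"
  assumes "continuous_on UNIV f"
  shows "\<exists>F. \<forall>t. (F has_real_derivative f t) (at t)"
proof -
  have "isCont f x" for x
    using assms by (simp add: continuous_on_eq_continuous_at)
  then show ?thesis
    using einterval_antiderivative[of "-\<infinity>" "\<infinity>" f]
    by (auto simp: has_real_derivative_iff_has_vector_derivative)
qed

lemma antiderivative_const_where_zero:
  fixes F f :: "real \<Rightarrow> real"
  assumes F: "\<And>t. (F has_real_derivative f t) (at t)" and "s \<le> t" and z: "\<And>x. s < x \<Longrightarrow> x < t \<Longrightarrow> f x = 0"
  shows "F s = F t"
proof (cases "s = t")
  case False
  then have "\<exists>x>s. x < t \<and> F t - F s = (t - s) * f x"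
    using \<open>s \<le> t\<close> by (intro MVT2 F) simp
  then show ?thesis
    using z by auto
qed simp

section \<open>Functions with vanishing weak gradient\<close>

lemma nonpos_if_le_all_multiples:
  fixes x A :: real
  assumes A: "A \<ge> 0" and le: "\<And>e. e > 0 \<Longrightarrow> x \<le> e * A"
  shows "x \<le> 0"
proof (rule field_le_epsilon)
  fix e :: real assume e: "e > 0"
  have "x \<le> e / (A + 1) * A"
    using e A by (intro le) simp
  also have "\<dots> \<le> 0 + e"
    using e A by (simp add: field_simps)
  finally show "x \<le> 0 + e" .
qed

text \<open>A product test function minus its translate along an axis is a partial derivative of another
  product test function: the factor \<open>\<beta>\<close> of that axis is replaced by \<open>B t - B (t - s)\<close>, where \<open>B\<close> is an
  antiderivative of \<open>\<beta>\<close>. A function with vanishing weak gradient therefore does not distinguish a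
  product test function from its translates.\<close>

lemma integral_shifted_box_test:
  fixes z :: "real^'n \<Rightarrow> real"
  assumes z: "locally_integrable z"
    and 0: "\<And>\<phi> i. \<phi> \<in> test_functions \<Longrightarrow> (LINT x|lebesgue. z x * partial i \<phi> x) = 0"
    and \<beta>: "\<And>i. smooth (\<beta> i)" "\<And>i t. \<bar>t\<bar> > R \<Longrightarrow> \<beta> i t = 0" and s: "s \<ge> 0"
  defines "\<eta> \<equiv> \<lambda>x. \<Prod>i\<in>UNIV. \<beta> i (x $ i)"
  shows "(LINT x|lebesgue. z x * \<eta> x) = (LINT x|lebesgue. z x * \<eta> (x - s *\<^sub>R axis j 1))"
proof -
  obtain B where B: "\<And>t. (B has_real_derivative \<beta> j t) (at t)"
    using continuous_antiderivative[OF smooth_continuous[OF \<beta>(1)]] by blast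
  have Bs: "smooth B"
    by (rule smooth_antiderivative[OF B \<beta>(1)])
  have B': "((\<lambda>t. B (t - s)) has_real_derivative \<beta> j (t - s)) (at t)" for t
    using DERIV_shift[of B "\<beta> j (t - s)" t "- s"] B[of "t - s"] by simp
  define \<gamma> where "\<gamma> t = B t - B (t - s)" for t
  have \<gamma>s: "smooth \<gamma>"
    using smooth_diff[OF Bs smooth_affine[OF Bs, of 1 1 "- s"]] unfolding \<gamma>_def by simp
  have \<gamma>': "deriv \<gamma> t = \<beta> j t - \<beta> j (t - s)" for t
    using DERIV_diff[OF B B'] unfolding \<gamma>_def by (rule DERIV_imp_deriv)
  have \<gamma>0: "\<gamma> t = 0" if "\<bar>t\<bar> > \<bar>R\<bar> + s" for t
  proof -
    have "B (t - s) = B t"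
      by (rule antiderivative_const_where_zero[OF B]) (use that s \<beta>(2) in auto)
    then show ?thesis by (simp add: \<gamma>_def)
  qed
  have \<beta>'s: "smooth ((\<beta>(j := \<gamma>)) i)" for i
    using \<gamma>s \<beta>(1) by simp
  have \<beta>'0: "(\<beta>(j := \<gamma>)) i t = 0" if "\<bar>t\<bar> > \<bar>R\<bar> + s" for i t
    using \<gamma>0[OF that] \<beta>(2)[of t i] that s by auto
  define \<Psi> where "\<Psi> x = (\<Prod>i\<in>UNIV. (\<beta>(j := \<gamma>)) i (x $ i))" for x :: "real^'n"
  have \<Psi>: "\<Psi> \<in> test_functions"
    using test_box[of "\<beta>(j := \<gamma>)", OF \<beta>'s \<beta>'0] unfolding \<Psi>_def[abs_def] .
  have \<eta>: "\<eta> \<in> test_functions"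
    using test_box[of \<beta>, OF \<beta>] unfolding \<eta>_def .
  have split: "(\<Prod>i\<in>UNIV. f i) = f j * (\<Prod>i\<in>UNIV - {j}. f i)" for f :: "'n \<Rightarrow> real"
    by (rule prod.remove) auto
  have dd: "partial j \<Psi> x = \<eta> x - \<eta> (x - s *\<^sub>R axis j 1)" for x
  proof -
    have "partial j \<Psi> x = deriv \<gamma> (x $ j) * (\<Prod>i\<in>UNIV - {j}. (\<beta>(j := \<gamma>)) i (x $ i))"
      using partial_box[of "\<beta>(j := \<gamma>)" j x, OF \<beta>'s] unfolding \<Psi>_def[abs_def] by simp
    also have "(\<Prod>i\<in>UNIV - {j}. (\<beta>(j := \<gamma>)) i (x $ i)) = (\<Prod>i\<in>UNIV - {j}. \<beta> i (x $ i))"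
      by (rule prod.cong) auto
    finally have "partial j \<Psi> x = (\<beta> j (x $ j) - \<beta> j (x $ j - s)) * (\<Prod>i\<in>UNIV - {j}. \<beta> i (x $ i))"
      by (simp add: \<gamma>')
    moreover have "(\<Prod>i\<in>UNIV - {j}. \<beta> i ((x - s *\<^sub>R axis j 1) $ i)) = (\<Prod>i\<in>UNIV - {j}. \<beta> i (x $ i))"
      by (rule prod.cong) (auto simp: axis_def)
    moreover have "(x - s *\<^sub>R axis j 1) $ j = x $ j - s"
      by (simp add: axis_def)
    ultimately show ?thesis
      unfolding \<eta>_def split by (simp add: left_diff_distrib)
  qed
  have "(\<lambda>x. \<eta> x - partial j \<Psi> x) = (\<lambda>x. \<eta> (x - s *\<^sub>R axis j 1))"
    by (simp add: dd)
  then have "(LINT x|lebesgue. z x * \<eta> (x - s *\<^sub>R axis j 1)) =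
      (LINT x|lebesgue. z x * \<eta> x - z x * partial j \<Psi> x)"
    by (simp add: dd right_diff_distrib)
  also have "\<dots> = (LINT x|lebesgue. z x * \<eta> x) - (LINT x|lebesgue. z x * partial j \<Psi> x)"
    by (rule Bochner_Integration.integral_diff[OF integrable_mult_test[OF z \<eta>] integrable_mult_test[OF z test_partial[OF \<Psi>]]])
  finally show ?thesis
    by (simp add: 0[OF \<Psi>])
qed

text \<open>Smallness up to an integrable error. This covers functions with an integrable power of exponent above \<open>1\<close> as well as
  locally integrable functions that tend to \<open>0\<close> at infinity, and it is stable under sums.\<close>

definition small_at_infinity :: "('a::euclidean_space \<Rightarrow> real) \<Rightarrow> bool" where
  "small_at_infinity z \<longleftrightarrow> (\<forall>d>0. \<exists>q. integrable lebesgue q \<and> (AE x in lebesgue. \<bar>z x\<bar> \<le> d + q x))"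

text \<open>The test function can be translated to infinity without changing the integral, and there the
  integral is small.\<close>

lemma AE_zero_if_weak_gradient_zero:
  fixes z :: "real^'n \<Rightarrow> real"
  assumes z: "locally_integrable z"
    and 0: "\<And>\<phi> i. \<phi> \<in> test_functions \<Longrightarrow> (LINT x|lebesgue. z x * partial i \<phi> x) = 0"
    and small: "small_at_infinity z"
  shows "AE x in lebesgue. z x = 0"
proof (rule AE_zero_of_box_tests[OF z])
  fix \<beta> :: "'n \<Rightarrow> real \<Rightarrow> real" and R
  assume \<beta>: "\<And>i. smooth (\<beta> i)" "\<And>i t. \<bar>t\<bar> > R \<Longrightarrow> \<beta> i t = 0"
  define \<eta> where "\<eta> x = (\<Prod>i\<in>UNIV. \<beta> i (x $ i))" for x :: "real^'n"
  obtain j :: 'n where True by simp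
  let ?T = "\<lambda>n x. x - real n *\<^sub>R axis j 1 :: real^'n"
  have \<eta>: "\<eta> \<in> test_functions"
    using test_box[of \<beta>, OF \<beta>] unfolding \<eta>_def[abs_def] .
  obtain M where M: "M > 0" "\<forall>x. \<bar>\<eta> x\<bar> \<le> M"
    using test_bounded[OF \<eta>] by blast
  obtain r where r: "r > 0" "\<forall>x. norm x > r \<longrightarrow> \<eta> x = 0"
    using test_support[OF \<eta>] by blast
  define A where "A = (LINT x|lebesgue. \<bar>\<eta> x\<bar>)"
  have shift: "(LINT x|lebesgue. z x * \<eta> x) = (LINT x|lebesgue. z x * \<eta> (?T n x))" for n
    using integral_shifted_box_test[of z \<beta> R "real n" j, OF z 0 \<beta>] unfolding \<eta>_def[abs_def] by simp
  have mT: "(\<lambda>x. \<eta> (?T n x)) \<in> borel_measurable borel" for n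
    using test_borel[OF \<eta>] by measurable
  have T0: "\<eta> (?T n x) = 0" if "norm x > r + real n" for n x
  proof -
    have "norm x \<le> norm (?T n x) + norm (real n *\<^sub>R axis j 1 :: real^'n)"
      using norm_triangle_ineq[of "?T n x" "real n *\<^sub>R axis j 1"] by simp
    then have "norm (?T n x) > r"
      using that by (simp add: norm_axis_1)
    then show ?thesis using r by blast
  qed
  have iT: "integrable lebesgue (\<lambda>x. y x * \<eta> (?T n x))" if "locally_integrable y" for y n
    by (rule integrable_mult_bounded_support[OF that mT, of n M "r + real n"]) (use M T0 in auto)
  have iA: "integrable lebesgue (\<lambda>x. \<bar>\<eta> (?T n x)\<bar>)" for n
    using iT[OF locally_integrable_continuous[OF continuous_on_const[of UNIV "1::real"]], of n] by simp
  have AT: "(LINT x|lebesgue. \<bar>\<eta> (?T n x)\<bar>) = A" for n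
  proof -
    have "(\<lambda>x. \<bar>\<eta> x\<bar>) \<in> borel_measurable borel"
      using test_borel[OF \<eta>] by measurable
    from integral_lebesgue_translation[OF this, of "- real n *\<^sub>R axis j 1"]
    show ?thesis unfolding A_def by simp
  qed
  have "\<bar>LINT x|lebesgue. z x * \<eta> x\<bar> \<le> d * A" if d: "d > 0" for d
  proof -
    obtain q where q: "integrable lebesgue q" "AE x in lebesgue. \<bar>z x\<bar> \<le> d + q x"
      using small d unfolding small_at_infinity_def by blast
    have iq: "integrable lebesgue (\<lambda>x. \<bar>q x\<bar> * \<bar>\<eta> (?T n x)\<bar>)" for n
    proof (rule Bochner_Integration.integrable_bound)
      show "integrable lebesgue (\<lambda>x. M * \<bar>q x\<bar>)"
        using q by simp
      show "(\<lambda>x. \<bar>q x\<bar> * \<bar>\<eta> (?T n x)\<bar>) \<in> borel_measurable lebesgue"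
        using borel_measurable_integrable[OF q(1)] borel_imp_lebesgue_measurable[OF mT]
        by (intro borel_measurable_times borel_measurable_abs)
      show "AE x in lebesgue. norm (\<bar>q x\<bar> * \<bar>\<eta> (?T n x)\<bar>) \<le> norm (M * \<bar>q x\<bar>)"
        using M by (auto intro!: always_eventually simp: abs_mult mult.commute[of M] mult_left_mono)
    qed
    have bound: "\<bar>LINT x|lebesgue. z x * \<eta> x\<bar> \<le> d * A + (LINT x|lebesgue. \<bar>q x\<bar> * \<bar>\<eta> (?T n x)\<bar>)" for n
    proof -
      have "\<bar>LINT x|lebesgue. z x * \<eta> x\<bar> \<le> (LINT x|lebesgue. \<bar>z x * \<eta> (?T n x)\<bar>)"
        unfolding shift[of n] by (rule integral_abs_bound)
      also have "\<dots> \<le> (LINT x|lebesgue. d * \<bar>\<eta> (?T n x)\<bar> + \<bar>q x\<bar> * \<bar>\<eta> (?T n x)\<bar>)"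
      proof (rule integral_mono_AE)
        show "AE x in lebesgue. \<bar>z x * \<eta> (?T n x)\<bar> \<le> d * \<bar>\<eta> (?T n x)\<bar> + \<bar>q x\<bar> * \<bar>\<eta> (?T n x)\<bar>"
          using q(2)
        proof eventually_elim
          case (elim x)
          then have "\<bar>z x\<bar> \<le> d + \<bar>q x\<bar>" by linarith
          from mult_right_mono[OF this, of "\<bar>\<eta> (?T n x)\<bar>"] show ?case
            by (simp add: abs_mult distrib_right)
        qed
      qed (use iT[OF z] iA iq in auto)
      also have "\<dots> = d * A + (LINT x|lebesgue. \<bar>q x\<bar> * \<bar>\<eta> (?T n x)\<bar>)"
        using iA iq by (simp add: AT)
      finally show ?thesis .
    qed
    have "(\<lambda>n. LINT x|lebesgue. \<bar>q x\<bar> * \<bar>\<eta> (?T n x)\<bar>) \<longlonglongrightarrow> (LINT x|(lebesgue :: (real^'n) measure). (0::real))"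
    proof (rule integral_dominated_convergence)
      show "integrable lebesgue (\<lambda>x. M * \<bar>q x\<bar>)"
        using q by simp
      show "(\<lambda>x. \<bar>q x\<bar> * \<bar>\<eta> (?T n x)\<bar>) \<in> borel_measurable lebesgue" for n
        by (rule borel_measurable_integrable[OF iq])
      show "AE x in lebesgue. norm (\<bar>q x\<bar> * \<bar>\<eta> (?T n x)\<bar>) \<le> M * \<bar>q x\<bar>" for n
        using M by (auto intro!: always_eventually simp: abs_mult mult.commute[of M] mult_left_mono)
      have "(\<lambda>n. \<bar>q x\<bar> * \<bar>\<eta> (?T n x)\<bar>) \<longlonglongrightarrow> 0" for x
      proof (rule tendsto_eventually)
        obtain m where m: "r + norm x < real m"
          using reals_Archimedean2 by blast
        show "\<forall>\<^sub>F n in sequentially. \<bar>q x\<bar> * \<bar>\<eta> (?T n x)\<bar> = 0"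
          using eventually_ge_at_top[of m]
        proof eventually_elim
          case (elim n)
          have "norm (real n *\<^sub>R axis j 1 :: real^'n) \<le> norm x + norm (?T n x)"
            using norm_triangle_ineq4[of x "?T n x"] by simp
          then have "norm (?T n x) > r"
            using m elim by (simp add: norm_axis_1)
          then show ?case using r by simp
        qed
      qed
      then show "AE x in lebesgue. (\<lambda>n. \<bar>q x\<bar> * \<bar>\<eta> (?T n x)\<bar>) \<longlonglongrightarrow> 0"
        by simp
    qed simp
    then have "(\<lambda>n. d * A + (LINT x|lebesgue. \<bar>q x\<bar> * \<bar>\<eta> (?T n x)\<bar>)) \<longlonglongrightarrow> d * A + 0"
      by (intro tendsto_intros) simp
    from LIMSEQ_le_const[OF this] bound show ?thesis
      by auto
  qed
  moreover have "A \<ge> 0"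
    unfolding A_def by simp
  ultimately have "\<bar>LINT x|lebesgue. z x * \<eta> x\<bar> \<le> 0"
    by (rule nonpos_if_le_all_multiples[rotated])
  then show "(LINT x|lebesgue. z x * (\<Prod>i\<in>UNIV. \<beta> i (x $ i))) = 0"
    by (simp add: \<eta>_def)
qed

lemma AE_eq_if_weak_gradients_eq:
  fixes u w :: "real^'n \<Rightarrow> real"
  assumes u: "weak_gradient u v" "small_at_infinity u" and w: "weak_gradient w v" "small_at_infinity w"
  shows "AE x in lebesgue. u x = w x"
proof -
  have wg: "weak_gradient (\<lambda>x. u x + - 1 * w x) (\<lambda>x. 0)"
    using weak_gradient_add[OF u(1) weak_gradient_cmult[OF w(1), of "- 1"]] by simp
  have "AE x in lebesgue. u x + - 1 * w x = 0"
  proof (rule AE_zero_if_weak_gradient_zero)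
    show "small_at_infinity (\<lambda>x. u x + - 1 * w x)"
      unfolding small_at_infinity_def
    proof (intro allI impI)
      fix d :: real assume "d > 0"
      then have "d / 2 > 0" by simp
      then obtain p q where pq: "integrable lebesgue p" "AE x in lebesgue. \<bar>u x\<bar> \<le> d / 2 + p x"
        "integrable lebesgue q" "AE x in lebesgue. \<bar>w x\<bar> \<le> d / 2 + q x"
        using u(2) w(2) unfolding small_at_infinity_def by meson
      from pq(2,4) have "AE x in lebesgue. \<bar>u x + - 1 * w x\<bar> \<le> d + (p x + q x)"
        by eventually_elim simp
      then show "\<exists>q. integrable lebesgue q \<and> (AE x in lebesgue. \<bar>u x + - 1 * w x\<bar> \<le> d + q x)"
        using Bochner_Integration.integrable_add[OF pq(1,3)] by blast
    qed
  qed (use wg in \<open>simp_all add: weak_gradient_locally_integrable\<close>)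
  then show ?thesis
    by (rule eventually_mono) simp
qed

text \<open>Both sides of the defining identity pass to the limit: the functions converge with the locally
  integrable weight \<open>y\<close>, the gradients in mean square.\<close>

lemma weak_gradient_limit:
  fixes w y :: "real^'n \<Rightarrow> real"
  assumes t: "\<And>n. \<phi> n \<in> test_functions" and \<epsilon>: "\<And>n. \<epsilon> n > 0" "\<epsilon> \<longlonglongrightarrow> 0"
    and lw: "locally_integrable w" and ly: "locally_integrable y" and lv: "locally_integrable v"
    and close: "\<And>n. AE x in lebesgue. \<bar>\<phi> n x - w x\<bar> \<le> \<epsilon> n * y x"
    and I: "\<And>n. integrable lebesgue (\<lambda>x. (norm (v x - gradient (\<phi> n) x))\<^sup>2)"
    and L: "\<And>n. (LINT x|lebesgue. (norm (v x - gradient (\<phi> n) x))\<^sup>2) \<le> (\<epsilon> n)\<^sup>2"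
  shows "weak_gradient w v"
proof -
  have squeeze: "f \<longlonglongrightarrow> l" if "\<And>n. \<bar>f n - l\<bar> \<le> \<epsilon> n * Y" for f :: "nat \<Rightarrow> real" and l Y
  proof -
    have "(\<lambda>n. \<epsilon> n * Y) \<longlonglongrightarrow> 0"
      using tendsto_mult_right[OF \<epsilon>(2), of Y] by simp
    then have "(\<lambda>n. f n - l) \<longlonglongrightarrow> 0"
      by (rule Lim_null_comparison[rotated]) (use that in simp)
    then show ?thesis
      by (rule LIM_zero_cancel)
  qed
  have lim1: "(\<lambda>n. LINT x|lebesgue. \<phi> n x * \<psi> x) \<longlonglongrightarrow> (LINT x|lebesgue. w x * \<psi> x)" if \<psi>: "\<psi> \<in> test_functions" for \<psi>
  proof (rule squeeze)
    fix n
    note I1 = integrable_mult_test[OF locally_integrable_test[OF t] \<psi>, of n] and I2 = integrable_mult_test[OF lw \<psi>]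
    have yI: "integrable lebesgue (\<lambda>x. \<bar>y x * \<psi> x\<bar>)"
      by (rule integrable_abs[OF integrable_mult_test[OF ly \<psi>]])
    have "\<bar>(LINT x|lebesgue. \<phi> n x * \<psi> x) - (LINT x|lebesgue. w x * \<psi> x)\<bar> \<le> (LINT x|lebesgue. \<bar>\<phi> n x * \<psi> x - w x * \<psi> x\<bar>)"
      using integral_abs_bound[of lebesgue "\<lambda>x. \<phi> n x * \<psi> x - w x * \<psi> x"] I1 I2 by simp
    also have "\<dots> \<le> (LINT x|lebesgue. \<epsilon> n * \<bar>y x * \<psi> x\<bar>)"
    proof (rule integral_mono_AE[OF integrable_abs[OF Bochner_Integration.integrable_diff[OF I1 I2]] integrable_mult_right[OF yI]])
      show "AE x in lebesgue. \<bar>\<phi> n x * \<psi> x - w x * \<psi> x\<bar> \<le> \<epsilon> n * \<bar>y x * \<psi> x\<bar>"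
        using close[of n]
      proof eventually_elim
        case (elim x)
        have "\<bar>\<phi> n x * \<psi> x - w x * \<psi> x\<bar> = \<bar>\<phi> n x - w x\<bar> * \<bar>\<psi> x\<bar>"
          by (simp flip: left_diff_distrib abs_mult)
        also have "\<dots> \<le> (\<epsilon> n * \<bar>y x\<bar>) * \<bar>\<psi> x\<bar>"
          using order_trans[OF elim mult_left_mono[OF abs_ge_self less_imp_le[OF \<epsilon>(1)]]] by (intro mult_right_mono) auto
        finally show ?case
          by (simp add: abs_mult)
      qed
    qed
    finally show "\<bar>(LINT x|lebesgue. \<phi> n x * \<psi> x) - (LINT x|lebesgue. w x * \<psi> x)\<bar> \<le> \<epsilon> n * (LINT x|lebesgue. \<bar>y x * \<psi> x\<bar>)"
      by simp
  qed
  have lim2: "(\<lambda>n. LINT x|lebesgue. partial i (\<phi> n) x * \<psi> x) \<longlonglongrightarrow> (LINT x|lebesgue. v x $ i * \<psi> x)"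
    if \<psi>: "\<psi> \<in> test_functions" for \<psi> i
  proof (rule squeeze)
    fix n
    define Y where "Y = (LINT x|lebesgue. \<psi> x * \<psi> x)"
    have yI: "integrable lebesgue (\<lambda>x. \<psi> x * \<psi> x)"
      by (rule integrable_test[OF test_mult[OF \<psi> \<psi>]])
    note I1 = integrable_test[OF test_mult[OF test_partial[OF t] \<psi>], of i n]
      and I2 = integrable_mult_test[OF locally_integrable_component[OF lv] \<psi>, of i]
    have "\<bar>(LINT x|lebesgue. partial i (\<phi> n) x * \<psi> x) - (LINT x|lebesgue. v x $ i * \<psi> x)\<bar>
        \<le> (LINT x|lebesgue. \<bar>partial i (\<phi> n) x * \<psi> x - v x $ i * \<psi> x\<bar>)"
      using integral_abs_bound[of lebesgue "\<lambda>x. partial i (\<phi> n) x * \<psi> x - v x $ i * \<psi> x"] I1 I2 by simp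
    also have "\<dots> \<le> (LINT x|lebesgue. inverse (2 * \<epsilon> n) * (norm (v x - gradient (\<phi> n) x))\<^sup>2 + (\<epsilon> n / 2) * (\<psi> x * \<psi> x))"
    proof (rule integral_mono[OF integrable_abs[OF Bochner_Integration.integrable_diff[OF I1 I2]]
          Bochner_Integration.integrable_add[OF integrable_mult_right[OF I] integrable_mult_right[OF yI]]])
      fix x
      define A B where "A = norm (v x - gradient (\<phi> n) x)" and "B = \<bar>\<psi> x\<bar>"
      have "\<bar>partial i (\<phi> n) x - v x $ i\<bar> \<le> A"
        using component_le_norm_cart[of "v x - gradient (\<phi> n) x" i]
        by (simp add: A_def gradient_def abs_minus_commute)
      then have "\<bar>partial i (\<phi> n) x - v x $ i\<bar> * B \<le> A * B"
        by (rule mult_right_mono) (simp add: B_def)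
      moreover have "\<bar>partial i (\<phi> n) x * \<psi> x - v x $ i * \<psi> x\<bar> = \<bar>partial i (\<phi> n) x - v x $ i\<bar> * B"
        by (simp add: B_def flip: left_diff_distrib abs_mult)
      \<comment> \<open>The weight is chosen such that both terms have an integral of order \<open>\<epsilon> n\<close>.\<close>
      moreover have "A * B \<le> inverse (2 * \<epsilon> n) * A\<^sup>2 + (\<epsilon> n / 2) * (B * B)"
      proof -
        have "0 \<le> (A - \<epsilon> n * B)\<^sup>2 * inverse (2 * \<epsilon> n)"
          using \<epsilon>(1)[of n] by simp
        also have "\<dots> = inverse (2 * \<epsilon> n) * A\<^sup>2 + (\<epsilon> n / 2) * (B * B) - A * B"
          using \<epsilon>(1)[of n] by (simp add: field_simps power2_eq_square)
        finally show ?thesis by simp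
      qed
      moreover have "B * B = \<psi> x * \<psi> x"
        by (simp add: B_def)
      ultimately show "\<bar>partial i (\<phi> n) x * \<psi> x - v x $ i * \<psi> x\<bar> \<le>
          inverse (2 * \<epsilon> n) * (norm (v x - gradient (\<phi> n) x))\<^sup>2 + (\<epsilon> n / 2) * (\<psi> x * \<psi> x)"
        by (simp add: A_def)
    qed
    also have "\<dots> = inverse (2 * \<epsilon> n) * (LINT x|lebesgue. (norm (v x - gradient (\<phi> n) x))\<^sup>2) + (\<epsilon> n / 2) * Y"
      unfolding Y_def
      by (subst Bochner_Integration.integral_add[OF integrable_mult_right[OF I] integrable_mult_right[OF yI]]) simp
    also have "\<dots> \<le> inverse (2 * \<epsilon> n) * (\<epsilon> n)\<^sup>2 + (\<epsilon> n / 2) * Y"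
      using \<epsilon>(1)[of n] by (intro add_mono mult_left_mono L order_refl) simp
    also have "\<dots> = \<epsilon> n * ((1 + Y) / 2)"
      using \<epsilon>(1)[of n] by (simp add: field_simps power2_eq_square)
    finally show "\<bar>(LINT x|lebesgue. partial i (\<phi> n) x * \<psi> x) - (LINT x|lebesgue. v x $ i * \<psi> x)\<bar> \<le> \<epsilon> n * ((1 + Y) / 2)" .
  qed
  have "(LINT x|lebesgue. w x * partial i \<psi> x) = - (LINT x|lebesgue. v x $ i * \<psi> x)"
    if \<psi>: "\<psi> \<in> test_functions" for \<psi> i
  proof -
    have "(LINT x|lebesgue. \<phi> n x * partial i \<psi> x) = - (LINT x|lebesgue. partial i (\<phi> n) x * \<psi> x)" for n
      using weak_gradient_test[OF t, of n] \<psi> by (simp add: weak_gradient_locally_integrable gradient_def)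
    then have "(\<lambda>n. LINT x|lebesgue. \<phi> n x * partial i \<psi> x) \<longlonglongrightarrow> - (LINT x|lebesgue. v x $ i * \<psi> x)"
      using tendsto_minus[OF lim2[OF \<psi>, of i]] by simp
    with lim1[OF test_partial[OF \<psi>]] show ?thesis
      by (rule LIMSEQ_unique)
  qed
  then show ?thesis
    using lw lv by (simp add: weak_gradient_locally_integrable)
qed

section \<open>Integration of radial functions\<close>

text \<open>The density of the image of Lebesgue measure on \<open>\<real>\<^sup>N\<close> under \<open>x \<mapsto> x \<bullet> x\<close>: the derivative
  of \<open>t \<mapsto> unit_ball_vol N * t powr (N / 2)\<close>, the volume of the ball of radius \<open>sqrt t\<close>.\<close>

definition radial_density :: "nat \<Rightarrow> real \<Rightarrow> real" where
  "radial_density N t = (if t > 0 then unit_ball_vol (real N) * (real N / 2) * t powr (real N / 2 - 1) else 0)"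

lemma radial_density_nonneg: "radial_density N t \<ge> 0"
  by (simp add: radial_density_def)

lemma radial_density_borel [measurable]: "radial_density N \<in> borel_measurable borel"
  unfolding radial_density_def by measurable

lemma nn_integral_radial_density:
  assumes "N > 0"
  shows "(\<integral>\<^sup>+ t. ennreal (radial_density N t) * indicator {..a} t \<partial>lborel) =
    (if a < 0 then 0 else ennreal (unit_ball_vol (real N) * a powr (real N / 2)))"
proof (cases "a < 0")
  case True
  have "ennreal (radial_density N t) * indicator {..a} t = 0" for t
    using True by (simp add: radial_density_def indicator_def)
  then show ?thesis
    using True by (simp only: nn_integral_const if_True) simp
next
  case False
  let ?c = "unit_ball_vol (real N) * (real N / 2)"
  have "((\<lambda>t. ?c * t powr (real N / 2 - 1)) has_integral
      ?c * (a powr (real N / 2 - 1 + 1) / (real N / 2 - 1 + 1))) {0..a}"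
    using False assms by (intro has_integral_mult_right has_integral_powr_from_0) auto
  then have "((\<lambda>t. ?c * t powr (real N / 2 - 1)) has_integral unit_ball_vol (real N) * a powr (real N / 2)) {0..a}"
    using assms by simp
  then have "(\<integral>\<^sup>+ t. indicator {0..a} t * (?c * t powr (real N / 2 - 1)) \<partial>lborel) =
      ennreal (unit_ball_vol (real N) * a powr (real N / 2))"
    by (rule nn_integral_has_integral_lebesgue[rotated]) simp
  also have "(\<integral>\<^sup>+ t. indicator {0..a} t * (?c * t powr (real N / 2 - 1)) \<partial>lborel) =
      (\<integral>\<^sup>+ t. ennreal (radial_density N t) * indicator {..a} t \<partial>lborel)"
    by (rule nn_integral_cong) (auto simp: radial_density_def indicator_def)
  finally show ?thesis
    using False by simp
qed

text \<open>Both measures assign to a half-line up to \<open>a\<close> the volume of the ball of radius \<open>sqrt a\<close>.\<close>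

lemma distr_inner_self:
  "distr lborel borel (\<lambda>x::real^'n. x \<bullet> x) = density lborel (\<lambda>t. ennreal (radial_density CARD('n) t))"
proof (rule measure_eqI_generator_eq[where E = "range (\<lambda>a::real. {..a})" and \<Omega> = UNIV and A = "\<lambda>n. {..real n}"])
  have eq: "emeasure (distr lborel borel (\<lambda>x::real^'n. x \<bullet> x)) {..a} =
      (if a < 0 then 0 else ennreal (unit_ball_vol (real CARD('n)) * a powr (real CARD('n) / 2)))" for a
  proof -
    have "emeasure (distr lborel borel (\<lambda>x::real^'n. x \<bullet> x)) {..a} = emeasure lborel {x::real^'n. x \<bullet> x \<le> a}"
      by (subst emeasure_distr) (auto simp: vimage_def)
    also have "\<dots> = (if a < 0 then 0 else ennreal (unit_ball_vol (real CARD('n)) * a powr (real CARD('n) / 2)))"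
    proof (cases "a < 0")
      case True
      then have "{x::real^'n. x \<bullet> x \<le> a} = {}"
        by (auto simp: not_le intro: less_le_trans)
      then show ?thesis using True by simp
    next
      case False
      then have "{x::real^'n. x \<bullet> x \<le> a} = cball 0 (sqrt a)"
        by (auto simp: norm_eq_sqrt_inner)
      moreover have "sqrt a ^ CARD('n) = a powr (real CARD('n) / 2)"
      proof (cases "a = 0")
        case False
        with \<open>\<not> a < 0\<close> have "a > 0" by simp
        then show ?thesis
          by (simp add: powr_half_sqrt[symmetric] powr_powr flip: powr_realpow)
      qed simp
      ultimately show ?thesis
        using False emeasure_cball[of "sqrt a" "0::real^'n"] by simp
    qed
    finally show ?thesis .
  qed
  show "emeasure (distr lborel borel (\<lambda>x::real^'n. x \<bullet> x)) X =
      emeasure (density lborel (\<lambda>t. ennreal (radial_density CARD('n) t))) X" if "X \<in> range (\<lambda>a::real. {..a})" for X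
    using that by (auto simp: eq emeasure_density nn_integral_radial_density)
  show "emeasure (distr lborel borel (\<lambda>x::real^'n. x \<bullet> x)) {..real n} \<noteq> \<infinity>" for n
    by (simp add: eq)
  show "(\<Union>n. {..real n}) = UNIV"
    using real_arch_simple by auto
  show "Int_stable (range (\<lambda>a::real. {..a}))"
    by (auto simp: Int_stable_def)
qed (auto simp: borel_eq_atMost)

lemma
  fixes p :: "real \<Rightarrow> real"
  assumes [measurable]: "p \<in> borel_measurable borel"
  shows integral_radial: "(LINT x|lebesgue. p ((x::real^'n) \<bullet> x)) = (LINT t|lborel. radial_density CARD('n) t * p t)"
    and integrable_radial: "integrable lebesgue (\<lambda>x::real^'n. p (x \<bullet> x)) \<longleftrightarrow>
      integrable lborel (\<lambda>t. radial_density CARD('n) t * p t)"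
proof -
  have m: "(\<lambda>x::real^'n. p (x \<bullet> x)) \<in> borel_measurable lborel"
    by measurable
  have "(LINT x|lebesgue. p ((x::real^'n) \<bullet> x)) = (LINT t|distr lborel borel (\<lambda>x::real^'n. x \<bullet> x). p t)"
    by (subst integral_distr) (auto simp: integral_completion[OF m])
  then show "(LINT x|lebesgue. p ((x::real^'n) \<bullet> x)) = (LINT t|lborel. radial_density CARD('n) t * p t)"
    unfolding distr_inner_self by (simp add: integral_density radial_density_nonneg)
  have "integrable lebesgue (\<lambda>x::real^'n. p (x \<bullet> x)) \<longleftrightarrow> integrable (distr lborel borel (\<lambda>x::real^'n. x \<bullet> x)) p"
    by (subst integrable_distr_eq) (auto simp: integrable_completion[OF m])
  then show "integrable lebesgue (\<lambda>x::real^'n. p (x \<bullet> x)) \<longleftrightarrow>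
      integrable lborel (\<lambda>t. radial_density CARD('n) t * p t)"
    unfolding distr_inner_self by (simp add: integrable_density radial_density_nonneg)
qed

section \<open>Pointwise decay of radial functions\<close>

lemma test_has_derivative:
  assumes "\<phi> \<in> test_functions"
  shows "(\<phi> has_derivative (\<lambda>y. gradient \<phi> x \<bullet> y)) (at x)"
proof -
  let ?D = "frechet_derivative \<phi> (at x)"
  have D: "(\<phi> has_derivative ?D) (at x)"
    using test_differentiable[OF assms] by (simp add: frechet_derivative_works)
  have lin: "linear ?D"
    using linear_frechet_derivative[OF test_differentiable[OF assms]] .
  have "?D y = gradient \<phi> x \<bullet> y" for y
  proof -
    have "?D y = ?D (\<Sum>i\<in>UNIV. (y $ i) *\<^sub>R axis i 1)"
      using basis_expansion[of y] by (simp add: scalar_mult_eq_scaleR)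
    also have "\<dots> = (\<Sum>i\<in>UNIV. y $ i * partial i \<phi> x)"
      by (simp add: linear_sum[OF lin] linear_cmul[OF lin] partial_def)
    finally show ?thesis
      by (simp add: gradient_def inner_vec_def mult.commute)
  qed
  then have "?D = (\<lambda>y. gradient \<phi> x \<bullet> y)" by blast
  with D show ?thesis by simp
qed

lemma gradient_continuous: "\<phi> \<in> test_functions \<Longrightarrow> continuous_on S (gradient \<phi>)"
  unfolding gradient_def[abs_def] by (intro continuous_on_vec_lambda test_continuous test_partial)

lemma integrable_gradient_sq:
  assumes "\<phi> \<in> test_functions" shows "integrable lebesgue (\<lambda>y. (norm (gradient \<phi> y))\<^sup>2)"
proof -
  have "(\<lambda>y. (norm (gradient \<phi> y))\<^sup>2) = (\<lambda>y. \<Sum>i\<in>UNIV. partial i \<phi> y * partial i \<phi> y)"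
    by (simp add: power2_norm_eq_inner inner_vec_def gradient_def)
  then show ?thesis
    using test_mult[OF test_partial[OF assms] test_partial[OF assms]] by (simp add: integrable_test)
qed

text \<open>If \<open>\<phi> x = \<Phi> (x \<bullet> x)\<close>, then the squared gradient is \<open>4 * t * (\<Phi>' t)\<^sup>2\<close> at \<open>t = x \<bullet> x\<close>, so the Dirichlet
  integral controls the integral of \<open>4 * t powr m * (\<Phi>' t)\<^sup>2\<close>. The value \<open>\<Phi> s\<close> is minus the integral of
  \<open>\<Phi>' = (2 * t powr (m / 2) * \<Phi>') * (t powr (- m / 2) / 2)\<close> over the half-line from \<open>s\<close> on, and the square of
  the second factor is integrable there because \<open>m > 1\<close>.\<close>

lemma radial_test_decay:
  fixes \<phi> :: "real^'n \<Rightarrow> real"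
  assumes N: "CARD('n) \<ge> 3" and \<phi>: "\<phi> \<in> radial_test_functions"
    and E: "(LINT x|lebesgue. (norm (gradient \<phi> x))\<^sup>2) \<le> \<epsilon>\<^sup>2" and \<epsilon>: "\<epsilon> > 0" and x: "x \<noteq> 0"
  defines "m \<equiv> real CARD('n) / 2"
  shows "\<bar>\<phi> x\<bar> \<le> (1 / (2 * unit_ball_vol (real CARD('n)) * m) + 1 / (8 * (m - 1))) * \<epsilon> * (x \<bullet> x) powr ((1 - m) / 2)"
proof -
  have t: "\<phi> \<in> test_functions"
    using \<phi> by (simp add: radial_test_functions_def)
  have rad: "\<phi> x = \<phi> y" if "norm x = norm y" for x y
    using \<phi> that unfolding radial_test_functions_def by blast
  have m: "m > 1" "real CARD('n) / 2 = m"
    using N by (simp_all add: m_def)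
  define \<kappa> where "\<kappa> = unit_ball_vol (real CARD('n)) * m"
  have \<kappa>: "\<kappa> > 0"
    using m by (simp add: \<kappa>_def)
  obtain i :: 'n where True by simp
  define e where "e = (axis i 1 :: real^'n)"
  have e: "norm e = 1"
    by (simp add: e_def norm_axis_1)
  define \<Phi> where "\<Phi> t = \<phi> (sqrt t *\<^sub>R e)" for t
  define \<Phi>' where "\<Phi>' t = (gradient \<phi> (sqrt t *\<^sub>R e) \<bullet> e) * (inverse (sqrt t) / 2)" for t
  define p where "p t = (norm (gradient \<phi> (sqrt t *\<^sub>R e)))\<^sup>2" for t
  have \<phi>_eq: "\<phi> y = \<Phi> (y \<bullet> y)" for y
    unfolding \<Phi>_def by (rule rad) (simp add: e norm_eq_sqrt_inner[of y])
  have \<phi>_fun: "\<phi> = (\<lambda>y. \<Phi> (y \<bullet> y))"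
    using \<phi>_eq by blast
  have d: "(\<Phi> has_real_derivative \<Phi>' t) (at t)" if "t > 0" for t
  proof -
    have "(sqrt has_derivative (\<lambda>h. h * (inverse (sqrt t) / 2))) (at t)"
      by (rule has_derivative_eq_rhs[OF DERIV_real_sqrt[OF that, unfolded has_field_derivative_def]])
        (simp add: fun_eq_iff)
    from has_derivative_compose[OF has_derivative_scaleR_left[OF this, of e] test_has_derivative[OF t]]
    have "(\<Phi> has_derivative (\<lambda>h. gradient \<phi> (sqrt t *\<^sub>R e) \<bullet> ((h * (inverse (sqrt t) / 2)) *\<^sub>R e))) (at t)"
      unfolding \<Phi>_def .
    moreover have "(\<lambda>h. gradient \<phi> (sqrt t *\<^sub>R e) \<bullet> ((h * (inverse (sqrt t) / 2)) *\<^sub>R e)) = (*) (\<Phi>' t)"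
      by (simp add: fun_eq_iff \<Phi>'_def)
    ultimately show ?thesis
      by (simp only: has_field_derivative_def)
  qed
  have grad: "(norm (gradient \<phi> y))\<^sup>2 = 4 * (y \<bullet> y) * (\<Phi>' (y \<bullet> y))\<^sup>2" if "y \<noteq> 0" for y
  proof -
    have "(\<Phi> has_real_derivative \<Phi>' (y \<bullet> y)) (at (y \<bullet> y))"
      using that by (intro d) simp
    from partial_radial[OF this] have "gradient \<phi> y = (2 * \<Phi>' (y \<bullet> y)) *\<^sub>R y"
      unfolding gradient_def \<phi>_fun[symmetric] by (simp add: vec_eq_iff)
    then show ?thesis
      by (simp add: power_mult_distrib dot_square_norm)
  qed
  have p_eq: "p t = 4 * t * (\<Phi>' t)\<^sup>2" if "t > 0" for t
  proof -
    have "e \<noteq> 0" using e by auto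
    then show ?thesis
      using grad[of "sqrt t *\<^sub>R e"] that e unfolding p_def by (simp add: dot_square_norm)
  qed
  have norm_grad: "(norm (gradient \<phi> y))\<^sup>2 = p (y \<bullet> y)" for y
    by (cases "y = 0") (simp_all add: grad p_eq, simp add: p_def)
  have p_cont: "continuous_on UNIV p"
    unfolding p_def
    by (intro continuous_on_power continuous_on_norm
        continuous_on_compose2[OF gradient_continuous[OF t, of UNIV]] continuous_intros subset_UNIV)
  have p_borel: "p \<in> borel_measurable borel"
    by (rule borel_measurable_continuous_onI[OF p_cont])
  have p0: "p t \<ge> 0" for t
    by (simp add: p_def)
  let ?w = "\<lambda>t. radial_density CARD('n) t * p t"
  have w: "?w t = \<kappa> * (t powr (m - 1) * p t)" if "t > 0" for t
    using that m by (simp add: radial_density_def \<kappa>_def)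
  have "integrable lebesgue (\<lambda>y. (norm (gradient \<phi> y))\<^sup>2)"
    by (rule integrable_gradient_sq[OF t])
  then have wI: "integrable lborel ?w" and E': "(LINT t|lborel. ?w t) \<le> \<epsilon>\<^sup>2"
    using E unfolding norm_grad integrable_radial[OF p_borel] integral_radial[OF p_borel] by simp_all
  define s where "s = x \<bullet> x"
  have s: "s > 0"
    using x by (simp add: s_def)
  obtain R where R: "R > 0" "\<forall>x. norm x > R \<longrightarrow> \<phi> x = 0"
    using test_support[OF t] by blast
  define T where "T = s + (R + 1)\<^sup>2"
  have T: "s < T" "\<Phi> T = 0"
  proof -
    show "s < T" using R by (simp add: T_def)
    have "(R + 1)\<^sup>2 \<le> T" using s by (simp add: T_def)
    then have "R + 1 \<le> sqrt T"
      using real_le_rsqrt by blast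
    then show "\<Phi> T = 0"
      using R e by (simp add: \<Phi>_def)
  qed
  \<comment> \<open>The weight in Young's inequality that balances the two resulting integrals.\<close>
  define l where "l = s powr ((1 - m) / 2) / \<epsilon>"
  have l: "l > 0"
    using s \<epsilon> by (simp add: l_def)
  define h1 where "h1 t = t powr (m - 1) * p t" for t
  define h2 where "h2 t = t powr (- m)" for t
  have h1c: "continuous_on {s..T} h1" and h2c: "continuous_on {s..T} h2"
    unfolding h1_def h2_def using s continuous_on_subset[OF p_cont] by (auto intro!: continuous_intros)
  have \<Phi>_int: "(\<Phi>' has_integral (\<Phi> T - \<Phi> s)) {s..T}"
    using d s T by (intro fundamental_theorem_of_calculus)
      (auto simp: has_real_derivative_iff_has_vector_derivative[symmetric] intro: has_field_derivative_at_within)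
  have le: "\<bar>\<Phi>' t\<bar> \<le> l / 2 * h1 t + 1 / (8 * l) * h2 t" if "t \<in> {s..T}" for t
  proof -
    have t0: "t > 0" using that s by auto
    define a where "a = 2 * t powr (m / 2) * \<bar>\<Phi>' t\<bar>"
    define b where "b = t powr (- m / 2) / 2"
    have "t powr (m / 2) * t powr (- m / 2) = 1"
      using t0 by (simp flip: powr_add)
    then have ab: "a * b = \<bar>\<Phi>' t\<bar>"
      by (simp add: a_def b_def mult.commute mult.left_commute)
    have A: "t powr (m / 2) * t powr (m / 2) = t powr (m - 1) * t"
      using t0 powr_add[of t "m - 1" 1] powr_add[of t "m / 2" "m / 2"] by simp
    have "a\<^sup>2 = 4 * (t powr (m / 2) * t powr (m / 2)) * (\<Phi>' t)\<^sup>2"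
      by (simp add: a_def power_mult_distrib power2_eq_square)
    then have a2: "a\<^sup>2 = h1 t"
      unfolding A by (simp add: h1_def p_eq[OF t0])
    have b2: "b\<^sup>2 = h2 t / 4"
      using powr_add[of t "- m / 2" "- m / 2"] by (simp add: b_def h2_def power2_eq_square)
    have "0 \<le> (l * a - b)\<^sup>2 / (2 * l)"
      using l by simp
    also have "(l * a - b)\<^sup>2 / (2 * l) = l / 2 * a\<^sup>2 + b\<^sup>2 / (2 * l) - a * b"
      using l by (simp add: power2_eq_square field_simps)
    finally show ?thesis
      using l unfolding ab a2 b2 by (simp add: field_simps)
  qed
  have int1: "h1 integrable_on {s..T}" and int2: "h2 integrable_on {s..T}"
    by (auto intro: integrable_continuous_interval h1c h2c)
  have i1: "(\<lambda>t. l / 2 * h1 t) integrable_on {s..T}" and i2: "(\<lambda>t. 1 / (8 * l) * h2 t) integrable_on {s..T}"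
    by (rule integrable_on_mult_right[OF int1], rule integrable_on_mult_right[OF int2])
  have bound: "\<bar>\<Phi> s\<bar> \<le> integral {s..T} (\<lambda>t. l / 2 * h1 t + 1 / (8 * l) * h2 t)"
  proof -
    have "norm (integral {s..T} \<Phi>') \<le> integral {s..T} (\<lambda>t. l / 2 * h1 t + 1 / (8 * l) * h2 t)"
      by (rule integral_norm_bound_integral) (use \<Phi>_int integrable_add[OF i1 i2] le in auto)
    then show ?thesis
      using integral_unique[OF \<Phi>_int] T by simp
  qed
  have split: "integral {s..T} (\<lambda>t. l / 2 * h1 t + 1 / (8 * l) * h2 t) =
      l / 2 * integral {s..T} h1 + 1 / (8 * l) * integral {s..T} h2"
    using integral_add[OF i1 i2] by (simp only: integral_mult_right)
  have b1: "integral {s..T} h1 \<le> \<epsilon>\<^sup>2 / \<kappa>"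
  proof -
    have "integral {s..T} h1 = (LINT t:{s..T}|lborel. h1 t)"
      by (rule set_borel_integral_eq_integral(2)[symmetric]) (rule borel_integrable_atLeastAtMost'[OF h1c])
    also have "\<dots> \<le> (LINT t|lborel. ?w t / \<kappa>)"
      unfolding set_lebesgue_integral_def
    proof (rule integral_mono)
      show "integrable lborel (\<lambda>t. indicat_real {s..T} t *\<^sub>R h1 t)"
        using borel_integrable_atLeastAtMost'[OF h1c] by (simp add: set_integrable_def)
      show "integrable lborel (\<lambda>t. ?w t / \<kappa>)"
        using wI by simp
      show "indicat_real {s..T} t *\<^sub>R h1 t \<le> ?w t / \<kappa>" for t
        using w[of t] \<kappa> s p0[of t] radial_density_nonneg[of "CARD('n)" t] by (auto simp: h1_def indicator_def)
    qed
    also have "\<dots> \<le> \<epsilon>\<^sup>2 / \<kappa>"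
      using E' \<kappa> by (simp add: divide_right_mono)
    finally show ?thesis .
  qed
  have b2: "integral {s..T} h2 \<le> s powr (1 - m) / (m - 1)"
  proof -
    have "((\<lambda>t. - (t powr (1 - m)) / (m - 1)) has_real_derivative h2 t) (at t within {s..T})" if "t \<in> {s..T}" for t
    proof -
      have "((\<lambda>t. t powr (1 - m)) has_real_derivative (1 - m) * t powr (1 - m - 1)) (at t)"
        using that s by (intro has_real_derivative_powr) auto
      then have "((\<lambda>t. - (t powr (1 - m)) / (m - 1)) has_real_derivative - ((1 - m) * t powr (1 - m - 1)) / (m - 1)) (at t)"
        by (intro DERIV_cdivide DERIV_minus)
      moreover have "- ((1 - m) * t powr (1 - m - 1)) / (m - 1) = h2 t"
        using m by (simp add: h2_def field_simps)
      ultimately show ?thesis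
        by (metis has_field_derivative_at_within)
    qed
    then have "(h2 has_integral (- (T powr (1 - m)) / (m - 1) - - (s powr (1 - m)) / (m - 1))) {s..T}"
      using T by (intro fundamental_theorem_of_calculus) (auto simp: has_real_derivative_iff_has_vector_derivative)
    from integral_unique[OF this] show ?thesis
      using m by simp
  qed
  have "\<bar>\<Phi> s\<bar> \<le> l / 2 * (\<epsilon>\<^sup>2 / \<kappa>) + 1 / (8 * l) * (s powr (1 - m) / (m - 1))"
    by (rule order_trans[OF bound[unfolded split]]) (intro add_mono mult_left_mono b1 b2; use l in simp)
  also have "s powr (1 - m) = s powr ((1 - m) / 2) * s powr ((1 - m) / 2)"
    by (simp flip: powr_add)
  also have "l / 2 * (\<epsilon>\<^sup>2 / \<kappa>) + 1 / (8 * l) * (s powr ((1 - m) / 2) * s powr ((1 - m) / 2) / (m - 1)) =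
      (1 / (2 * \<kappa>) + 1 / (8 * (m - 1))) * \<epsilon> * s powr ((1 - m) / 2)"
    using s \<epsilon> m \<kappa> by (simp add: l_def field_simps power2_eq_square)
  finally show ?thesis
    by (simp add: \<phi>_eq s_def \<kappa>_def mult.assoc)
qed

section \<open>The radial representative\<close>

lemma locally_integrable_measurable:
  fixes v :: "'a::euclidean_space \<Rightarrow> 'b::euclidean_space"
  assumes "locally_integrable v" shows "v \<in> borel_measurable lebesgue"
proof (rule borel_measurable_LIMSEQ_metric)
  show "(\<lambda>x. indicat_real (cball 0 (real n)) x *\<^sub>R v x) \<in> borel_measurable lebesgue" for n
    by (rule borel_measurable_integrable[OF locally_integrable_integrable[OF assms compact_cball]])
  show "(\<lambda>n. indicat_real (cball 0 (real n)) x *\<^sub>R v x) \<longlonglongrightarrow> v x" for x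
  proof (rule tendsto_eventually)
    obtain m where "norm x \<le> real m"
      using real_arch_simple by blast
    then show "\<forall>\<^sub>F n in sequentially. indicat_real (cball 0 (real n)) x *\<^sub>R v x = v x"
      unfolding eventually_sequentially by (intro exI[of _ m]) (auto simp: indicator_def)
  qed
qed

lemma weak_gradient_wgrad: "weak_gradient u v \<Longrightarrow> weak_gradient u (wgrad u)"
  unfolding wgrad_def using someI[of "weak_gradient u" v] by simp

lemma
  assumes "weak_gradient u v"
  shows integrable_wgrad: "integrable lebesgue (\<lambda>x. (norm (wgrad u x))\<^sup>2) \<longleftrightarrow> integrable lebesgue (\<lambda>x. (norm (v x))\<^sup>2)"
    and integral_wgrad: "(LINT x|lebesgue. (norm (wgrad u x))\<^sup>2) = (LINT x|lebesgue. (norm (v x))\<^sup>2)"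
proof -
  note w = weak_gradient_wgrad[OF assms]
  have AE: "AE x in lebesgue. wgrad u x = v x"
    by (rule weak_gradient_unique[OF w assms]) simp
  have "wgrad u \<in> borel_measurable lebesgue" "v \<in> borel_measurable lebesgue"
    using w assms by (auto simp: weak_gradient_locally_integrable intro: locally_integrable_measurable)
  then have m: "(\<lambda>x. (norm (wgrad u x))\<^sup>2) \<in> borel_measurable lebesgue" "(\<lambda>x. (norm (v x))\<^sup>2) \<in> borel_measurable lebesgue"
    by measurable
  from AE have AE2: "AE x in lebesgue. (norm (wgrad u x))\<^sup>2 = (norm (v x))\<^sup>2"
    by eventually_elim simp
  show "integrable lebesgue (\<lambda>x. (norm (wgrad u x))\<^sup>2) \<longleftrightarrow> integrable lebesgue (\<lambda>x. (norm (v x))\<^sup>2)"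
    by (rule integrable_cong_AE[OF m AE2])
  show "(LINT x|lebesgue. (norm (wgrad u x))\<^sup>2) = (LINT x|lebesgue. (norm (v x))\<^sup>2)"
    by (rule integral_cong_AE[OF m AE2])
qed

lemma D12_weak_gradient:
  assumes "u \<in> D12"
  shows "weak_gradient u (wgrad u)" "integrable lebesgue (\<lambda>x. (norm (wgrad u x))\<^sup>2)"
proof -
  obtain v where v: "weak_gradient u v" "integrable lebesgue (\<lambda>x. (norm (v x))\<^sup>2)"
    using assms by (auto simp: D12_def)
  show "weak_gradient u (wgrad u)"
    by (rule weak_gradient_wgrad[OF v(1)])
  show "integrable lebesgue (\<lambda>x. (norm (wgrad u x))\<^sup>2)"
    using v(2) by (simp add: integrable_wgrad[OF v(1)])
qed

lemma dirichlet_norm_eq: "weak_gradient u v \<Longrightarrow> (dirichlet_norm u)\<^sup>2 = (LINT x|lebesgue. (norm (v x))\<^sup>2)"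
  by (simp add: dirichlet_norm_def integral_wgrad)

text \<open>Above the level \<open>d\<close>, a function is dominated by a multiple of its \<open>p\<close>-th power.\<close>

lemma power_split_bound:
  fixes a :: real
  assumes "d > 0" "p > 1" "a \<ge> 0"
  shows "a \<le> d + d powr (1 - p) * a powr p"
proof (cases "a \<le> d")
  case True
  then show ?thesis by (simp add: add_increasing2)
next
  case False
  then have "a powr (1 - p) \<le> d powr (1 - p)"
    using assms by (intro powr_mono2') auto
  then have "a powr (1 - p) * a powr p \<le> d powr (1 - p) * a powr p"
    by (rule mult_right_mono) simp
  moreover have "a powr (1 - p) * a powr p = a"
    using False assms by (simp flip: powr_add)
  ultimately show ?thesis
    using assms by linarith
qed

lemma D12_small_at_infinity:
  fixes u :: "real^'n \<Rightarrow> real"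
  assumes "CARD('n) \<ge> 3" "u \<in> D12"
  shows "small_at_infinity u"
  unfolding small_at_infinity_def
proof (intro allI impI exI conjI)
  fix d :: real assume d: "d > 0"
  let ?p = "2 * real CARD('n) / (real CARD('n) - 2)"
  have "?p > 1"
    using assms(1) by (simp add: field_simps)
  then show "AE x in lebesgue. \<bar>u x\<bar> \<le> d + d powr (1 - ?p) * \<bar>u x\<bar> powr ?p"
    using power_split_bound[OF d, of ?p] by simp
  show "integrable lebesgue (\<lambda>x. d powr (1 - ?p) * \<bar>u x\<bar> powr ?p)"
    using assms(2) by (simp add: D12_def)
qed

lemma gradient_diff:
  assumes "\<phi> \<in> test_functions" "\<psi> \<in> test_functions"
  shows "gradient (\<lambda>x. \<phi> x + - 1 * \<psi> x) x = gradient \<phi> x - gradient \<psi> x"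
proof -
  have d: "((\<lambda>x. - 1 * \<psi> x) has_derivative (\<lambda>y. - 1 * (gradient \<psi> x \<bullet> y))) (at x)"
    by (rule has_derivative_mult_right[OF test_has_derivative[OF assms(2)]])
  have "partial i (\<lambda>x. \<phi> x + - 1 * \<psi> x) x = partial i \<phi> x - partial i \<psi> x" for i
    using partial_eqI[OF has_derivative_add[OF test_has_derivative[OF assms(1)] d], of i]
    by (simp add: inner_axis gradient_def)
  then show ?thesis
    by (simp add: gradient_def vec_eq_iff)
qed

text \<open>The parallelogram identity.\<close>

lemma sq_norm_diff_le:
  fixes a b c :: "'a::real_inner"
  shows "(norm (b - c))\<^sup>2 \<le> 2 * (norm (a - b))\<^sup>2 + 2 * (norm (a - c))\<^sup>2"
proof -
  have "0 \<le> (norm ((a - b) + (a - c)))\<^sup>2" by simp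
  moreover have "(norm (b - c))\<^sup>2 + (norm ((a - b) + (a - c)))\<^sup>2 = 2 * (norm (a - b))\<^sup>2 + 2 * (norm (a - c))\<^sup>2"
    by (simp add: power2_norm_eq_inner algebra_simps inner_commute)
  ultimately show ?thesis by linarith
qed

lemma locally_integrable_bound:
  fixes w z :: "'a::euclidean_space \<Rightarrow> real"
  assumes z: "locally_integrable z" and w: "w \<in> borel_measurable borel"
    and le: "AE x in lebesgue. \<bar>w x\<bar> \<le> z x"
  shows "locally_integrable w"
  unfolding locally_integrable_def set_integrable_def
proof safe
  fix S :: "'a set" assume S: "compact S"
  show "integrable lebesgue (\<lambda>x. indicat_real S x *\<^sub>R w x)"
  proof (rule Bochner_Integration.integrable_bound[OF locally_integrable_integrable[OF z S]])
    show "(\<lambda>x. indicat_real S x *\<^sub>R w x) \<in> borel_measurable lebesgue"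
      using S w
      by (intro borel_imp_lebesgue_measurable borel_measurable_scaleR borel_measurable_indicator)
        (auto simp: compact_imp_closed borel_closed)
    show "AE x in lebesgue. norm (indicat_real S x *\<^sub>R w x) \<le> norm (indicat_real S x *\<^sub>R z x)"
      using le by eventually_elim (auto simp: indicator_def)
  qed
qed

text \<open>Multiplied with the radial density, the power becomes bounded on bounded intervals.\<close>

lemma locally_integrable_radial_power:
  assumes a: "a \<le> 0" "real CARD('n) / 2 - 1 + a \<ge> 0"
  shows "locally_integrable (\<lambda>x::real^'n. (x \<bullet> x) powr a)"
  unfolding locally_integrable_def set_integrable_def
proof safe
  fix S :: "(real^'n) set" assume S: "compact S"
  then obtain R where R: "R > 0" "\<And>x. x \<in> S \<Longrightarrow> norm x \<le> R"
    using compact_imp_bounded bounded_pos by metis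
  define r where "r = R\<^sup>2"
  let ?c = "unit_ball_vol (real CARD('n)) * (real CARD('n) / 2)"
  let ?b = "real CARD('n) / 2 - 1 + a"
  have m: "(\<lambda>t. t powr a * indicat_real {..r} t) \<in> borel_measurable borel"
    by measurable
  have "integrable lborel (\<lambda>t. radial_density CARD('n) t * (t powr a * indicat_real {..r} t))"
  proof (rule Bochner_Integration.integrable_bound)
    show "integrable lborel (\<lambda>t. (?c * r powr ?b) * indicat_real {0..r} t)"
    proof (rule integrable_mult_right)
      show "integrable lborel (indicat_real {0..r})"
        using borel_integrable_compact[of "{0..r}" "\<lambda>_. 1::real"] by simp
    qed
    have "\<bar>radial_density CARD('n) t * (t powr a * indicat_real {..r} t)\<bar> \<le> \<bar>(?c * r powr ?b) * indicat_real {0..r} t\<bar>" for t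
    proof (cases "t > 0 \<and> t \<le> r")
      case True
      then have "t powr ?b \<le> r powr ?b"
        using a by (intro powr_mono2) auto
      then have "?c * t powr ?b \<le> ?c * r powr ?b"
        by (intro mult_left_mono) auto
      moreover have "t powr (real CARD('n) / 2 - 1) * t powr a = t powr ?b"
        by (simp flip: powr_add)
      ultimately show ?thesis
        using True by (simp add: radial_density_def abs_mult mult.assoc)
    qed (auto simp: radial_density_def indicator_def)
    then show "AE t in lborel. norm (radial_density CARD('n) t * (t powr a * indicat_real {..r} t)) \<le>
        norm ((?c * r powr ?b) * indicat_real {0..r} t)"
      by simp
  qed measurable
  then have I: "integrable lebesgue (\<lambda>x::real^'n. ((x \<bullet> x) powr a) * indicator {..r} (x \<bullet> x))"
    using integrable_radial[OF m, where 'n = 'n] by simp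
  show "integrable lebesgue (\<lambda>x. indicat_real S x *\<^sub>R (x \<bullet> x) powr a)"
  proof (rule Bochner_Integration.integrable_bound[OF I])
    show "(\<lambda>x::real^'n. indicat_real S x *\<^sub>R (x \<bullet> x) powr a) \<in> borel_measurable lebesgue"
      using S
      by (intro borel_imp_lebesgue_measurable borel_measurable_scaleR borel_measurable_indicator)
        (auto simp: compact_imp_closed borel_closed)
    have "indicat_real S x \<le> indicator {..r} (x \<bullet> x)" for x
      using R(2)[of x] power_mono[of "norm x" R 2] by (auto simp: r_def indicator_def dot_square_norm)
    then have "\<bar>indicat_real S x *\<^sub>R (x \<bullet> x) powr a\<bar> \<le> \<bar>((x \<bullet> x) powr a) * indicator {..r} (x \<bullet> x)\<bar>" for x
      using mult_left_mono[of "indicat_real S x" "indicator {..r} (x \<bullet> x)" "(x \<bullet> x) powr a"]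
      by (simp add: abs_mult mult.commute)
    then show "AE x in lebesgue. norm (indicat_real S x *\<^sub>R (x \<bullet> x) powr a) \<le> norm (((x \<bullet> x) powr a) * indicator {..r} (x \<bullet> x))"
      by simp
  qed
qed

lemma small_at_infinity_if_tendsto_0:
  fixes w :: "'a::euclidean_space \<Rightarrow> real"
  assumes lw: "locally_integrable w" and far: "\<And>d. d > 0 \<Longrightarrow> \<exists>r. \<forall>x. norm x > r \<longrightarrow> \<bar>w x\<bar> \<le> d"
  shows "small_at_infinity w"
  unfolding small_at_infinity_def
proof (intro allI impI)
  fix d :: real assume d: "d > 0"
  then obtain r where r: "\<forall>x. norm x > r \<longrightarrow> \<bar>w x\<bar> \<le> d"
    using far by blast
  have le: "\<bar>w x\<bar> \<le> d + \<bar>indicat_real (cball 0 r) x *\<^sub>R w x\<bar>" for x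
    using r d by (cases "norm x > r") auto
  show "\<exists>q. integrable lebesgue q \<and> (AE x in lebesgue. \<bar>w x\<bar> \<le> d + q x)"
  proof (intro exI conjI)
    show "integrable lebesgue (\<lambda>x. \<bar>indicat_real (cball 0 r) x *\<^sub>R w x\<bar>)"
      by (rule integrable_abs[OF locally_integrable_integrable[OF lw compact_cball]])
    show "AE x in lebesgue. \<bar>w x\<bar> \<le> d + \<bar>indicat_real (cball 0 r) x *\<^sub>R w x\<bar>"
      by (rule always_eventually) (use le in blast)
  qed
qed

lemma locally_uniform_limit:
  fixes \<Phi> :: "nat \<Rightarrow> real \<Rightarrow> real"
  assumes \<Phi>c: "\<And>n S. continuous_on S (\<Phi> n)" and a: "a \<le> 0" and \<epsilon>: "\<And>n. \<epsilon> n > 0" "\<epsilon> \<longlonglongrightarrow> 0"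
    and diff: "\<And>n k s. n \<le> k \<Longrightarrow> s > 0 \<Longrightarrow> \<bar>\<Phi> n s - \<Phi> k s\<bar> \<le> \<epsilon> n * s powr a"
  shows "\<exists>U. continuous_on {0<..} U \<and> (\<forall>n. \<forall>s>0. \<bar>\<Phi> n s - U s\<bar> \<le> \<epsilon> n * s powr a)"
proof -
  define U where "U s = lim (\<lambda>n. \<Phi> n s)" for s
  have vanish: "\<forall>\<^sub>F n in sequentially. \<epsilon> n * K < r" if "r > 0" for K r
  proof -
    have "(\<lambda>n. \<epsilon> n * K) \<longlonglongrightarrow> 0"
      using tendsto_mult_right[OF \<epsilon>(2), of K] by simp
    from order_tendstoD(2)[OF this that] show ?thesis .
  qed
  have conv: "(\<lambda>n. \<Phi> n s) \<longlonglongrightarrow> U s" if s: "s > 0" for s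
  proof -
    have "Cauchy (\<lambda>n. \<Phi> n s)"
    proof (rule CauchyI)
      fix r :: real assume "r > 0"
      from vanish[OF this, of "2 * s powr a"] obtain M where M: "\<epsilon> M * (2 * s powr a) < r"
        by (auto simp: eventually_sequentially)
      have "norm (\<Phi> n s - \<Phi> k s) < r" if "n \<ge> M" "k \<ge> M" for n k
        using diff[OF that(1) s] diff[OF that(2) s] M by (simp add: mult_ac)
      then show "\<exists>M. \<forall>n\<ge>M. \<forall>k\<ge>M. norm (\<Phi> n s - \<Phi> k s) < r"
        by blast
    qed
    then show ?thesis
      unfolding U_def by (simp add: Cauchy_convergent convergent_LIMSEQ_iff[symmetric])
  qed
  have bound: "\<bar>\<Phi> n s - U s\<bar> \<le> \<epsilon> n * s powr a" if s: "s > 0" for n s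
  proof (rule LIMSEQ_le_const2)
    show "(\<lambda>k. \<bar>\<Phi> n s - \<Phi> k s\<bar>) \<longlonglongrightarrow> \<bar>\<Phi> n s - U s\<bar>"
      by (intro tendsto_intros conv s)
    show "\<exists>M. \<forall>k\<ge>M. \<bar>\<Phi> n s - \<Phi> k s\<bar> \<le> \<epsilon> n * s powr a"
      using diff s by blast
  qed
  have "continuous_on {0<..} U"
  proof (rule continuous_at_imp_continuous_on, safe)
    fix s :: real assume s: "s > 0"
    have "uniform_limit {s/2<..} \<Phi> U sequentially"
    proof (rule uniform_limitI)
      fix r :: real assume "r > 0"
      from vanish[OF this, of "(s/2) powr a"] show "\<forall>\<^sub>F n in sequentially. \<forall>x\<in>{s/2<..}. dist (\<Phi> n x) (U x) < r"
      proof eventually_elim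
        case (elim n)
        have "dist (\<Phi> n x) (U x) < r" if x: "x > s/2" for x
        proof -
          have "x powr a \<le> (s/2) powr a"
            using x s a by (intro powr_mono2') auto
          then have "\<epsilon> n * x powr a \<le> \<epsilon> n * (s/2) powr a"
            using \<epsilon>(1)[of n] by (intro mult_left_mono) auto
          then show ?thesis
            using bound[of x n] x s elim by (simp add: dist_real_def)
        qed
        then show ?case by simp
      qed
    qed
    then have "continuous_on {s/2<..} U"
      by (rule uniform_limit_theorem[OF always_eventually[OF allI[OF \<Phi>c]]]) simp
    then show "isCont U s"
      using s by (simp add: continuous_on_eq_continuous_at)
  qed
  with bound show ?thesis
    by blast
qed

text \<open>The potentials are continuous on the open half-line only; their value at \<open>0\<close> is arbitrary.\<close>

lemma borel_measurable_positive_comp: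
  fixes h :: "real \<Rightarrow> real"
  assumes h: "continuous_on {0<..} h" and a: "a \<in> borel_measurable M" "\<And>x. a x \<ge> 0"
  shows "(\<lambda>x. h (a x)) \<in> borel_measurable M"
proof -
  have "(\<lambda>s. indicator {0<..} s *\<^sub>R h s) \<in> borel_measurable borel"
    by (rule borel_measurable_continuous_on_indicator[OF _ h]) simp
  then have "(\<lambda>s. if s = 0 then h 0 else indicator {0<..} s *\<^sub>R h s) \<in> borel_measurable borel"
    using measurable_If[of "\<lambda>_. h 0" borel borel "\<lambda>s. indicator {0<..} s *\<^sub>R h s" "\<lambda>s. s = 0"] by simp
  from measurable_compose[OF a(1) this]
  have "(\<lambda>x. if a x = 0 then h 0 else indicator {0<..} (a x) *\<^sub>R h (a x)) \<in> borel_measurable M" .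
  moreover have "(\<lambda>x. if a x = 0 then h 0 else indicator {0<..} (a x) *\<^sub>R h (a x)) = (\<lambda>x. h (a x))"
    using a(2) by (auto simp: fun_eq_iff indicator_def less_le)
  ultimately show ?thesis
    by simp
qed

lemma radial_borel:
  fixes h :: "real \<Rightarrow> real"
  assumes "continuous_on {0<..} h"
  shows "(\<lambda>x::real^'n. h (norm x)) \<in> borel_measurable borel" "(\<lambda>x::real^'n. h (x \<bullet> x)) \<in> borel_measurable borel"
  by (rule borel_measurable_positive_comp[OF assms]; simp)+

lemma radial_testD: "\<phi> \<in> radial_test_functions \<Longrightarrow> \<phi> \<in> test_functions"
  unfolding radial_test_functions_def by blast

lemma radial_test_diff:
  assumes "\<phi> \<in> radial_test_functions" "\<psi> \<in> radial_test_functions"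
  shows "(\<lambda>x. \<phi> x + - 1 * \<psi> x) \<in> radial_test_functions"
proof -
  have "(\<lambda>x. \<phi> x + - 1 * \<psi> x) \<in> test_functions"
    by (rule test_add[OF radial_testD[OF assms(1)] test_cmult[OF radial_testD[OF assms(2)]]])
  moreover have "\<phi> x + - 1 * \<psi> x = \<phi> y + - 1 * \<psi> y" if "norm x = norm y" for x y
  proof -
    have "\<phi> x = \<phi> y" "\<psi> x = \<psi> y"
      using assms that unfolding radial_test_functions_def by blast+
    then show ?thesis by simp
  qed
  ultimately show ?thesis
    unfolding radial_test_functions_def by blast
qed

text \<open>An element \<open>u\<close> of the space is only given as a limit of radial test functions in the gradient
  norm. The decay estimate makes that sequence converge locally uniformly away from the origin,
  to a radial function with the same weak gradient as \<open>u\<close>. The difference of the two has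
  vanishing weak gradient and is small at infinity, so it is \<open>0\<close>.\<close>

lemma radial_representative:
  fixes u :: "real^'n \<Rightarrow> real"
  assumes N: "CARD('n) \<ge> 3" and u: "u \<in> D12_rad"
  shows "\<exists>U. continuous_on {0<..} U \<and> (AE x in lebesgue. u x = U (x \<bullet> x))"
proof -
  define m where "m = real CARD('n) / 2"
  have m: "m > 1"
    using N by (simp add: m_def)
  define a where "a = (1 - m) / 2"
  have "m - 1 + a = (m - 1) / 2"
    by (simp add: a_def field_simps)
  then have a: "m - 1 + a \<ge> 0"  "a < 0"
    using m by (simp, simp add: a_def)
  define D where "D = 2 * (1 / (2 * unit_ball_vol (real CARD('n)) * m) + 1 / (8 * (m - 1)))"
  have D: "D > 0"
    using m unfolding D_def by (intro mult_pos_pos add_pos_pos divide_pos_pos) auto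
  define \<epsilon> where "\<epsilon> n = inverse (real (Suc n))" for n
  have \<epsilon>: "\<epsilon> n > 0" for n by (simp add: \<epsilon>_def)
  have \<epsilon>_mono: "\<epsilon> k \<le> \<epsilon> n" if "n \<le> k" for n k
    using that by (simp add: \<epsilon>_def le_imp_inverse_le)
  define \<delta> where "\<delta> n = D * \<epsilon> n" for n
  have \<epsilon>0: "\<epsilon> \<longlonglongrightarrow> 0"
    unfolding \<epsilon>_def by (rule LIMSEQ_inverse_real_of_nat)
  have \<delta>: "\<delta> n > 0" for n
    using D \<epsilon>[of n] by (simp add: \<delta>_def)
  have \<delta>0: "\<delta> \<longlonglongrightarrow> 0"
    using tendsto_mult_left[OF \<epsilon>0, of D] by (simp add: \<delta>_def[abs_def])
  have uD: "u \<in> D12" and dens: "\<And>e. e > 0 \<Longrightarrow> \<exists>\<phi>\<in>radial_test_functions. dirichlet_norm (\<lambda>x. u x - \<phi> x) < e"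
    using u by (auto simp: D12_rad_def)
  define v where "v = wgrad u"
  have v: "weak_gradient u v" and vI: "integrable lebesgue (\<lambda>x. (norm (v x))\<^sup>2)"
    using D12_weak_gradient[OF uD] by (simp_all add: v_def)
  have lu: "locally_integrable u" and lv: "locally_integrable v"
    using v by (simp_all add: weak_gradient_locally_integrable)
  obtain \<phi> where \<phi>r: "\<And>n. \<phi> n \<in> radial_test_functions"
    and \<phi>d: "\<And>n. dirichlet_norm (\<lambda>x. u x - \<phi> n x) < \<epsilon> n"
    using dens[OF \<epsilon>] by metis
  have t: "\<phi> n \<in> test_functions" for n
    using \<phi>r[of n] by (simp add: radial_test_functions_def)
  have L: "(LINT x|lebesgue. (norm (v x - gradient (\<phi> n) x))\<^sup>2) \<le> (\<epsilon> n)\<^sup>2" for n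
  proof -
    have w: "weak_gradient (\<lambda>x. u x - \<phi> n x) (\<lambda>x. v x - gradient (\<phi> n) x)"
      using weak_gradient_add[OF v weak_gradient_cmult[OF weak_gradient_test[OF t], of "- 1" n]] by simp
    have "0 \<le> dirichlet_norm (\<lambda>x. u x - \<phi> n x)"
      by (simp add: dirichlet_norm_def)
    then have "(dirichlet_norm (\<lambda>x. u x - \<phi> n x))\<^sup>2 \<le> (\<epsilon> n)\<^sup>2"
      using \<phi>d[of n] by (intro power_mono) auto
    then show ?thesis
      by (simp only: dirichlet_norm_eq[OF w])
  qed
  have gm: "gradient (\<phi> n) \<in> borel_measurable lebesgue" for n
    by (rule borel_imp_lebesgue_measurable[OF borel_measurable_continuous_onI[OF gradient_continuous[OF t]]])
  have vm: "v \<in> borel_measurable lebesgue"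
    by (rule locally_integrable_measurable[OF lv])
  have I: "integrable lebesgue (\<lambda>x. (norm (v x - gradient (\<phi> n) x))\<^sup>2)" for n
  proof (rule Bochner_Integration.integrable_bound)
    show "integrable lebesgue (\<lambda>x. 2 * (norm (v x))\<^sup>2 + 2 * (norm (gradient (\<phi> n) x))\<^sup>2)"
      using vI integrable_gradient_sq[OF t, of n] by simp
    show "(\<lambda>x. (norm (v x - gradient (\<phi> n) x))\<^sup>2) \<in> borel_measurable lebesgue"
      using gm vm by measurable
    show "AE x in lebesgue. norm ((norm (v x - gradient (\<phi> n) x))\<^sup>2) \<le> norm (2 * (norm (v x))\<^sup>2 + 2 * (norm (gradient (\<phi> n) x))\<^sup>2)"
      using sq_norm_diff_le[of "v _" "gradient (\<phi> n) _" 0] by simp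
  qed
  have diff: "\<bar>\<phi> n x - \<phi> k x\<bar> \<le> \<delta> n * (x \<bullet> x) powr a" if nk: "n \<le> k" and x: "x \<noteq> 0" for n k x
  proof -
    let ?d = "\<lambda>x. \<phi> n x + - 1 * \<phi> k x"
    have "(LINT x|lebesgue. (norm (gradient ?d x))\<^sup>2) \<le>
        (LINT x|lebesgue. 2 * (norm (v x - gradient (\<phi> n) x))\<^sup>2 + 2 * (norm (v x - gradient (\<phi> k) x))\<^sup>2)"
    proof (rule integral_mono)
      show "integrable lebesgue (\<lambda>x. (norm (gradient ?d x))\<^sup>2)"
        by (rule integrable_gradient_sq[OF test_add[OF t test_cmult[OF t]]])
      show "integrable lebesgue (\<lambda>x. 2 * (norm (v x - gradient (\<phi> n) x))\<^sup>2 + 2 * (norm (v x - gradient (\<phi> k) x))\<^sup>2)"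
        using I[of n] I[of k] by simp
    qed (simp only: gradient_diff[OF t t] sq_norm_diff_le)
    also have "\<dots> = 2 * (LINT x|lebesgue. (norm (v x - gradient (\<phi> n) x))\<^sup>2) + 2 * (LINT x|lebesgue. (norm (v x - gradient (\<phi> k) x))\<^sup>2)"
      using I[of n] I[of k] by simp
    also have "\<dots> \<le> 2 * (\<epsilon> n)\<^sup>2 + 2 * (\<epsilon> n)\<^sup>2"
      using L[of n] L[of k] power_mono[OF \<epsilon>_mono[OF nk] less_imp_le[OF \<epsilon>], of 2] by linarith
    also have "\<dots> = (2 * \<epsilon> n)\<^sup>2"
      by (simp add: power2_eq_square)
    finally have "(LINT x|lebesgue. (norm (gradient ?d x))\<^sup>2) \<le> (2 * \<epsilon> n)\<^sup>2" .
    from radial_test_decay[OF N radial_test_diff[OF \<phi>r \<phi>r] this _ x]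
    show ?thesis
      using \<epsilon>[of n] by (simp add: \<delta>_def D_def a_def m_def mult_ac)
  qed
  obtain j :: 'n where True by simp
  define e where "e = (axis j 1 :: real^'n)"
  have e: "norm e = 1" "e \<noteq> 0"
    using norm_axis_1[of j] by (auto simp: e_def)
  define \<Phi> where "\<Phi> n t = \<phi> n (sqrt t *\<^sub>R e)" for n t
  have \<phi>_eq: "\<phi> n x = \<Phi> n (x \<bullet> x)" for n x
  proof -
    have "norm x = norm (sqrt (x \<bullet> x) *\<^sub>R e)"
      by (simp add: e norm_eq_sqrt_inner[of x])
    then show ?thesis
      using \<phi>r[of n] unfolding \<Phi>_def radial_test_functions_def by blast
  qed
  have \<Phi>c: "continuous_on S (\<Phi> n)" for S n
    unfolding \<Phi>_def
    by (intro continuous_on_compose2[OF test_continuous[OF t, of UNIV]] continuous_intros subset_UNIV)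
  have \<Phi>diff: "\<bar>\<Phi> n s - \<Phi> k s\<bar> \<le> \<delta> n * s powr a" if "n \<le> k" "s > 0" for n k s
    using diff[of n k "sqrt s *\<^sub>R e"] that e by (simp add: \<Phi>_def dot_square_norm)
  obtain U where U: "continuous_on {0<..} U" "\<forall>n. \<forall>s>0. \<bar>\<Phi> n s - U s\<bar> \<le> \<delta> n * s powr a"
    using locally_uniform_limit[OF \<Phi>c less_imp_le[OF a(2)] \<delta> \<delta>0 \<Phi>diff] by blast
  define w where "w x = U (x \<bullet> x)" for x :: "real^'n"
  define y where "y x = (x \<bullet> x) powr a" for x :: "real^'n"
  have wbound: "\<bar>\<phi> n x - w x\<bar> \<le> \<delta> n * y x" if "x \<noteq> 0" for n x
    using U(2) that by (simp add: \<phi>_eq w_def y_def)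
  have ne0: "AE x in lebesgue. x \<noteq> (0::real^'n)"
    by (rule AE_completion[OF AE_lborel_singleton])
  have close: "AE x in lebesgue. \<bar>\<phi> n x - w x\<bar> \<le> \<delta> n * y x" for n
    using ne0 by eventually_elim (rule wbound)
  have ly: "locally_integrable y"
    unfolding y_def by (rule locally_integrable_radial_power) (use a in \<open>auto simp: m_def\<close>)
  have lw: "locally_integrable w"
  proof (rule locally_integrable_bound)
    show "locally_integrable (\<lambda>x. \<bar>\<phi> 0 x\<bar> + \<delta> 0 *\<^sub>R y x)"
      by (intro locally_integrable_add locally_integrable_scale ly locally_integrable_continuous
          continuous_on_rabs test_continuous t)
    show "w \<in> borel_measurable borel"
      unfolding w_def[abs_def] by (rule radial_borel(2)[OF U(1)])
    show "AE x in lebesgue. \<bar>w x\<bar> \<le> \<bar>\<phi> 0 x\<bar> + \<delta> 0 *\<^sub>R y x"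
      using close[of 0] by eventually_elim simp
  qed
  have "weak_gradient w v"
  proof (rule weak_gradient_limit[OF t _ _ lw locally_integrable_scale[OF ly, of D] lv _ I L])
    show "AE x in lebesgue. \<bar>\<phi> n x - w x\<bar> \<le> \<epsilon> n * (D *\<^sub>R y x)" for n
      using close[of n] by eventually_elim (simp add: \<delta>_def mult_ac)
  qed (rule \<epsilon>, rule \<epsilon>0)
  moreover have "small_at_infinity w"
  proof (rule small_at_infinity_if_tendsto_0[OF lw])
    fix d :: real assume d: "d > 0"
    obtain R where R: "R > 0" "\<forall>x. norm x > R \<longrightarrow> \<phi> 0 x = 0"
      using test_support[OF t] by blast
    have "((\<lambda>s. \<delta> 0 * s powr a) \<longlongrightarrow> \<delta> 0 * 0) at_top"
      by (intro tendsto_mult_left tendsto_neg_powr a filterlim_ident)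
    then have "\<forall>\<^sub>F s in at_top. \<delta> 0 * s powr a < d"
      using d order_tendstoD(2)[of "\<lambda>s. \<delta> 0 * s powr a" "\<delta> 0 * 0" at_top d] by simp
    then obtain S where S: "\<And>s. s \<ge> S \<Longrightarrow> \<delta> 0 * s powr a < d"
      unfolding eventually_at_top_linorder by blast
    have "\<bar>w x\<bar> \<le> d" if x: "norm x > R + \<bar>S\<bar> + 1" for x
    proof -
      have "norm x > 1" "norm x > R" "norm x > S"
        using x R by simp_all
      then have "x \<bullet> x \<ge> S"
        using mult_mono[of 1 "norm x" S "norm x"] mult_left_mono[of 1 "norm x" "norm x"]
        by (simp add: dot_square_norm power2_eq_square)
      moreover have "x \<noteq> 0" "\<phi> 0 x = 0"
        using \<open>norm x > 1\<close> \<open>norm x > R\<close> R by auto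
      ultimately show ?thesis
        using wbound[of x 0] S[of "x \<bullet> x"] by (simp add: y_def)
    qed
    then show "\<exists>r. \<forall>x. norm x > r \<longrightarrow> \<bar>w x\<bar> \<le> d"
      by blast
  qed
  ultimately have "AE x in lebesgue. u x = w x"
    by (rule AE_eq_if_weak_gradients_eq[OF v D12_small_at_infinity[OF N uD]])
  with U(1) show ?thesis
    unfolding w_def by blast
qed

section \<open>The change of variable and the nonlinearity\<close>

lemma isCont_chg: "isCont chg t"
  using chg_deriv DERIV_isCont by blast

lemma continuous_chg: "continuous_on S chg"
  by (rule continuous_at_imp_continuous_on) (simp add: isCont_chg)

lemma chg_deriv_pos: "1 / sqrt (1 + 2 * (chg t)\<^sup>2) > 0" and chg_deriv_le_1: "1 / sqrt (1 + 2 * (chg t)\<^sup>2) \<le> 1"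
proof -
  have "sqrt (1 + 2 * (chg t)\<^sup>2) \<ge> 1"
    by simp
  then show "1 / sqrt (1 + 2 * (chg t)\<^sup>2) > 0" "1 / sqrt (1 + 2 * (chg t)\<^sup>2) \<le> 1"
    by (simp_all add: add_pos_nonneg)
qed

lemma chg_mono:
  assumes "s \<le> t" shows "chg s \<le> chg t"
proof (rule DERIV_nonneg_imp_nondecreasing[OF assms])
  fix x
  show "\<exists>y. (chg has_real_derivative y) (at x) \<and> 0 \<le> y"
    by (intro exI[of _ "1 / sqrt (1 + 2 * (chg x)\<^sup>2)"] conjI chg_deriv less_imp_le[OF chg_deriv_pos])
qed

lemma chg_odd: "chg (- t) = - chg t"
proof -
  let ?h = "\<lambda>t. - chg (- t)"
  have "(?h has_real_derivative 1 / sqrt (1 + 2 * (?h t)\<^sup>2)) (at t)" for t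
  proof -
    have "((\<lambda>t. chg (- t)) has_real_derivative 1 / sqrt (1 + 2 * (chg (- t))\<^sup>2) * (- 1)) (at t)"
      by (rule DERIV_chain2[OF chg_deriv]) (auto intro!: derivative_eq_intros)
    from DERIV_minus[OF this] show ?thesis by simp
  qed
  then have "?h 0 = 0 \<and> (\<forall>t. (?h has_real_derivative 1 / sqrt (1 + 2 * (?h t)\<^sup>2)) (at t))"
    by (simp add: chg_0)
  moreover have "chg 0 = 0 \<and> (\<forall>t. (chg has_real_derivative 1 / sqrt (1 + 2 * (chg t)\<^sup>2)) (at t))"
    using chg_0 chg_deriv by blast
  ultimately have "?h = chg"
    using chg_ex1 by (metis (no_types, lifting))
  then have "- chg (- (- t)) = chg (- t)"
    by (rule fun_cong)
  then show ?thesis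
    by simp
qed

lemma chg_abs_le: "\<bar>chg t\<bar> \<le> \<bar>t\<bar>"
proof -
  have "0 \<le> chg t \<and> chg t \<le> t" if t: "t \<ge> 0" for t
  proof -
    have "((\<lambda>t. t - chg t) has_real_derivative 1 - 1 / sqrt (1 + 2 * (chg t)\<^sup>2)) (at t)" for t
      by (rule DERIV_diff[OF DERIV_ident chg_deriv])
    then have "0 - chg 0 \<le> t - chg t"
      using DERIV_nonneg_imp_nondecreasing[OF t, of "\<lambda>t. t - chg t"] chg_deriv_le_1 diff_ge_0_iff_ge by blast
    then show ?thesis
      using chg_mono[OF t] by (simp add: chg_0)
  qed
  from this[of "\<bar>t\<bar>"] show ?thesis
    by (cases "t \<ge> 0") (auto simp: chg_odd)
qed

text \<open>For \<open>c \<le> 1\<close> this is monotonicity. For \<open>c > 1\<close> it is concavity on the positive half-line, where the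
  derivative of \<open>chg\<close> decreases.\<close>

lemma chg_scale_le:
  assumes c: "c > 0"
  shows "(chg (c * t))\<^sup>2 \<le> (max 1 c)\<^sup>2 * (chg t)\<^sup>2"
proof -
  have main: "0 \<le> chg (c * t) \<and> chg (c * t) \<le> max 1 c * chg t" if t: "t \<ge> 0" for t
  proof
    show "0 \<le> chg (c * t)"
      using chg_mono[of 0 "c * t"] c t by (simp add: chg_0)
    show "chg (c * t) \<le> max 1 c * chg t"
    proof (cases "c \<le> 1")
      case True
      then show ?thesis
        using chg_mono[of "c * t" t] mult_right_mono[of c 1 t] t by simp
    next
      case False
      have D: "((\<lambda>t. c * chg t - chg (c * t)) has_real_derivative
          c * (1 / sqrt (1 + 2 * (chg t)\<^sup>2)) - 1 / sqrt (1 + 2 * (chg (c * t))\<^sup>2) * c) (at t)" for t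
        by (intro DERIV_diff DERIV_cmult chg_deriv DERIV_chain2[OF chg_deriv] DERIV_cmult_Id)
      have "c * chg 0 - chg (c * 0) \<le> c * chg t - chg (c * t)"
      proof (rule DERIV_nonneg_imp_nondecreasing[OF t], intro exI conjI)
        fix x assume x: "0 \<le> x" "x \<le> t"
        show "((\<lambda>t. c * chg t - chg (c * t)) has_real_derivative
          c * (1 / sqrt (1 + 2 * (chg x)\<^sup>2)) - 1 / sqrt (1 + 2 * (chg (c * x))\<^sup>2) * c) (at x)"
          by (rule D)
        have "0 \<le> chg x" "chg x \<le> chg (c * x)"
          using chg_mono[of 0 x] chg_mono[of x "c * x"] x False mult_right_mono[of 1 c x] by (auto simp: chg_0)
        then have "(chg x)\<^sup>2 \<le> (chg (c * x))\<^sup>2"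
          by (intro power_mono) auto
        then have le: "1 / sqrt (1 + 2 * (chg (c * x))\<^sup>2) \<le> 1 / sqrt (1 + 2 * (chg x)\<^sup>2)"
          by (intro divide_left_mono) (auto simp: add_pos_nonneg)
        show "0 \<le> c * (1 / sqrt (1 + 2 * (chg x)\<^sup>2)) - 1 / sqrt (1 + 2 * (chg (c * x))\<^sup>2) * c"
          using mult_left_mono[OF le, of c] c by (simp add: mult.commute)
      qed
      then show ?thesis
        using False by (simp add: chg_0)
    qed
  qed
  have "(chg (c * \<bar>t\<bar>))\<^sup>2 \<le> (max 1 c * chg \<bar>t\<bar>)\<^sup>2"
    using main[of "\<bar>t\<bar>"] by (intro power_mono) auto
  moreover have "(chg (c * \<bar>t\<bar>))\<^sup>2 = (chg (c * t))\<^sup>2" "(chg \<bar>t\<bar>)\<^sup>2 = (chg t)\<^sup>2"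
    by (cases "t \<ge> 0"; simp add: chg_odd)+
  ultimately show ?thesis
    by (simp add: power_mult_distrib)
qed

lemma primitive_deriv:
  assumes "continuous_on UNIV g"
  shows "(primitive g has_real_derivative g t) (at t)" "primitive g 0 = 0"
proof -
  obtain F where F: "\<And>t. (F has_real_derivative g t) (at t)"
    using continuous_antiderivative[OF assms] by blast
  have "primitive g t = F t - F 0" for t
    unfolding primitive_def
  proof (rule interval_integral_FTC_finite)
    show "continuous_on {min 0 t..max 0 t} g"
      by (rule continuous_on_subset[OF assms]) simp
    show "(F has_vector_derivative g x) (at x within {min 0 t..max 0 t})" for x
      using F has_field_derivative_at_within has_real_derivative_iff_has_vector_derivative by blast
  qed
  then have eq: "primitive g = (\<lambda>t. F t - F 0)"
    by blast
  show "(primitive g has_real_derivative g t) (at t)"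
    unfolding eq using DERIV_diff[OF F DERIV_const] by simp
  show "primitive g 0 = 0"
    by (simp add: eq)
qed

lemma primitive_bound:
  assumes g: "continuous_on UNIV g" and q: "q > 1" and C: "\<And>t. \<bar>g t\<bar> \<le> C * \<bar>t\<bar> powr (q - 1)"
  shows "\<bar>primitive g t\<bar> \<le> C * \<bar>t\<bar> powr q"
proof (cases "t = 0")
  case False
  have C0: "C \<ge> 0"
    using C[of 1] by simp
  have "\<exists>x. \<bar>x\<bar> \<le> \<bar>t\<bar> \<and> \<bar>primitive g t\<bar> = \<bar>t\<bar> * \<bar>g x\<bar>"
  proof (cases "t > 0")
    case True
    then obtain x where "0 < x" "x < t" "primitive g t - primitive g 0 = (t - 0) * g x"
      using MVT2[of 0 t "primitive g" g] primitive_deriv(1)[OF g] by blast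
    then show ?thesis
      by (intro exI[of _ x]) (simp add: primitive_deriv(2)[OF g] abs_mult)
  next
    case f: False
    then have "t < 0" using False by simp
    then obtain x where "t < x" "x < 0" "primitive g 0 - primitive g t = (0 - t) * g x"
      using MVT2[of t 0 "primitive g" g] primitive_deriv(1)[OF g] by blast
    then show ?thesis
      by (intro exI[of _ x]) (simp add: primitive_deriv(2)[OF g] abs_mult)
  qed
  then obtain x where x: "\<bar>x\<bar> \<le> \<bar>t\<bar>" "\<bar>primitive g t\<bar> = \<bar>t\<bar> * \<bar>g x\<bar>"
    by blast
  have "\<bar>g x\<bar> \<le> C * \<bar>t\<bar> powr (q - 1)"
    by (rule order_trans[OF C]) (use x C0 q in \<open>auto intro!: mult_left_mono powr_mono2\<close>)
  then have "\<bar>t\<bar> * \<bar>g x\<bar> \<le> \<bar>t\<bar> * (C * \<bar>t\<bar> powr (q - 1))"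
    by (rule mult_left_mono) simp
  also have "\<bar>t\<bar> * (C * \<bar>t\<bar> powr (q - 1)) = C * \<bar>t\<bar> powr q"
    using False powr_add[of "\<bar>t\<bar>" 1 "q - 1"] by simp
  finally show ?thesis
    by (simp add: x)
qed (simp add: primitive_deriv(2)[OF g])

section \<open>Scaling in the function space\<close>

lemma chg_borel: "chg \<in> borel_measurable borel"
  by (rule borel_measurable_continuous_onI[OF continuous_chg])

lemma dirichlet_norm_cmult:
  assumes "weak_gradient u v"
  shows "dirichlet_norm (\<lambda>x. c * u x) = \<bar>c\<bar> * dirichlet_norm u"
  using integral_wgrad[OF assms] integral_wgrad[OF weak_gradient_cmult[OF assms, of c]]
  by (simp add: dirichlet_norm_def power_mult_distrib real_sqrt_mult)

lemma D12_measurable: "u \<in> D12 \<Longrightarrow> u \<in> borel_measurable lebesgue"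
  unfolding D12_def by blast

lemma D12_rad_D12: "u \<in> D12_rad \<Longrightarrow> u \<in> D12"
  unfolding D12_rad_def by blast

lemma Espace_D12_rad: "u \<in> Espace V \<Longrightarrow> u \<in> D12_rad"
  unfolding Espace_def by blast

lemma D12_cmult:
  fixes u :: "real^'n \<Rightarrow> real"
  assumes "u \<in> D12" shows "(\<lambda>x. c * u x) \<in> D12"
proof -
  note v = D12_weak_gradient[OF assms]
  have "weak_gradient (\<lambda>x. c * u x) (\<lambda>x. c *\<^sub>R wgrad u x)"
    by (rule weak_gradient_cmult[OF v(1)])
  moreover have "integrable lebesgue (\<lambda>x. (norm (c *\<^sub>R wgrad u x))\<^sup>2)"
    using v(2) by (simp add: power_mult_distrib)
  moreover have "integrable lebesgue (\<lambda>x. \<bar>c * u x\<bar> powr (2 * real CARD('n) / (real CARD('n) - 2)))"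
    using assms by (simp add: D12_def abs_mult powr_mult)
  moreover have "(\<lambda>x. c * u x) \<in> borel_measurable lebesgue"
    using D12_measurable[OF assms] by (intro borel_measurable_times borel_measurable_const)
  ultimately show ?thesis
    unfolding D12_def by blast
qed

lemma D12_rad_cmult:
  assumes u: "u \<in> D12_rad" and c: "c > 0" shows "(\<lambda>x. c * u x) \<in> D12_rad"
  unfolding D12_rad_def
proof safe
  show "(\<lambda>x. c * u x) \<in> D12"
    by (rule D12_cmult[OF D12_rad_D12[OF u]])
  fix e :: real assume "e > 0"
  then have "e / c > 0" using c by simp
  then obtain \<phi> where \<phi>: "\<phi> \<in> radial_test_functions" "dirichlet_norm (\<lambda>x. u x - \<phi> x) < e / c"
    using u unfolding D12_rad_def by blast
  have t: "\<phi> \<in> test_functions"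
    by (rule radial_testD[OF \<phi>(1)])
  have "weak_gradient (\<lambda>x. u x - \<phi> x) (\<lambda>x. wgrad u x - gradient \<phi> x)"
    using weak_gradient_add[OF D12_weak_gradient(1)[OF D12_rad_D12[OF u]] weak_gradient_cmult[OF weak_gradient_test[OF t], of "- 1"]]
    by simp
  from dirichlet_norm_cmult[OF this, of c]
  have "dirichlet_norm (\<lambda>x. c * u x - c * \<phi> x) < e"
    using \<phi>(2) c by (simp add: right_diff_distrib field_simps)
  moreover have "(\<lambda>x. c * \<phi> x) \<in> radial_test_functions"
  proof -
    have "c * \<phi> x = c * \<phi> y" if "norm x = norm y" for x y
    proof -
      have "\<phi> x = \<phi> y"
        using \<phi>(1) that unfolding radial_test_functions_def by blast
      then show ?thesis by simp
    qed
    with test_cmult[OF t, of c] show ?thesis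
      unfolding radial_test_functions_def by blast
  qed
  ultimately show "\<exists>\<phi>\<in>radial_test_functions. dirichlet_norm (\<lambda>x. c * u x - \<phi> x) < e"
    by (intro bexI[of _ "\<lambda>x. c * \<phi> x"])
qed

lemma Espace_cmult:
  fixes u :: "real^'n \<Rightarrow> real"
  assumes V: "continuous_on {0<..} V" and u: "u \<in> Espace V" and c: "c > 0"
  shows "(\<lambda>x. c * u x) \<in> Espace V"
proof -
  let ?M = "(max 1 c)\<^sup>2"
  have um: "u \<in> borel_measurable lebesgue"
    by (rule D12_measurable[OF D12_rad_D12[OF Espace_D12_rad[OF u]]])
  have m: "(\<lambda>x. V (norm x) * (chg (u x))\<^sup>2) \<in> borel_measurable lebesgue"
    by (intro borel_measurable_times borel_measurable_power measurable_compose[OF um chg_borel]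
        borel_imp_lebesgue_measurable[OF radial_borel(1)[OF V]])
  have "(\<integral>\<^sup>+ x. ennreal (V (norm x) * (chg (c * u x))\<^sup>2) \<partial>lebesgue) \<le>
      (\<integral>\<^sup>+ x. ennreal ?M * ennreal (V (norm x) * (chg (u x))\<^sup>2) \<partial>lebesgue)"
  proof (rule nn_integral_mono)
    fix x :: "real^'n"
    show "ennreal (V (norm x) * (chg (c * u x))\<^sup>2) \<le> ennreal ?M * ennreal (V (norm x) * (chg (u x))\<^sup>2)"
    proof (cases "V (norm x) \<ge> 0")
      case True
      then have "V (norm x) * (chg (c * u x))\<^sup>2 \<le> ?M * (V (norm x) * (chg (u x))\<^sup>2)"
        using mult_left_mono[OF chg_scale_le[OF c, of "u x"] True] by (simp add: mult_ac)
      then show ?thesis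
        by (simp add: ennreal_mult'[symmetric] ennreal_leI)
    next
      case False
      then have "ennreal (V (norm x) * (chg (c * u x))\<^sup>2) = 0"
        by (intro ennreal_neg) (simp add: mult_nonpos_nonneg)
      then show ?thesis by simp
    qed
  qed
  also have "\<dots> = ennreal ?M * (\<integral>\<^sup>+ x. ennreal (V (norm x) * (chg (u x))\<^sup>2) \<partial>lebesgue)"
    by (rule nn_integral_cmult) (use m in measurable)
  also have "\<dots> < \<infinity>"
    using u by (simp add: Espace_def ennreal_mult_less_top)
  finally show ?thesis
    using D12_rad_cmult[OF Espace_D12_rad[OF u] c] unfolding Espace_def by blast
qed

text \<open>Substitute \<open>k / c\<close> for \<open>k\<close> in the infimum.\<close>

lemma norm_o_cmult_le:
  assumes c: "c > 0"
  shows "norm_o V (\<lambda>x. c * u x) \<le> ennreal c * norm_o V u"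
proof -
  define J where "J k = (\<integral>\<^sup>+ x. ennreal (V (norm x) * (chg (k * u x))\<^sup>2) \<partial>lebesgue)" for k
  have "ennreal (1 / c) * norm_o V (\<lambda>x. c * u x) \<le> norm_o V u"
    unfolding norm_o_def[of V u]
  proof (rule INF_greatest)
    fix k :: real assume "k \<in> {0<..}"
    then have k: "k > 0" by simp
    have "norm_o V (\<lambda>x. c * u x) \<le> ennreal (1 / (k / c)) * (1 + J k)"
      unfolding norm_o_def
      by (rule INF_lower2[of "k / c"]) (use k c in \<open>auto simp: J_def\<close>)
    then have "ennreal (1 / c) * norm_o V (\<lambda>x. c * u x) \<le> ennreal (1 / c) * (ennreal (1 / (k / c)) * (1 + J k))"
      by (rule mult_left_mono) simp
    also have "\<dots> = ennreal (1 / k) * (1 + J k)"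
      using c k by (simp add: mult.assoc[symmetric] ennreal_mult''[symmetric])
    finally show "ennreal (1 / c) * norm_o V (\<lambda>x. c * u x) \<le>
        ennreal (1 / k) * (1 + (\<integral>\<^sup>+ x. ennreal (V (norm x) * (chg (k * u x))\<^sup>2) \<partial>lebesgue))"
      by (simp add: J_def)
  qed
  then have "ennreal c * (ennreal (1 / c) * norm_o V (\<lambda>x. c * u x)) \<le> ennreal c * norm_o V u"
    by (rule mult_left_mono) simp
  then show ?thesis
    using c by (simp add: mult.assoc[symmetric] ennreal_mult''[symmetric])
qed

lemma norm_o_cmult:
  assumes c: "c > 0"
  shows "norm_o V (\<lambda>x. c * u x) = ennreal c * norm_o V u"
proof (rule antisym[OF norm_o_cmult_le[OF c]])
  have "norm_o V (\<lambda>x. (1 / c) * (c * u x)) \<le> ennreal (1 / c) * norm_o V (\<lambda>x. c * u x)"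
    using c by (intro norm_o_cmult_le) simp
  then have "ennreal c * norm_o V u \<le> ennreal c * (ennreal (1 / c) * norm_o V (\<lambda>x. c * u x))"
    using c by (intro mult_left_mono) simp_all
  then show "ennreal c * norm_o V u \<le> norm_o V (\<lambda>x. c * u x)"
    using c by (simp add: mult.assoc[symmetric] ennreal_mult''[symmetric])
qed

lemma Enorm_cmult:
  assumes "weak_gradient u v" and c: "c > 0"
  shows "Enorm V (\<lambda>x. c * u x) = c * Enorm V u"
  using c by (simp add: Enorm_def dirichlet_norm_cmult[OF assms(1)] norm_o_cmult enn2real_mult distrib_left)

text \<open>If the norm vanishes, so does the weak gradient.\<close>

lemma Enorm_pos_or_AE_zero:
  fixes u :: "real^'n \<Rightarrow> real"
  assumes N: "CARD('n) \<ge> 3" and u: "u \<in> D12"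
  shows "Enorm V u > 0 \<or> (AE x in lebesgue. u x = 0)"
proof (rule disjCI)
  note v = D12_weak_gradient[OF u]
  assume nz: "\<not> (AE x in lebesgue. u x = 0)"
  have "dirichlet_norm u \<noteq> 0"
  proof
    assume "dirichlet_norm u = 0"
    then have "(LINT x|lebesgue. (norm (wgrad u x))\<^sup>2) = 0"
      by (simp add: dirichlet_norm_def)
    then have "AE x in lebesgue. (norm (wgrad u x))\<^sup>2 = 0"
      using integral_nonneg_eq_0_iff_AE[OF v(2)] by simp
    then have w0: "AE x in lebesgue. wgrad u x = 0"
      by simp
    have "AE x in lebesgue. u x = 0"
    proof (rule AE_zero_if_weak_gradient_zero)
      show "locally_integrable u"
        using v(1) by (simp add: weak_gradient_locally_integrable)
      fix \<phi> :: "real^'n \<Rightarrow> real" and i assume \<phi>: "\<phi> \<in> test_functions"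
      have "AE x in lebesgue. wgrad u x $ i * \<phi> x = 0"
        using w0 by eventually_elim simp
      then show "(LINT x|lebesgue. u x * partial i \<phi> x) = 0"
        using v(1) \<phi> by (simp add: weak_gradient_locally_integrable integral_eq_zero_AE)
    qed (rule D12_small_at_infinity[OF N u])
    with nz show False by blast
  qed
  moreover have "dirichlet_norm u \<ge> 0"
    by (simp add: dirichlet_norm_def)
  ultimately show "Enorm V u > 0"
    by (simp add: Enorm_def add_pos_nonneg)
qed

section \<open>Finiteness of the energy\<close>

text \<open>The integral is homogeneous in \<open>u\<close>, so finiteness of the supremum over the unit sphere extends to
  every element of the space with positive norm; the others vanish almost everywhere.\<close>

lemma weighted_power_integral_finite:
  fixes u :: "real^'n \<Rightarrow> real"
  assumes N: "CARD('n) \<ge> 3" and V: "continuous_on {0<..} V" and K: "continuous_on {0<..} K"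
    and S: "(SUP u\<in>{u \<in> Espace V. Enorm V u = 1}. \<integral>\<^sup>+ x\<in>A. ennreal (K (norm x) * \<bar>u x\<bar> powr q) \<partial>lebesgue) < \<infinity>"
    and A: "A \<in> sets lebesgue" and u: "u \<in> Espace V" and q: "q > 0"
  shows "(\<integral>\<^sup>+ x\<in>A. ennreal (K (norm x) * \<bar>u x\<bar> powr q) \<partial>lebesgue) < \<infinity>"
proof -
  have uD: "u \<in> D12"
    by (rule D12_rad_D12[OF Espace_D12_rad[OF u]])
  note um = D12_measurable[OF uD]
  consider "Enorm V u > 0" | "AE x in lebesgue. u x = 0"
    using Enorm_pos_or_AE_zero[OF N uD] by blast
  then show ?thesis
  proof cases
    case 1
    define c where "c = 1 / Enorm V u"
    have c: "c > 0" using 1 by (simp add: c_def)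
    let ?u = "\<lambda>x. c * u x"
    have "?u \<in> Espace V" "Enorm V ?u = 1"
      using Espace_cmult[OF V u c] Enorm_cmult[OF D12_weak_gradient(1)[OF uD] c, of V] 1 by (simp_all add: c_def)
    then have "(\<integral>\<^sup>+ x\<in>A. ennreal (K (norm x) * \<bar>?u x\<bar> powr q) \<partial>lebesgue) \<le>
        (SUP u\<in>{u \<in> Espace V. Enorm V u = 1}. \<integral>\<^sup>+ x\<in>A. ennreal (K (norm x) * \<bar>u x\<bar> powr q) \<partial>lebesgue)"
      by (intro SUP_upper) simp
    with S have fin: "(\<integral>\<^sup>+ x\<in>A. ennreal (K (norm x) * \<bar>?u x\<bar> powr q) \<partial>lebesgue) < \<infinity>"
      by (rule le_less_trans[rotated])
    have m: "(\<lambda>x. ennreal (K (norm x) * \<bar>?u x\<bar> powr q) * indicator A x) \<in> borel_measurable lebesgue"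
      using um A borel_imp_lebesgue_measurable[OF radial_borel(1)[OF K]] by measurable
    have "(\<integral>\<^sup>+ x\<in>A. ennreal (K (norm x) * \<bar>u x\<bar> powr q) \<partial>lebesgue) =
        (\<integral>\<^sup>+ x. ennreal (c powr (- q)) * (ennreal (K (norm x) * \<bar>?u x\<bar> powr q) * indicator A x) \<partial>lebesgue)"
    proof (rule nn_integral_cong)
      fix x :: "real^'n"
      have 1: "\<bar>?u x\<bar> powr q = c powr q * \<bar>u x\<bar> powr q"
        using c by (simp add: abs_mult powr_mult)
      have 2: "c powr (- q) * c powr q = 1"
        using c by (simp flip: powr_add)
      have "c powr (- q) * (K (norm x) * \<bar>?u x\<bar> powr q) = (c powr (- q) * c powr q) * (K (norm x) * \<bar>u x\<bar> powr q)"
        unfolding 1 by (simp only: mult_ac)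
      then have "c powr (- q) * (K (norm x) * \<bar>?u x\<bar> powr q) = K (norm x) * \<bar>u x\<bar> powr q"
        by (simp only: 2 mult_1)
      then have "ennreal (K (norm x) * \<bar>u x\<bar> powr q) = ennreal (c powr (- q)) * ennreal (K (norm x) * \<bar>?u x\<bar> powr q)"
        by (metis ennreal_mult' powr_ge_zero)
      then show "ennreal (K (norm x) * \<bar>u x\<bar> powr q) * indicator A x =
          ennreal (c powr (- q)) * (ennreal (K (norm x) * \<bar>?u x\<bar> powr q) * indicator A x)"
        by (simp add: mult.assoc)
    qed
    also have "\<dots> = ennreal (c powr (- q)) * (\<integral>\<^sup>+ x\<in>A. ennreal (K (norm x) * \<bar>?u x\<bar> powr q) \<partial>lebesgue)"
      by (rule nn_integral_cmult[OF m])
    also have "\<dots> < \<infinity>"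
      using fin by (simp add: ennreal_mult_less_top)
    finally show ?thesis .
  next
    case 2
    then have "AE x in lebesgue. ennreal (K (norm x) * \<bar>u x\<bar> powr q) * indicator A x = 0"
      by eventually_elim simp
    then have "(\<integral>\<^sup>+ x\<in>A. ennreal (K (norm x) * \<bar>u x\<bar> powr q) \<partial>lebesgue) = (\<integral>\<^sup>+ x. 0 \<partial>(lebesgue :: (real^'n) measure))"
      by (rule nn_integral_cong_AE)
    then show ?thesis
      by simp
  qed
qed

lemma integrable_bounded_support:
  fixes f :: "'a::euclidean_space \<Rightarrow> real"
  assumes "f \<in> borel_measurable borel" "\<And>x. \<bar>f x\<bar> \<le> M" "\<And>x. norm x > R \<Longrightarrow> f x = 0"
  shows "integrable lebesgue f"
  using integrable_mult_bounded_support[OF locally_integrable_continuous[OF continuous_on_const[of UNIV "1::real"]] assms]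
  by simp

lemma continuous_bounded_between:
  fixes h :: "real \<Rightarrow> real"
  assumes "continuous_on {0<..} h" "r > 0"
  shows "\<exists>B>0. \<forall>s. r \<le> s \<and> s \<le> R \<longrightarrow> \<bar>h s\<bar> \<le> B"
proof -
  have "compact (h ` {r..R})"
    by (rule compact_continuous_image[OF continuous_on_subset[OF assms(1)]]) (use assms(2) in auto)
  then obtain B where "B > 0" "\<forall>y\<in>h ` {r..R}. norm y \<le> B"
    using compact_imp_bounded bounded_pos by metis
  then show ?thesis
    by (intro exI[of _ B]) auto
qed

text \<open>Near the origin the growth exponent \<open>q1\<close> applies, near infinity \<open>q2\<close>. If \<open>R1 < R2\<close>, the annulus in
  between is covered by neither, but there the continuous representative of \<open>u\<close> is bounded.\<close>

lemma nonlinear_term_integrable: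
  fixes u :: "real^'n \<Rightarrow> real"
  assumes N: "CARD('n) \<ge> 3" and V: "continuous_on {0<..} V" and K: "continuous_on {0<..} K" and Kpos: "\<forall>r>0. K r > 0"
    and q: "q1 > 1" "q2 > 1" and R: "R1 > 0" "R2 > 0"
    and S1: "S_zero TYPE('n) V K q1 R1 < \<infinity>" and S2: "S_infty TYPE('n) V K q2 R2 < \<infinity>"
    and g: "continuous_on UNIV g" and gb: "\<forall>t. \<bar>g t\<bar> \<le> C * min (\<bar>t\<bar> powr (q1 - 1)) (\<bar>t\<bar> powr (q2 - 1))"
    and C: "C > 0" and u: "u \<in> Espace V"
    and U: "continuous_on {0<..} U" "AE x in lebesgue. u x = U (x \<bullet> x)"
  shows "integrable lebesgue (\<lambda>x. K (norm x) * primitive g (chg (u x)))"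
proof -
  have um: "u \<in> borel_measurable lebesgue"
    by (rule D12_measurable[OF D12_rad_D12[OF Espace_D12_rad[OF u]]])
  note Km = borel_imp_lebesgue_measurable[OF radial_borel(1)[OF K]]
  have Gc: "continuous_on S (primitive g)" for S
    using primitive_deriv(1)[OF g] DERIV_isCont by (intro continuous_at_imp_continuous_on) blast
  have Gm: "primitive g \<in> borel_measurable borel"
    by (rule borel_measurable_continuous_onI[OF Gc])
  let ?f = "\<lambda>x. K (norm x) * primitive g (chg (u x))"
  have fm: "?f \<in> borel_measurable lebesgue"
    by (intro borel_measurable_times Km measurable_compose[OF measurable_compose[OF um chg_borel] Gm])
  have gb1: "\<bar>g t\<bar> \<le> C * \<bar>t\<bar> powr (q1 - 1)" and gb2: "\<bar>g t\<bar> \<le> C * \<bar>t\<bar> powr (q2 - 1)" for t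
    by (rule order_trans[OF gb[rule_format, of t] mult_left_mono[OF min.cobounded1 less_imp_le[OF C]]],
        rule order_trans[OF gb[rule_format, of t] mult_left_mono[OF min.cobounded2 less_imp_le[OF C]]])
  have sum_le: "a \<le> (a + b) + d" "b \<le> (a + b) + d" "d \<le> (a + b) + d" for a b d :: ennreal
    by (simp_all add: add.assoc add_increasing add_increasing2)
  have Gb: "\<bar>primitive g (chg t)\<bar> \<le> C * \<bar>t\<bar> powr q" if "\<And>t. \<bar>g t\<bar> \<le> C * \<bar>t\<bar> powr (q - 1)" "q > 1" for t q
  proof -
    have "\<bar>primitive g (chg t)\<bar> \<le> C * \<bar>chg t\<bar> powr q"
      by (rule primitive_bound[OF g that(2) that(1)])
    also have "\<dots> \<le> C * \<bar>t\<bar> powr q"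
      using C that(2) chg_abs_le[of t] by (intro mult_left_mono powr_mono2) auto
    finally show ?thesis .
  qed
  obtain BU where BU: "BU > 0" "\<forall>s. R1\<^sup>2 \<le> s \<and> s \<le> R2\<^sup>2 \<longrightarrow> \<bar>U s\<bar> \<le> BU"
    using continuous_bounded_between[OF U(1), of "R1\<^sup>2" "R2\<^sup>2"] R by auto
  obtain BK where BK: "BK > 0" "\<forall>s. R1 \<le> s \<and> s \<le> R2 \<longrightarrow> \<bar>K s\<bar> \<le> BK"
    using continuous_bounded_between[OF K, of R1 R2] R by auto
  let ?T = "BK * (C * BU powr q1)"
  let ?k1 = "\<lambda>x. ennreal (K (norm x) * \<bar>u x\<bar> powr q1) * indicator (ball 0 R1) x"
  let ?k2 = "\<lambda>x. ennreal (K (norm x) * \<bar>u x\<bar> powr q2) * indicator (- ball 0 R2) x"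
  let ?k3 = "\<lambda>x::real^'n. ennreal ?T * indicator (cball 0 R2) x"
  have [measurable]: "ball 0 R1 \<in> sets (lebesgue :: (real^'n) measure)" "- ball 0 R2 \<in> sets (lebesgue :: (real^'n) measure)"
    by (auto intro!: sets_completionI_sets)
  have meas1: "?k1 \<in> borel_measurable lebesgue"
    using um Km by measurable
  have meas2: "?k2 \<in> borel_measurable lebesgue"
    using um Km by measurable
  have cball: "cball (0::real^'n) R2 \<in> sets lebesgue"
    by (rule sets_completionI_sets) simp
  have meas3: "?k3 \<in> borel_measurable lebesgue"
    by (rule borel_measurable_times_ennreal[OF borel_measurable_const borel_measurable_indicator[OF cball]])
  have "(\<integral>\<^sup>+ x. ennreal (norm (?f x)) \<partial>lebesgue) \<le> (\<integral>\<^sup>+ x. (ennreal C * ?k1 x + ennreal C * ?k2 x) + ?k3 x \<partial>lebesgue)"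
  proof (rule nn_integral_mono_AE)
    have "AE x in lebesgue. x \<noteq> (0::real^'n)"
      by (rule AE_completion[OF AE_lborel_singleton])
    with U(2) show "AE x in lebesgue. ennreal (norm (?f x)) \<le> (ennreal C * ?k1 x + ennreal C * ?k2 x) + ?k3 x"
    proof eventually_elim
      case (elim x)
      then have Kx: "K (norm x) > 0"
        using Kpos by simp
      have le: "norm (?f x) \<le> C * (K (norm x) * \<bar>u x\<bar> powr q)" if "\<And>t. \<bar>g t\<bar> \<le> C * \<bar>t\<bar> powr (q - 1)" "q > 1" for q
        using mult_left_mono[OF Gb[OF that, of "u x"], of "K (norm x)"] Kx by (simp add: abs_mult mult_ac)
      have le': "ennreal (norm (?f x)) \<le> ennreal C * ennreal (K (norm x) * \<bar>u x\<bar> powr q)"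
        if "\<And>t. \<bar>g t\<bar> \<le> C * \<bar>t\<bar> powr (q - 1)" "q > 1" for q
        using le[OF that] C by (simp flip: ennreal_mult')
      consider "norm x < R1" | "norm x \<ge> R2" | "norm x \<ge> R1" "norm x \<le> R2" by linarith
      then show ?case
      proof cases
        case 1
        then have "ennreal (norm (?f x)) \<le> ennreal C * ?k1 x"
          using le'[OF gb1 q(1)] by simp
        then show ?thesis
          by (rule order_trans[OF _ sum_le(1)])
      next
        case 2
        then have "ennreal (norm (?f x)) \<le> ennreal C * ?k2 x"
          using le'[OF gb2 q(2)] by simp
        then show ?thesis
          by (rule order_trans[OF _ sum_le(2)])
      next
        case 3
        have "\<bar>u x\<bar> \<le> BU"
          using BU(2) 3 R elim(1) power_mono[OF 3(1), of 2] power_mono[OF 3(2), of 2] by (simp add: dot_square_norm)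
        then have "C * \<bar>u x\<bar> powr q1 \<le> C * BU powr q1"
          using C q by (intro mult_left_mono powr_mono2) auto
        moreover have "K (norm x) \<le> BK"
          using BK 3 by fastforce
        ultimately have "K (norm x) * (C * \<bar>u x\<bar> powr q1) \<le> ?T"
          using Kx C BK by (intro mult_mono) auto
        then have "norm (?f x) \<le> ?T"
          using le[OF gb1 q(1)] by (simp add: mult_ac)
        then have "ennreal (norm (?f x)) \<le> ?k3 x"
          using 3 by (simp add: ennreal_leI)
        then show ?thesis
          by (rule order_trans[OF _ sum_le(3)])
      qed
    qed
  qed
  also have "\<dots> = (\<integral>\<^sup>+ x. ennreal C * ?k1 x + ennreal C * ?k2 x \<partial>lebesgue) + (\<integral>\<^sup>+ x. ?k3 x \<partial>lebesgue)"
    by (rule nn_integral_add[OF borel_measurable_add[OF borel_measurable_times_ennreal[OF borel_measurable_const meas1]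
        borel_measurable_times_ennreal[OF borel_measurable_const meas2]] meas3])
  also have "(\<integral>\<^sup>+ x. ennreal C * ?k1 x + ennreal C * ?k2 x \<partial>lebesgue) =
      ennreal C * (\<integral>\<^sup>+ x. ?k1 x \<partial>lebesgue) + ennreal C * (\<integral>\<^sup>+ x. ?k2 x \<partial>lebesgue)"
    using meas1 meas2 by (subst nn_integral_add) (auto simp: nn_integral_cmult)
  also have "\<dots> + (\<integral>\<^sup>+ x. ?k3 x \<partial>lebesgue) < \<infinity>"
  proof -
    have "(\<integral>\<^sup>+ x. ?k1 x \<partial>lebesgue) < \<infinity>"
      by (rule weighted_power_integral_finite[OF N V K S1[unfolded S_zero_def] _ u]) (use q in auto)
    moreover have "(\<integral>\<^sup>+ x. ?k2 x \<partial>lebesgue) < \<infinity>"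
      by (rule weighted_power_integral_finite[OF N V K S2[unfolded S_infty_def] _ u]) (use q in auto)
    moreover have "(\<integral>\<^sup>+ x. ?k3 x \<partial>lebesgue) < \<infinity>"
      using emeasure_lborel_cball_finite[of "0::real^'n" R2]
      by (simp add: nn_integral_cmult_indicator ennreal_mult_less_top emeasure_completion)
    ultimately show ?thesis
      by (simp add: ennreal_mult_less_top)
  qed
  finally show ?thesis
    using fm by (simp add: integrable_iff_bounded)
qed

section \<open>The equation along radial test functions\<close>

lemma test_in_Espace:
  fixes \<phi> :: "real^'n \<Rightarrow> real"
  assumes N: "CARD('n) \<ge> 3" and V: "continuous_on {0<..} V" and \<phi>: "\<phi> \<in> radial_test_functions"
    and r: "r > 0" "\<And>x. norm x < r \<Longrightarrow> \<phi> x = 0"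
  shows "\<phi> \<in> Espace V"
proof -
  have t: "\<phi> \<in> test_functions"
    by (rule radial_testD[OF \<phi>])
  note \<phi>m = test_borel[OF t]
  obtain R where R: "R > 0" "\<forall>x. norm x > R \<longrightarrow> \<phi> x = 0"
    using test_support[OF t] by blast
  obtain M where M: "M > 0" "\<forall>x. \<bar>\<phi> x\<bar> \<le> M"
    using test_bounded[OF t] by blast
  let ?p = "2 * real CARD('n) / (real CARD('n) - 2)"
  have p: "?p > 0"
    using N by simp
  have pm: "(\<lambda>x. \<bar>\<phi> x\<bar> powr ?p) \<in> borel_measurable borel"
    using \<phi>m by measurable
  have "integrable lebesgue (\<lambda>x. \<bar>\<phi> x\<bar> powr ?p)"
  proof (rule integrable_bounded_support[OF pm, of "M powr ?p" R])
    show "\<bar>\<bar>\<phi> x\<bar> powr ?p\<bar> \<le> M powr ?p" for x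
      using M p by (simp add: powr_mono2)
    show "\<bar>\<phi> x\<bar> powr ?p = 0" if "norm x > R" for x
      using R that by simp
  qed
  then have D12: "\<phi> \<in> D12"
    unfolding D12_def using weak_gradient_test[OF t] integrable_gradient_sq[OF t] borel_imp_lebesgue_measurable[OF \<phi>m]
    by blast
  have "dirichlet_norm (\<lambda>x. 0 * \<phi> x) = 0"
    using dirichlet_norm_cmult[OF weak_gradient_test[OF t], of 0] by simp
  then have "dirichlet_norm (\<lambda>x. \<phi> x - \<phi> x) = 0"
    by simp
  then have "\<phi> \<in> D12_rad"
    unfolding D12_rad_def using D12 \<phi> by force
  moreover have "(\<integral>\<^sup>+ x. ennreal (V (norm x) * (chg (\<phi> x))\<^sup>2) \<partial>lebesgue) < \<infinity>"
  proof -
    obtain B where B: "B > 0" "\<forall>s. r \<le> s \<and> s \<le> R \<longrightarrow> \<bar>V s\<bar> \<le> B"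
      using continuous_bounded_between[OF V r(1)] by blast
    have m: "(\<lambda>x. V (norm x) * (chg (\<phi> x))\<^sup>2) \<in> borel_measurable borel"
      by (intro borel_measurable_times borel_measurable_power radial_borel(1)[OF V] measurable_compose[OF \<phi>m chg_borel])
    have I: "integrable lebesgue (\<lambda>x. V (norm x) * (chg (\<phi> x))\<^sup>2)"
    proof (rule integrable_bounded_support[OF m, of "B * M\<^sup>2" R])
      show "\<bar>V (norm x) * (chg (\<phi> x))\<^sup>2\<bar> \<le> B * M\<^sup>2" for x
      proof (cases "r \<le> norm x \<and> norm x \<le> R")
        case True
        have "\<bar>chg (\<phi> x)\<bar> \<le> M"
          using chg_abs_le[of "\<phi> x"] M(2) order_trans by blast
        then have "(chg (\<phi> x))\<^sup>2 \<le> M\<^sup>2"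
          using abs_le_square_iff[of "chg (\<phi> x)" M] M(1) by simp
        then show ?thesis
          using B True by (simp add: abs_mult mult_mono)
      next
        case False
        then have "\<phi> x = 0"
          using r(2)[of x] R(2) by (meson not_le)
        then show ?thesis
          using B by (simp add: chg_0)
      qed
      show "V (norm x) * (chg (\<phi> x))\<^sup>2 = 0" if "norm x > R" for x
        using R that by (simp add: chg_0)
    qed
    have "(\<integral>\<^sup>+ x. ennreal (V (norm x) * (chg (\<phi> x))\<^sup>2) \<partial>lebesgue) \<le>
        (\<integral>\<^sup>+ x. ennreal (norm (V (norm x) * (chg (\<phi> x))\<^sup>2)) \<partial>lebesgue)"
      by (intro nn_integral_mono ennreal_leI) simp
    also have "\<dots> < \<infinity>"
      using I by (simp add: integrable_iff_bounded)
    finally show ?thesis .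
  qed
  ultimately show ?thesis
    unfolding Espace_def by blast
qed

text \<open>Differentiation under the integral sign in the direction \<open>h\<close>. On the support of \<open>h\<close> the function \<open>w\<close>
  is bounded, so the difference quotients are bounded by a Lipschitz constant of \<open>S\<close> on the
  relevant interval.\<close>

lemma
  fixes w h k :: "'a::euclidean_space \<Rightarrow> real" and S S' :: "real \<Rightarrow> real"
  assumes S: "\<And>t. (S has_real_derivative S' t) (at t)" and S'c: "continuous_on UNIV S'"
    and k: "k \<in> borel_measurable borel" and w: "w \<in> borel_measurable borel" and h: "h \<in> borel_measurable borel"
    and "\<forall>x. \<bar>h x\<bar> \<le> M" and "\<forall>x. norm x < r \<longrightarrow> h x = 0" and "\<forall>x. norm x > R \<longrightarrow> h x = 0"
    and "\<forall>x. r \<le> norm x \<longrightarrow> norm x \<le> R \<longrightarrow> \<bar>k x\<bar> \<le> B"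
    and "\<forall>x. r \<le> norm x \<longrightarrow> norm x \<le> R \<longrightarrow> \<bar>w x\<bar> \<le> B'"
  shows quotient_integrable: "\<And>e. 0 < e \<Longrightarrow> e \<le> 1 \<Longrightarrow>
      integrable lebesgue (\<lambda>x. k x * (S (w x + e * h x) - S (w x)))"
    and quotient_tendsto: "(\<lambda>n. (LINT x|lebesgue. k x * (S (w x + inverse (real (Suc n)) * h x) - S (w x))) / inverse (real (Suc n)))
      \<longlonglongrightarrow> (LINT x|lebesgue. k x * (S' (w x) * h x))"
    and limit_integrable: "integrable lebesgue (\<lambda>x. k x * (S' (w x) * h x))"
proof -
  note hM = assms(6)[rule_format] and h0 = assms(7,8)[rule_format]
    and kB = assms(9)[rule_format] and wB = assms(10)[rule_format]
  have Sc: "continuous_on A S" for A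
    using S DERIV_isCont by (intro continuous_at_imp_continuous_on) blast
  have Sm: "S \<in> borel_measurable borel" and S'm: "S' \<in> borel_measurable borel"
    by (rule borel_measurable_continuous_onI[OF Sc], rule borel_measurable_continuous_onI[OF S'c])
  let ?c = "\<bar>B'\<bar> + \<bar>M\<bar>"
  obtain L where L: "L > 0" "\<And>s. \<bar>s\<bar> \<le> ?c \<Longrightarrow> \<bar>S' s\<bar> \<le> L"
  proof -
    have "compact (S' ` {- ?c..?c})"
      by (rule compact_continuous_image[OF continuous_on_subset[OF S'c]]) auto
    then obtain L where "L > 0" "\<forall>y\<in>S' ` {- ?c..?c}. norm y \<le> L"
      using compact_imp_bounded bounded_pos by metis
    then show thesis
      by (intro that[of L]) (auto simp: abs_le_iff)
  qed
  have Lip: "\<bar>S (a + d) - S a\<bar> \<le> L * \<bar>d\<bar>" if "\<bar>a\<bar> \<le> \<bar>B'\<bar>" "\<bar>d\<bar> \<le> \<bar>M\<bar>" for a d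
  proof -
    have "norm (S (a + d) - S a) \<le> L * norm (a + d - a)"
    proof (rule field_differentiable_bound[of "{- ?c..?c}" S S'])
      show "(S has_field_derivative S' z) (at z within {- ?c..?c})" for z
        by (rule has_field_derivative_at_within[OF S])
      show "norm (S' z) \<le> L" if "z \<in> {- ?c..?c}" for z
        using L(2)[of z] that by (simp add: abs_le_iff)
      have "\<bar>a + d\<bar> \<le> ?c" "\<bar>a\<bar> \<le> ?c"
        using that by linarith+
      then show "a + d \<in> {- ?c..?c}" "a \<in> {- ?c..?c}"
        by (simp_all add: abs_le_iff)
    qed simp
    then show ?thesis by simp
  qed
  define Q where "Q = \<bar>B\<bar> * (L * \<bar>M\<bar>)"
  have Q0: "Q \<ge> 0"
    using L by (simp add: Q_def)
  have hM': "\<bar>h x\<bar> \<le> \<bar>M\<bar>" for x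
    using hM[of x] by linarith
  have bound: "\<bar>k x * (S (w x + e * h x) - S (w x))\<bar> \<le> e * Q" if e: "0 < e" "e \<le> 1" for e x
  proof (cases "r \<le> norm x \<and> norm x \<le> R")
    case True
    have d: "\<bar>e * h x\<bar> \<le> e * \<bar>M\<bar>" "e * \<bar>M\<bar> \<le> \<bar>M\<bar>"
      using e hM'[of x] mult_right_mono[of e 1 "\<bar>M\<bar>"] by (simp_all add: abs_mult mult_left_mono)
    have "\<bar>S (w x + e * h x) - S (w x)\<bar> \<le> L * \<bar>e * h x\<bar>"
      using wB[of x] True d by (intro Lip) linarith+
    also have "\<dots> \<le> L * (e * \<bar>M\<bar>)"
      using d L by (intro mult_left_mono) auto
    finally have "\<bar>k x\<bar> * \<bar>S (w x + e * h x) - S (w x)\<bar> \<le> \<bar>B\<bar> * (L * (e * \<bar>M\<bar>))"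
      using kB[of x] True by (intro mult_mono) auto
    then show ?thesis
      by (simp add: abs_mult Q_def mult_ac)
  next
    case False
    then have "h x = 0"
      using h0[of x] by (meson not_le)
    then show ?thesis
      using Q0 e by simp
  qed
  have out: "k x * (S (w x + e * h x) - S (w x)) = 0" if "norm x > R" for x e
    using h0(2)[OF that] by simp
  have meas: "(\<lambda>x. k x * (S (w x + e * h x) - S (w x))) \<in> borel_measurable borel" for e
    by (intro borel_measurable_times borel_measurable_diff k measurable_compose[OF _ Sm] borel_measurable_add w h borel_measurable_const)
  show int: "integrable lebesgue (\<lambda>x. k x * (S (w x + e * h x) - S (w x)))" if e: "0 < e" "e \<le> 1" for e
    by (rule integrable_bounded_support[OF meas bound[OF e] out])
  have meas': "(\<lambda>x. k x * (S' (w x) * h x)) \<in> borel_measurable borel"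
    by (intro borel_measurable_times k measurable_compose[OF w S'm] h)
  show "integrable lebesgue (\<lambda>x. k x * (S' (w x) * h x))"
  proof (rule integrable_bounded_support[OF meas', of Q R])
    show "\<bar>k x * (S' (w x) * h x)\<bar> \<le> Q" for x
    proof (cases "r \<le> norm x \<and> norm x \<le> R")
      case True
      have "\<bar>S' (w x)\<bar> \<le> L"
        using wB[of x] True by (intro L) linarith
      then have le: "\<bar>S' (w x)\<bar> * \<bar>h x\<bar> \<le> L * \<bar>M\<bar>"
        using hM'[of x] L by (intro mult_mono) auto
      have "\<bar>k x\<bar> * (\<bar>S' (w x)\<bar> * \<bar>h x\<bar>) \<le> \<bar>B\<bar> * (L * \<bar>M\<bar>)"
        by (rule mult_mono[OF order_trans[OF kB abs_ge_self] le]) (use True in auto)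
      then show ?thesis
        by (simp add: abs_mult Q_def)
    next
      case False
      then have "h x = 0"
        using h0[of x] by (meson not_le)
      then show ?thesis
        using Q0 by simp
    qed
    show "k x * (S' (w x) * h x) = 0" if "norm x > R" for x
      using h0(2)[OF that] by simp
  qed
  define \<epsilon> where "\<epsilon> n = inverse (real (Suc n))" for n
  have \<epsilon>: "0 < \<epsilon> n" "\<epsilon> n \<le> 1" for n
    by (simp_all add: \<epsilon>_def inverse_le_1_iff)
  have "(\<lambda>n. LINT x|lebesgue. k x * (S (w x + \<epsilon> n * h x) - S (w x)) / \<epsilon> n) \<longlonglongrightarrow> (LINT x|lebesgue. k x * (S' (w x) * h x))"
  proof (rule integral_dominated_convergence)
    show "integrable lebesgue (\<lambda>x. indicat_real (cball (0::'a) R) x *\<^sub>R Q)"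
      by (rule locally_integrable_integrable[OF locally_integrable_continuous[OF continuous_on_const] compact_cball])
    show "(\<lambda>x. k x * (S' (w x) * h x)) \<in> borel_measurable lebesgue"
      by (rule borel_imp_lebesgue_measurable[OF meas'])
    show "(\<lambda>x. k x * (S (w x + \<epsilon> n * h x) - S (w x)) / \<epsilon> n) \<in> borel_measurable lebesgue" for n
      by (rule borel_measurable_divide[OF borel_imp_lebesgue_measurable[OF meas] borel_measurable_const])
    have "(\<lambda>n. k x * (S (w x + \<epsilon> n * h x) - S (w x)) / \<epsilon> n) \<longlonglongrightarrow> k x * (S' (w x) * h x)" for x
    proof -
      have "((\<lambda>s. S (w x + s * h x)) has_real_derivative S' (w x + 0 * h x) * h x) (at 0)"
        by (rule DERIV_chain2[OF S]) (auto intro!: derivative_eq_intros)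
      then have "((\<lambda>s. (S (w x + (0 + s) * h x) - S (w x + 0 * h x)) / s) \<longlongrightarrow> S' (w x + 0 * h x) * h x) (at 0)"
        unfolding DERIV_def .
      moreover have "filterlim \<epsilon> (at 0) sequentially"
        using LIMSEQ_inverse_real_of_nat \<epsilon>(1) unfolding \<epsilon>_def
        by (auto simp: filterlim_at simp del: of_nat_Suc)
      ultimately have "(\<lambda>n. (S (w x + (0 + \<epsilon> n) * h x) - S (w x + 0 * h x)) / \<epsilon> n) \<longlonglongrightarrow> S' (w x + 0 * h x) * h x"
        by (rule filterlim_compose)
      from tendsto_mult_left[OF this, of "k x"] show ?thesis
        by simp
    qed
    then show "AE x in lebesgue. (\<lambda>n. k x * (S (w x + \<epsilon> n * h x) - S (w x)) / \<epsilon> n) \<longlonglongrightarrow> k x * (S' (w x) * h x)"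
      by simp
    have "\<bar>k x * (S (w x + \<epsilon> n * h x) - S (w x)) / \<epsilon> n\<bar> \<le> indicat_real (cball 0 R) x *\<^sub>R Q" for x n
    proof (cases "norm x > R")
      case False
      have "\<bar>k x * (S (w x + \<epsilon> n * h x) - S (w x))\<bar> / \<epsilon> n \<le> \<epsilon> n * Q / \<epsilon> n"
        using bound[OF \<epsilon>] \<epsilon>(1)[of n] by (intro divide_right_mono) auto
      then show ?thesis
        using False \<epsilon>(1)[of n] by simp
    qed (simp add: out)
    then show "AE x in lebesgue. norm (k x * (S (w x + \<epsilon> n * h x) - S (w x)) / \<epsilon> n) \<le> indicat_real (cball 0 R) x *\<^sub>R Q" for n
      by simp
  qed
  then show "(\<lambda>n. (LINT x|lebesgue. k x * (S (w x + inverse (real (Suc n)) * h x) - S (w x))) / inverse (real (Suc n)))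
      \<longlonglongrightarrow> (LINT x|lebesgue. k x * (S' (w x) * h x))"
    by (simp add: \<epsilon>_def)
qed

definition chg' :: "real \<Rightarrow> real" where
  "chg' t = 1 / sqrt (1 + 2 * (chg t)\<^sup>2)"

lemma chg_DERIV: "(chg has_real_derivative chg' t) (at t)"
  unfolding chg'_def by (rule chg_deriv)

lemma continuous_chg': "continuous_on S chg'"
  unfolding chg'_def[abs_def]
proof (intro continuous_intros continuous_chg ballI)
  fix t :: real
  have "1 + 2 * (chg t)\<^sup>2 > 0"
    by (simp add: add_pos_nonneg)
  then show "sqrt (1 + 2 * (chg t)\<^sup>2) \<noteq> 0"
    by simp
qed

text \<open>The norm of \<open>\<epsilon> * h\<close> is linear in \<open>\<epsilon>\<close>, so an error of smaller order in the norm is of smaller order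
  in \<open>\<epsilon>\<close>.\<close>

lemma derivative_eq_0_if_critical:
  fixes u :: "real^'n \<Rightarrow> real"
  assumes crit: "critical_point V J u" and h: "weak_gradient h w"
    and hE: "\<And>c. c > 0 \<Longrightarrow> (\<lambda>x. c * h x) \<in> Espace V"
    and lim: "(\<lambda>n. (J (\<lambda>x. u x + inverse (real (Suc n)) * h x) - J u) / inverse (real (Suc n))) \<longlonglongrightarrow> l"
  shows "l = 0"
proof -
  define \<epsilon> where "\<epsilon> n = inverse (real (Suc n))" for n
  have \<epsilon>: "\<epsilon> n > 0" for n
    by (simp add: \<epsilon>_def)
  have \<epsilon>0: "\<epsilon> \<longlonglongrightarrow> 0"
    unfolding \<epsilon>_def by (rule LIMSEQ_inverse_real_of_nat)
  have En: "Enorm V (\<lambda>x. \<epsilon> n * h x) = \<epsilon> n * Enorm V h" for n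
    by (rule Enorm_cmult[OF h \<epsilon>])
  have le: "\<bar>l\<bar> \<le> e * Enorm V h" if e: "e > 0" for e
  proof -
    obtain d where d: "d > 0" "\<forall>h\<in>Espace V. Enorm V h < d \<longrightarrow> \<bar>J (\<lambda>x. u x + h x) - J u - 0\<bar> \<le> e * Enorm V h"
      using crit e unfolding critical_point_def has_frechet_differential_def by blast
    have "(\<lambda>n. \<epsilon> n * Enorm V h) \<longlonglongrightarrow> 0"
      using tendsto_mult_right[OF \<epsilon>0, of "Enorm V h"] by simp
    then have "\<forall>\<^sub>F n in sequentially. \<epsilon> n * Enorm V h < d"
      using d(1) by (rule order_tendstoD(2))
    then have ev: "\<forall>\<^sub>F n in sequentially. \<bar>(J (\<lambda>x. u x + \<epsilon> n * h x) - J u) / \<epsilon> n\<bar> \<le> e * Enorm V h"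
    proof eventually_elim
      case (elim n)
      then have "\<bar>J (\<lambda>x. u x + \<epsilon> n * h x) - J u\<bar> \<le> e * (\<epsilon> n * Enorm V h)"
        using d(2)[rule_format, OF hE[OF \<epsilon>[of n]]] En[of n] by simp
      then show ?case
        using \<epsilon>[of n] by (simp add: abs_divide field_simps)
    qed
    have "(\<lambda>n. \<bar>(J (\<lambda>x. u x + \<epsilon> n * h x) - J u) / \<epsilon> n\<bar>) \<longlonglongrightarrow> \<bar>l\<bar>"
      using tendsto_rabs[OF lim] unfolding \<epsilon>_def .
    then show ?thesis
      using ev by (rule tendsto_upperbound) simp
  qed
  have "Enorm V h \<ge> 0"
    using le[of 1] by simp
  then have "\<bar>l\<bar> \<le> 0"
    by (rule nonpos_if_le_all_multiples) (rule le)
  then show ?thesis by simp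
qed

text \<open>The partial derivatives of a test function are test functions, so the definition of the weak
  gradient applies to them and moves the second derivative to \<open>h\<close> as well.\<close>

lemma integral_gradient_inner:
  assumes u: "weak_gradient u v" and h: "h \<in> test_functions"
  shows "integrable lebesgue (\<lambda>x. v x \<bullet> gradient h x)"
    and "(LINT x|lebesgue. v x \<bullet> gradient h x) = - (LINT x|lebesgue. u x * laplacian h x)"
proof -
  have lv: "locally_integrable v" and lu: "locally_integrable u"
    using u by (simp_all add: weak_gradient_locally_integrable)
  note I = integrable_mult_test[OF locally_integrable_component[OF lv] test_partial[OF h]]
  note I2 = integrable_mult_test[OF lu test_partial[OF test_partial[OF h]]]
  have eq: "v x \<bullet> gradient h x = (\<Sum>i\<in>UNIV. v x $ i * partial i h x)" for x
    by (simp add: inner_vec_def gradient_def)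
  show "integrable lebesgue (\<lambda>x. v x \<bullet> gradient h x)"
    unfolding eq using I by (intro Bochner_Integration.integrable_sum)
  have "(LINT x|lebesgue. v x \<bullet> gradient h x) = (\<Sum>i\<in>UNIV. LINT x|lebesgue. v x $ i * partial i h x)"
    unfolding eq using I by (intro Bochner_Integration.integral_sum)
  also have "\<dots> = (\<Sum>i\<in>UNIV. - (LINT x|lebesgue. u x * partial i (partial i h) x))"
    by (rule sum.cong) (use u test_partial[OF h] in \<open>simp_all add: weak_gradient_locally_integrable\<close>)
  also have "\<dots> = - (\<Sum>i\<in>UNIV. LINT x|lebesgue. u x * partial i (partial i h) x)"
    by (rule sum_negf)
  also have "(\<Sum>i\<in>UNIV. LINT x|lebesgue. u x * partial i (partial i h) x) =
      (LINT x|lebesgue. (\<Sum>i\<in>UNIV. u x * partial i (partial i h) x))"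
    using I2 by (intro Bochner_Integration.integral_sum[symmetric])
  finally show "(LINT x|lebesgue. v x \<bullet> gradient h x) = - (LINT x|lebesgue. u x * laplacian h x)"
    by (simp add: laplacian_def sum_distrib_left)
qed

text \<open>The energies of \<open>u + \<epsilon> * h\<close> and of \<open>u\<close> differ by a quadratic polynomial in \<open>\<epsilon>\<close>, from the gradient, and
  by integrals over the support of \<open>h\<close>, an annulus on which all functions involved are bounded.
  For this splitting the full potential and nonlinear terms must be integrable, as a Lebesgue
  integral of a nonintegrable function would be \<open>0\<close> by convention.\<close>

lemma radial_euler_lagrange:
  fixes u :: "real^'n \<Rightarrow> real"
  assumes N: "CARD('n) \<ge> 3" and V: "continuous_on {0<..} V" and Vnn: "\<forall>r>0. V r \<ge> 0"
    and K: "continuous_on {0<..} K" and g: "continuous_on UNIV g"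
    and crit: "critical_point V (energy V K g) u"
    and KG: "integrable lebesgue (\<lambda>x. K (norm x) * primitive g (chg (u x)))"
    and U: "continuous_on {0<..} U" and uU: "AE x in lebesgue. u x = U (x \<bullet> x)"
    and H: "smooth H" "\<And>t. t < r\<^sup>2 \<Longrightarrow> H t = 0" "\<And>t. t > T \<Longrightarrow> H t = 0" and r: "r > 0"
  shows "(LINT x|lebesgue. U ((x::real^'n) \<bullet> x) * laplacian (\<lambda>x. H (x \<bullet> x)) x) =
    (LINT x|lebesgue. (V (norm x) * (chg (U ((x::real^'n) \<bullet> x)) * chg' (U (x \<bullet> x)))
      - K (norm x) * (g (chg (U (x \<bullet> x))) * chg' (U (x \<bullet> x)))) * H (x \<bullet> x))"
proof -
  define w where "w x = U (x \<bullet> x)" for x :: "real^'n"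
  define h where "h x = H (x \<bullet> x)" for x :: "real^'n"
  have hr: "h \<in> radial_test_functions"
    unfolding h_def[abs_def] by (rule test_radial[OF H(1,3)])
  have t: "h \<in> test_functions"
    by (rule radial_testD[OF hr])
  have h0: "h x = 0" if "norm x < r" for x
    using power_strict_mono[OF that, of 2] by (simp add: h_def H(2) dot_square_norm)
  have uE: "u \<in> Espace V"
    using crit by (simp add: critical_point_def)
  have uD: "u \<in> D12"
    by (rule D12_rad_D12[OF Espace_D12_rad[OF uE]])
  note um = D12_measurable[OF uD]
  define v where "v = wgrad u"
  have v: "weak_gradient u v" and vI: "integrable lebesgue (\<lambda>x. (norm (v x))\<^sup>2)"
    using D12_weak_gradient[OF uD] by (simp_all add: v_def)
  have hE: "(\<lambda>x. c * h x) \<in> Espace V" if "c > 0" for c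
    by (rule Espace_cmult[OF V test_in_Espace[OF N V hr r h0] that])
  obtain R0 where R0: "R0 > 0" "\<forall>x. norm x > R0 \<longrightarrow> h x = 0"
    using test_support[OF t] by blast
  obtain M where M: "M > 0" "\<forall>x. \<bar>h x\<bar> \<le> M"
    using test_bounded[OF t] by blast
  obtain BV where BV: "\<forall>s. r \<le> s \<and> s \<le> R0 \<longrightarrow> \<bar>V s\<bar> \<le> BV"
    using continuous_bounded_between[OF V r] by blast
  obtain BK where BK: "\<forall>s. r \<le> s \<and> s \<le> R0 \<longrightarrow> \<bar>K s\<bar> \<le> BK"
    using continuous_bounded_between[OF K r] by blast
  obtain BU where BU: "\<forall>s. r\<^sup>2 \<le> s \<and> s \<le> R0\<^sup>2 \<longrightarrow> \<bar>U s\<bar> \<le> BU"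
    using continuous_bounded_between[OF U, of "r\<^sup>2"] r by auto
  have wB: "\<forall>x. r \<le> norm x \<longrightarrow> norm x \<le> R0 \<longrightarrow> \<bar>w x\<bar> \<le> BU"
  proof (intro allI impI)
    fix x :: "real^'n" assume x: "r \<le> norm x" "norm x \<le> R0"
    show "\<bar>w x\<bar> \<le> BU"
      using BU power_mono[OF x(1), of 2] power_mono[OF x(2), of 2] r by (simp add: w_def dot_square_norm)
  qed
  have wm: "w \<in> borel_measurable borel"
    unfolding w_def[abs_def] by (rule radial_borel(2)[OF U])
  note Vm = radial_borel(1)[OF V, where 'n = 'n] and Km = radial_borel(1)[OF K, where 'n = 'n]
  note hm = test_borel[OF t]
  define S1 where "S1 s = (chg s)\<^sup>2" for s
  define S1' where "S1' s = 2 * (chg s * chg' s)" for s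
  define S2 where "S2 s = primitive g (chg s)" for s
  define S2' where "S2' s = g (chg s) * chg' s" for s
  have S1: "(S1 has_real_derivative S1' s) (at s)" for s
    unfolding S1_def[abs_def] S1'_def by (auto intro!: derivative_eq_intros chg_DERIV)
  have S2: "(S2 has_real_derivative S2' s) (at s)" for s
    unfolding S2_def[abs_def] S2'_def by (rule DERIV_chain2[OF primitive_deriv(1)[OF g] chg_DERIV])
  have S1'c: "continuous_on UNIV S1'"
    unfolding S1'_def[abs_def] by (intro continuous_intros continuous_chg continuous_chg')
  have S2'c: "continuous_on UNIV S2'"
    unfolding S2'_def[abs_def]
    by (intro continuous_on_mult continuous_on_compose2[OF g] continuous_chg continuous_chg' subset_UNIV)
  have Vb: "\<forall>x::real^'n. r \<le> norm x \<longrightarrow> norm x \<le> R0 \<longrightarrow> \<bar>V (norm x)\<bar> \<le> BV"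
    and Kb: "\<forall>x::real^'n. r \<le> norm x \<longrightarrow> norm x \<le> R0 \<longrightarrow> \<bar>K (norm x)\<bar> \<le> BK"
    using BV BK by blast+
  have hr0: "\<forall>x. norm x < r \<longrightarrow> h x = 0"
    using h0 by blast
  note q1 = quotient_integrable[OF S1 S1'c Vm wm hm M(2) hr0 R0(2) Vb wB]
    quotient_tendsto[OF S1 S1'c Vm wm hm M(2) hr0 R0(2) Vb wB] limit_integrable[OF S1 S1'c Vm wm hm M(2) hr0 R0(2) Vb wB]
  note q2 = quotient_integrable[OF S2 S2'c Km wm hm M(2) hr0 R0(2) Kb wB]
    quotient_tendsto[OF S2 S2'c Km wm hm M(2) hr0 R0(2) Kb wB] limit_integrable[OF S2 S2'c Km wm hm M(2) hr0 R0(2) Kb wB]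
  have Sm: "S1 \<in> borel_measurable borel" "S2 \<in> borel_measurable borel"
    by (intro borel_measurable_continuous_onI continuous_at_imp_continuous_on ballI DERIV_isCont[OF S1] DERIV_isCont[OF S2])+
  have ne0: "AE x in lebesgue. x \<noteq> (0::real^'n)"
    by (rule AE_completion[OF AE_lborel_singleton])
  have ml: "(\<lambda>x. k (norm x) * S (y x)) \<in> borel_measurable lebesgue"
    if "(\<lambda>x::real^'n. k (norm x)) \<in> borel_measurable borel" "S \<in> borel_measurable borel" "y \<in> borel_measurable lebesgue" for k S :: "real \<Rightarrow> real" and y :: "real^'n \<Rightarrow> real"
    by (rule borel_measurable_times[OF borel_imp_lebesgue_measurable[OF that(1)] measurable_compose[OF that(3,2)]])
  have wml: "(\<lambda>x. w x + e * h x) \<in> borel_measurable lebesgue" "w \<in> borel_measurable lebesgue"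
    "(\<lambda>x. u x + e * h x) \<in> borel_measurable lebesgue" for e
    using um borel_imp_lebesgue_measurable[OF wm] borel_imp_lebesgue_measurable[OF hm]
    by (auto intro!: borel_measurable_add borel_measurable_times)
  have IV: "integrable lebesgue (\<lambda>x. V (norm x) * S1 (w x))"
  proof (rule integrableI_nonneg)
    show "(\<lambda>x. V (norm x) * S1 (w x)) \<in> borel_measurable lebesgue"
      by (rule ml[OF Vm Sm(1) wml(2)])
    show "AE x in lebesgue. 0 \<le> V (norm x) * S1 (w x)"
      using ne0 by eventually_elim (use Vnn in \<open>simp add: S1_def\<close>)
    have "(\<integral>\<^sup>+ x. ennreal (V (norm x) * S1 (w x)) \<partial>lebesgue) = (\<integral>\<^sup>+ x. ennreal (V (norm x) * (chg (u x))\<^sup>2) \<partial>lebesgue)"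
      by (rule nn_integral_cong_AE) (use uU in \<open>eventually_elim, simp add: S1_def w_def\<close>)
    then show "(\<integral>\<^sup>+ x. ennreal (V (norm x) * S1 (w x)) \<partial>lebesgue) < \<infinity>"
      using uE by (simp add: Espace_def)
  qed
  have IK: "integrable lebesgue (\<lambda>x. K (norm x) * S2 (w x))"
  proof (rule integrable_cong_AE_imp[OF KG ml[OF Km Sm(2) wml(2)]])
    show "AE x in lebesgue. K (norm x) * primitive g (chg (u x)) = K (norm x) * S2 (w x)"
      using uU by eventually_elim (simp add: S2_def w_def)
  qed
  define A0 A1 A2 where "A0 = (LINT x|lebesgue. (norm (v x))\<^sup>2)" and "A1 = (LINT x|lebesgue. v x \<bullet> gradient h x)"
    and "A2 = (LINT x|lebesgue. (norm (gradient h x))\<^sup>2)"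
  define DV where "DV e = (LINT x|lebesgue. V (norm x) * (S1 (w x + e * h x) - S1 (w x)))" for e
  define DK where "DK e = (LINT x|lebesgue. K (norm x) * (S2 (w x + e * h x) - S2 (w x)))" for e
  note I1 = integral_gradient_inner(1)[OF v t] and I2 = integrable_gradient_sq[OF t]
  have E0: "energy V K g u = 1/2 * A0 + 1/2 * (LINT x|lebesgue. V (norm x) * S1 (w x)) - (LINT x|lebesgue. K (norm x) * S2 (w x))"
  proof -
    have "(LINT x|lebesgue. V (norm x) * (chg (u x))\<^sup>2) = (LINT x|lebesgue. V (norm x) * S1 (w x))"
    proof (rule integral_cong_AE)
      show "(\<lambda>x. V (norm x) * (chg (u x))\<^sup>2) \<in> borel_measurable lebesgue"
        using ml[OF Vm Sm(1) um] by (simp add: S1_def)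
      show "AE x in lebesgue. V (norm x) * (chg (u x))\<^sup>2 = V (norm x) * S1 (w x)"
        using uU by eventually_elim (simp add: S1_def w_def)
    qed (rule ml[OF Vm Sm(1) wml(2)])
    moreover have "(LINT x|lebesgue. K (norm x) * primitive g (chg (u x))) = (LINT x|lebesgue. K (norm x) * S2 (w x))"
    proof (rule integral_cong_AE)
      show "AE x in lebesgue. K (norm x) * primitive g (chg (u x)) = K (norm x) * S2 (w x)"
        using uU by eventually_elim (simp add: S2_def w_def)
    qed (rule borel_measurable_integrable[OF KG], rule borel_measurable_integrable[OF IK])
    ultimately show ?thesis
      by (simp add: energy_def A0_def v_def)
  qed
  have Ee: "energy V K g (\<lambda>x. u x + e * h x) = 1/2 * (A0 + 2 * e * A1 + e\<^sup>2 * A2)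
      + 1/2 * ((LINT x|lebesgue. V (norm x) * S1 (w x)) + DV e) - ((LINT x|lebesgue. K (norm x) * S2 (w x)) + DK e)"
    if e: "0 < e" "e \<le> 1" for e
  proof -
    have "weak_gradient (\<lambda>x. u x + e * h x) (\<lambda>x. v x + e *\<^sub>R gradient h x)"
      by (rule weak_gradient_add[OF v weak_gradient_cmult[OF weak_gradient_test[OF t]]])
    from integral_wgrad[OF this]
    have "(LINT x|lebesgue. (norm (wgrad (\<lambda>x. u x + e * h x) x))\<^sup>2) = (LINT x|lebesgue. (norm (v x + e *\<^sub>R gradient h x))\<^sup>2)" .
    also have "(\<lambda>x. (norm (v x + e *\<^sub>R gradient h x))\<^sup>2) =
        (\<lambda>x. ((norm (v x))\<^sup>2 + (2 * e) * (v x \<bullet> gradient h x)) + e\<^sup>2 * (norm (gradient h x))\<^sup>2)"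
      by (simp add: fun_eq_iff power2_norm_eq_inner inner_add_left inner_add_right inner_commute power2_eq_square[of e] algebra_simps)
    also have "(LINT x|lebesgue. ((norm (v x))\<^sup>2 + (2 * e) * (v x \<bullet> gradient h x)) + e\<^sup>2 * (norm (gradient h x))\<^sup>2) =
        A0 + 2 * e * A1 + e\<^sup>2 * A2"
      using vI I1 I2 by (simp add: A0_def A1_def A2_def)
    finally have 1: "(LINT x|lebesgue. (norm (wgrad (\<lambda>x. u x + e * h x) x))\<^sup>2) = A0 + 2 * e * A1 + e\<^sup>2 * A2" .
    have expand: "(LINT x|lebesgue. k (norm x) * S (u x + e * h x)) =
        (LINT x|lebesgue. k (norm x) * S (w x)) + (LINT x|lebesgue. k (norm x) * (S (w x + e * h x) - S (w x)))"
      if k: "(\<lambda>x::real^'n. k (norm x)) \<in> borel_measurable borel" and S: "S \<in> borel_measurable borel"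
        and i: "integrable lebesgue (\<lambda>x. k (norm x) * S (w x))"
          "integrable lebesgue (\<lambda>x. k (norm x) * (S (w x + e * h x) - S (w x)))" for k S :: "real \<Rightarrow> real"
    proof -
      have "(LINT x|lebesgue. k (norm x) * S (u x + e * h x)) =
          (LINT x|lebesgue. k (norm x) * S (w x) + k (norm x) * (S (w x + e * h x) - S (w x)))"
      proof (rule integral_cong_AE[OF ml[OF k S wml(3)] borel_measurable_integrable[OF Bochner_Integration.integrable_add[OF i]]])
        show "AE x in lebesgue. k (norm x) * S (u x + e * h x) = k (norm x) * S (w x) + k (norm x) * (S (w x + e * h x) - S (w x))"
          using uU by eventually_elim (simp add: w_def right_diff_distrib)
      qed
      then show ?thesis
        by (simp only: Bochner_Integration.integral_add[OF i])
    qed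
    note 2 = expand[OF Vm Sm(1) IV q1(1)[OF e], unfolded DV_def[symmetric]]
    note 3 = expand[OF Km Sm(2) IK q2(1)[OF e], unfolded DK_def[symmetric]]
    show ?thesis
      unfolding energy_def 1 using 2 3 by (simp only: S1_def S2_def)
  qed
  define LV where "LV = (LINT x|lebesgue. V (norm x) * (S1' (w x) * h x))"
  define LK where "LK = (LINT x|lebesgue. K (norm x) * (S2' (w x) * h x))"
  define \<epsilon> where "\<epsilon> n = inverse (real (Suc n))" for n
  have \<epsilon>: "0 < \<epsilon> n" "\<epsilon> n \<le> 1" for n
    by (simp_all add: \<epsilon>_def inverse_le_1_iff)
  have \<epsilon>0: "\<epsilon> \<longlonglongrightarrow> 0"
    unfolding \<epsilon>_def by (rule LIMSEQ_inverse_real_of_nat)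
  have "(energy V K g (\<lambda>x. u x + \<epsilon> n * h x) - energy V K g u) / \<epsilon> n =
      A1 + \<epsilon> n * (A2 / 2) + 1/2 * (DV (\<epsilon> n) / \<epsilon> n) - DK (\<epsilon> n) / \<epsilon> n" for n
    unfolding Ee[OF \<epsilon>] E0 using \<epsilon>(1)[of n] by (simp add: field_simps power2_eq_square)
  moreover have "(\<lambda>n. A1 + \<epsilon> n * (A2 / 2) + 1/2 * (DV (\<epsilon> n) / \<epsilon> n) - DK (\<epsilon> n) / \<epsilon> n) \<longlonglongrightarrow> A1 + 0 * (A2 / 2) + 1/2 * LV - LK"
  proof (intro tendsto_diff tendsto_add tendsto_mult tendsto_const \<epsilon>0)
    show "(\<lambda>n. DV (\<epsilon> n) / \<epsilon> n) \<longlonglongrightarrow> LV"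
      unfolding DV_def LV_def \<epsilon>_def by (rule q1(2))
    show "(\<lambda>n. DK (\<epsilon> n) / \<epsilon> n) \<longlonglongrightarrow> LK"
      unfolding DK_def LK_def \<epsilon>_def by (rule q2(2))
  qed
  ultimately have "(\<lambda>n. (energy V K g (\<lambda>x. u x + \<epsilon> n * h x) - energy V K g u) / \<epsilon> n) \<longlonglongrightarrow> A1 + 0 * (A2 / 2) + 1/2 * LV - LK"
    by simp
  from derivative_eq_0_if_critical[OF crit weak_gradient_test[OF t] hE this[unfolded \<epsilon>_def]]
  have "- A1 = 1/2 * LV - LK"
    by simp
  moreover have "- A1 = (LINT x|lebesgue. U (x \<bullet> x) * laplacian h x)"
  proof -
    have "- A1 = (LINT x|lebesgue. u x * laplacian h x)"
      by (simp add: A1_def integral_gradient_inner(2)[OF v t])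
    also have "\<dots> = (LINT x|lebesgue. U (x \<bullet> x) * laplacian h x)"
    proof (rule integral_cong_AE)
      have "(\<lambda>x. laplacian h x) \<in> borel_measurable borel"
        unfolding laplacian_def using test_borel[OF test_partial[OF test_partial[OF t]]]
        by (intro borel_measurable_sum)
      note lm = borel_imp_lebesgue_measurable[OF this]
      show "(\<lambda>x. u x * laplacian h x) \<in> borel_measurable lebesgue"
        by (rule borel_measurable_times[OF um lm])
      show "(\<lambda>x. U (x \<bullet> x) * laplacian h x) \<in> borel_measurable lebesgue"
        using borel_measurable_times[OF wml(2) lm] by (simp add: w_def)
      show "AE x in lebesgue. u x * laplacian h x = U (x \<bullet> x) * laplacian h x"
        using uU by eventually_elim simp
    qed
    finally show ?thesis .
  qed
  moreover have "1/2 * LV - LK = (LINT x|lebesgue. 1/2 * (V (norm x) * (S1' (w x) * h x)) - K (norm x) * (S2' (w x) * h x))"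
    using q1(3) q2(3) by (simp add: LV_def LK_def)
  moreover have "(\<lambda>x. 1/2 * (V (norm x) * (S1' (w x) * h x)) - K (norm x) * (S2' (w x) * h x)) =
    (\<lambda>x. (V (norm x) * (chg (U (x \<bullet> x)) * chg' (U (x \<bullet> x))) - K (norm x) * (g (chg (U (x \<bullet> x))) * chg' (U (x \<bullet> x)))) * H (x \<bullet> x))"
    by (simp add: fun_eq_iff S1'_def S2'_def w_def h_def algebra_simps)
  ultimately show ?thesis
    unfolding h_def[abs_def] by simp
qed

section \<open>Regularity of weak solutions of the radial equation\<close>

text \<open>A smooth convex function that vanishes to the left of \<open>0\<close> and is affine to the right of \<open>1\<close>, with its
  first two derivatives: a smoothed multiple of the positive part.\<close>

lemma smooth_ramp:
  "\<exists>L E \<eta> I c. (0::real) < I \<and> (\<forall>t. (L has_real_derivative E t) (at t)) \<and>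
    (\<forall>t. (E has_real_derivative \<eta> t) (at t)) \<and> smooth \<eta> \<and> (\<forall>t. \<eta> t \<ge> 0) \<and>
    (\<forall>t. t \<le> 0 \<or> t \<ge> 1 \<longrightarrow> \<eta> t = 0) \<and> (\<forall>t\<le>0. E t = 0 \<and> L t = 0) \<and> (\<forall>t\<ge>1. E t = I \<and> L t = I * t - c)"
proof -
  define \<eta> where "\<eta> t = flat t * flat (1 - t)" for t
  have \<eta>s: "smooth \<eta>"
    using smooth_mult[OF smooth_flat smooth_affine[OF smooth_flat, of 1 "- 1" 1]] unfolding \<eta>_def by simp
  have \<eta>nn: "\<eta> t \<ge> 0" for t
    by (simp add: \<eta>_def flat_bounds)
  have \<eta>0: "\<eta> t = 0" if "t \<le> 0 \<or> t \<ge> 1" for t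
    using that flat_bounds(3)[of t] flat_bounds(3)[of "1 - t"] by (auto simp: \<eta>_def)
  have \<eta>pos: "\<eta> t > 0" if "0 < t" "t < 1" for t
    using that by (simp add: \<eta>_def flat_def)
  obtain E0 where E0: "\<And>t. (E0 has_real_derivative \<eta> t) (at t)"
    using continuous_antiderivative[OF smooth_continuous[OF \<eta>s]] by blast
  define E where "E t = E0 t - E0 0" for t
  have E: "(E has_real_derivative \<eta> t) (at t)" for t
    unfolding E_def[abs_def] using DERIV_diff[OF E0 DERIV_const] by simp
  have Ec: "continuous_on UNIV E"
    using DERIV_isCont[OF E] by (simp add: continuous_at_imp_continuous_on)
  have Eneg: "E t = 0" if "t \<le> 0" for t
    using antiderivative_const_where_zero[OF E0 that] \<eta>0 by (simp add: E_def)
  define I where "I = E 1"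
  have Ege: "E t = I" if "t \<ge> 1" for t
    using antiderivative_const_where_zero[OF E that] \<eta>0 by (simp add: I_def)
  have I: "I > 0"
  proof -
    obtain z where "0 < z" "z < 1" "E 1 - E 0 = (1 - 0) * \<eta> z"
      using MVT2[of 0 1 E \<eta>] E by auto
    then show ?thesis
      using \<eta>pos[of z] Eneg[of 0] by (simp add: I_def)
  qed
  obtain L0 where L0: "\<And>t. (L0 has_real_derivative E t) (at t)"
    using continuous_antiderivative[OF Ec] by blast
  define L where "L t = L0 t - L0 0" for t
  have L: "(L has_real_derivative E t) (at t)" for t
    unfolding L_def[abs_def] using DERIV_diff[OF L0 DERIV_const] by simp
  have Lneg: "L t = 0" if "t \<le> 0" for t
    using antiderivative_const_where_zero[OF L0 that] Eneg by (simp add: L_def)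
  have Lge: "L t = I * t - (I - L 1)" if "t \<ge> 1" for t
  proof -
    have "((\<lambda>t. L t - I * t) has_real_derivative E t - I) (at t)" for t
      by (rule DERIV_diff[OF L DERIV_cmult_Id])
    then have "L 1 - I * 1 = L t - I * t"
      by (rule antiderivative_const_where_zero[OF _ that]) (use Ege in simp)
    then show ?thesis by simp
  qed
  show ?thesis
    by (rule exI[of _ L], rule exI[of _ E], rule exI[of _ \<eta>], rule exI[of _ I], rule exI[of _ "I - L 1"])
      (use I L E \<eta>s \<eta>nn \<eta>0 Eneg Lneg Ege Lge in blast)
qed

text \<open>A combination of three ramps that start at \<open>p\<close>, \<open>q\<close> and \<open>r\<close> has compact support if the
  coefficients are such that the affine parts cancel, which forces them to be the ones in the
  conclusion up to a factor. When the ramps are rescaled to width \<open>\<delta>\<close>, the second derivative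
  concentrates at the three points as \<open>\<delta>\<close> tends to \<open>0\<close>.

  The interval of integration exceeds the support of \<open>H\<close> on both sides, so that \<open>H\<close> and its
  derivatives vanish at its end points.\<close>

lemma weakly_affine_three_points:
  fixes D :: "real \<Rightarrow> real"
  assumes Dc: "continuous_on {0<..} D"
    and 0: "\<And>H \<alpha> \<beta>. smooth H \<Longrightarrow> 0 < \<alpha> \<Longrightarrow> \<alpha> \<le> \<beta> \<Longrightarrow> (\<And>t. t < \<alpha> \<Longrightarrow> H t = 0) \<Longrightarrow> (\<And>t. t > \<beta> \<Longrightarrow> H t = 0) \<Longrightarrow>
      integral {\<alpha> / 2..\<beta> + 1} (\<lambda>t. D t * deriv (deriv H) t) = 0"
    and p: "0 < p" "p < q" "q < r"
  shows "(r - q) * D p - (r - p) * D q + (q - p) * D r = 0"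
proof -
  obtain L E \<eta> I c where I: "(0::real) < I" and L: "\<And>t. (L has_real_derivative E t) (at t)"
    and E: "\<And>t. (E has_real_derivative \<eta> t) (at t)" and \<eta>s: "smooth \<eta>" and \<eta>nn: "\<And>t. \<eta> t \<ge> 0"
    and \<eta>0: "\<And>t. t \<le> 0 \<or> t \<ge> 1 \<Longrightarrow> \<eta> t = 0" and neg: "\<And>t. t \<le> 0 \<Longrightarrow> E t = 0 \<and> L t = 0"
    and ge: "\<And>t. t \<ge> 1 \<Longrightarrow> E t = I \<and> L t = I * t - c"
    using smooth_ramp by metis
  have Ls: "smooth L"
    by (rule smooth_antiderivative[OF L smooth_antiderivative[OF E \<eta>s]])
  define A B C where "A = r - q" and "B = - (r - p)" and "C = q - p"
  have ABC: "A + B + C = 0" "A * p + B * q + C * r = 0"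
    by (simp_all add: A_def B_def C_def algebra_simps)
  define X where "X = A * D p + B * D q + C * D r"
  have est: "\<bar>X\<bar> \<le> e * (\<bar>A\<bar> + \<bar>B\<bar> + \<bar>C\<bar>)" if e: "e > 0" for e
  proof -
    have near: "\<exists>d>0. \<forall>t. x \<le> t \<and> t \<le> x + d \<longrightarrow> \<bar>D t - D x\<bar> \<le> e" if "x > 0" for x
    proof -
      have "isCont D x"
        using Dc that by (simp add: continuous_on_eq_continuous_at)
      then obtain d where "d > 0" "\<forall>t. dist t x < d \<longrightarrow> dist (D t) (D x) < e"
        using e unfolding continuous_at_eps_delta by blast
      then show ?thesis
        by (intro exI[of _ "d / 2"]) (auto simp: dist_real_def less_imp_le)
    qed
    obtain d1 d2 d3 where d: "d1 > 0" "d2 > 0" "d3 > 0"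
      "\<And>t. p \<le> t \<and> t \<le> p + d1 \<Longrightarrow> \<bar>D t - D p\<bar> \<le> e"
      "\<And>t. q \<le> t \<and> t \<le> q + d2 \<Longrightarrow> \<bar>D t - D q\<bar> \<le> e"
      "\<And>t. r \<le> t \<and> t \<le> r + d3 \<Longrightarrow> \<bar>D t - D r\<bar> \<le> e"
      using near[of p] near[of q] near[of r] p by auto
    define \<delta> where "\<delta> = min d1 (min d2 d3)"
    have \<delta>: "\<delta> > 0" using d by (simp add: \<delta>_def)
    have close: "\<bar>D t - D x\<bar> \<le> e" if "x \<in> {p, q, r}" "x \<le> t" "t \<le> x + \<delta>" for x t
      using that d(4)[of t] d(5)[of t] d(6)[of t] by (auto simp: \<delta>_def)
    let ?S = "{p / 2..r + \<delta> + 1}"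
    define G where "G x t = \<eta> ((t - x) / \<delta>)" for x t
    have Gc: "continuous_on T (G x)" for T x
      unfolding G_def
      by (rule continuous_on_compose2[OF smooth_continuous[OF \<eta>s, of UNIV]]) (use \<delta> in \<open>auto intro!: continuous_intros\<close>)
    have lin: "((\<lambda>t. (t - x) / \<delta>) has_real_derivative 1 / \<delta>) (at t)" for x t
      using \<delta> by (auto intro!: derivative_eq_intros)
    define H where "H t = A * L ((t - p) / \<delta>) + B * L ((t - q) / \<delta>) + C * L ((t - r) / \<delta>)" for t
    have aff: "smooth (\<lambda>t. a * L ((t - x) / \<delta>))" for a x
      using smooth_affine[OF Ls, of a "1 / \<delta>" "- x / \<delta>"] by (simp add: diff_divide_distrib)
    have Hs: "smooth H"
      unfolding H_def[abs_def] by (rule smooth_add[OF smooth_add[OF aff aff] aff])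
    have H0: "H t = 0" if "t < p" for t
    proof -
      have "(t - p) / \<delta> \<le> 0" "(t - q) / \<delta> \<le> 0" "(t - r) / \<delta> \<le> 0"
        using that p \<delta> by (simp_all add: divide_le_0_iff)
      then show ?thesis
        using neg by (simp add: H_def)
    qed
    have H1: "H t = 0" if "t > r + \<delta>" for t
    proof -
      have "(t - p) / \<delta> \<ge> 1" "(t - q) / \<delta> \<ge> 1" "(t - r) / \<delta> \<ge> 1"
        using that p \<delta> by (simp_all add: le_divide_eq)
      then have "H t = A * (I * ((t - p) / \<delta>) - c) + B * (I * ((t - q) / \<delta>) - c) + C * (I * ((t - r) / \<delta>) - c)"
        using ge by (simp add: H_def)
      also have "\<dots> = (I * t / \<delta> - c) * (A + B + C) - I / \<delta> * (A * p + B * q + C * r)"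
        by (simp add: algebra_simps diff_divide_distrib add_divide_distrib)
      finally show ?thesis
        by (simp add: ABC)
    qed
    have dH: "deriv H t = (A * E ((t - p) / \<delta>) + B * E ((t - q) / \<delta>) + C * E ((t - r) / \<delta>)) / \<delta>" for t
    proof (rule DERIV_imp_deriv)
      have "(H has_real_derivative A * (E ((t - p) / \<delta>) * (1 / \<delta>)) + B * (E ((t - q) / \<delta>) * (1 / \<delta>)) + C * (E ((t - r) / \<delta>) * (1 / \<delta>))) (at t)"
        unfolding H_def[abs_def]
        by (rule DERIV_add[OF DERIV_add[OF DERIV_cmult[OF DERIV_chain2[OF L lin]] DERIV_cmult[OF DERIV_chain2[OF L lin]]]
            DERIV_cmult[OF DERIV_chain2[OF L lin]]])
      then show "(H has_real_derivative (A * E ((t - p) / \<delta>) + B * E ((t - q) / \<delta>) + C * E ((t - r) / \<delta>)) / \<delta>) (at t)"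
        by (simp add: add_divide_distrib)
    qed
    have ddH: "deriv (deriv H) t = (A * G p t + B * G q t + C * G r t) / \<delta>\<^sup>2" for t
    proof (rule DERIV_imp_deriv)
      have "((\<lambda>t. (A * E ((t - p) / \<delta>) + B * E ((t - q) / \<delta>) + C * E ((t - r) / \<delta>)) / \<delta>) has_real_derivative
          (A * (G p t * (1 / \<delta>)) + B * (G q t * (1 / \<delta>)) + C * (G r t * (1 / \<delta>))) / \<delta>) (at t)"
        unfolding G_def
        by (rule DERIV_cdivide[OF DERIV_add[OF DERIV_add[OF DERIV_cmult[OF DERIV_chain2[OF E lin]] DERIV_cmult[OF DERIV_chain2[OF E lin]]]
            DERIV_cmult[OF DERIV_chain2[OF E lin]]]])
      then show "(deriv H has_real_derivative (A * G p t + B * G q t + C * G r t) / \<delta>\<^sup>2) (at t)"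
        unfolding dH[abs_def] by (simp add: add_divide_distrib power2_eq_square)
    qed
    have Dc': "continuous_on ?S D"
      by (rule continuous_on_subset[OF Dc]) (use p in auto)
    define J where "J x = integral ?S (\<lambda>t. D t * G x t)" for x
    have iJ: "(\<lambda>t. D t * G x t) integrable_on ?S" for x
      by (intro integrable_continuous_interval continuous_on_mult Dc' Gc)
    have J0: "A * J p + B * J q + C * J r = 0"
    proof -
      have "integral ?S (\<lambda>t. D t * deriv (deriv H) t) = 0"
        by (rule 0[OF Hs p(1) _ H0 H1]) (use p \<delta> in auto)
      moreover have "((\<lambda>t. (A * (D t * G p t) + B * (D t * G q t) + C * (D t * G r t)) / \<delta>\<^sup>2) has_integral
          (A * J p + B * J q + C * J r) / \<delta>\<^sup>2) ?S"
        unfolding J_def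
        by (intro has_integral_divide has_integral_add has_integral_mult_right integrable_integral iJ)
      moreover have "(\<lambda>t. (A * (D t * G p t) + B * (D t * G q t) + C * (D t * G r t)) / \<delta>\<^sup>2) = (\<lambda>t. D t * deriv (deriv H) t)"
        by (simp add: ddH fun_eq_iff algebra_simps)
      ultimately have "(A * J p + B * J q + C * J r) / \<delta>\<^sup>2 = 0"
        by (metis integral_unique)
      then show ?thesis
        using \<delta> by simp
    qed
    have Jx: "\<bar>J x - D x * (\<delta> * I)\<bar> \<le> e * (\<delta> * I)" if x: "x \<in> {p, q, r}" for x
    proof -
      have Gint: "(G x has_integral \<delta> * I) ?S"
      proof -
        have "(G x has_integral \<delta> * E ((r + \<delta> + 1 - x) / \<delta>) - \<delta> * E ((p / 2 - x) / \<delta>)) ?S"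
        proof (rule fundamental_theorem_of_calculus)
          show "p / 2 \<le> r + \<delta> + 1"
            using p \<delta> by simp
          fix t
          have "((\<lambda>t. \<delta> * E ((t - x) / \<delta>)) has_real_derivative \<delta> * (G x t * (1 / \<delta>))) (at t)"
            unfolding G_def by (rule DERIV_cmult[OF DERIV_chain2[OF E lin]])
          then have "((\<lambda>t. \<delta> * E ((t - x) / \<delta>)) has_real_derivative G x t) (at t within ?S)"
            using \<delta> by (simp add: has_field_derivative_at_within)
          then show "((\<lambda>t. \<delta> * E ((t - x) / \<delta>)) has_vector_derivative G x t) (at t within ?S)"
            by (simp add: has_real_derivative_iff_has_vector_derivative)
        qed
        moreover have "(r + \<delta> + 1 - x) / \<delta> \<ge> 1" "(p / 2 - x) / \<delta> \<le> 0"
          using x p \<delta> by (auto simp: le_divide_eq divide_le_0_iff)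
        ultimately show ?thesis
          using ge neg by simp
      qed
      have i1: "((\<lambda>t. D t * G x t - D x * G x t) has_integral J x - D x * (\<delta> * I)) ?S"
        unfolding J_def by (intro has_integral_diff has_integral_mult_right integrable_integral iJ Gint)
      have i2: "((\<lambda>t. e * G x t) has_integral e * (\<delta> * I)) ?S"
        by (rule has_integral_mult_right[OF Gint])
      have le: "norm (D t * G x t - D x * G x t) \<le> e * G x t" for t
      proof (cases "x \<le> t \<and> t \<le> x + \<delta>")
        case True
        have "\<bar>D t - D x\<bar> * G x t \<le> e * G x t"
          using close[OF x] True \<eta>nn by (intro mult_right_mono) (auto simp: G_def)
        then show ?thesis
          using \<eta>nn[of "(t - x) / \<delta>"] by (simp add: G_def abs_mult flip: left_diff_distrib)
      next
        case False
        then have "(t - x) / \<delta> \<le> 0 \<or> (t - x) / \<delta> \<ge> 1"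
          using \<delta> by (auto simp: divide_le_0_iff le_divide_eq)
        then show ?thesis
          using \<eta>0 by (simp add: G_def)
      qed
      have "norm (integral ?S (\<lambda>t. D t * G x t - D x * G x t)) \<le> integral ?S (\<lambda>t. e * G x t)"
        by (rule integral_norm_bound_integral[OF has_integral_integrable[OF i1] has_integral_integrable[OF i2] le])
      then show ?thesis
        unfolding integral_unique[OF i1] integral_unique[OF i2] by simp
    qed
    define k where "k = \<delta> * I"
    have k: "k > 0" using \<delta> I by (simp add: k_def)
    have "X * k = - (A * (J p - D p * k) + B * (J q - D q * k) + C * (J r - D r * k))"
      using J0 by (simp add: X_def algebra_simps)
    then have "\<bar>X\<bar> * k = \<bar>A * (J p - D p * k) + B * (J q - D q * k) + C * (J r - D r * k)\<bar>"
      using k by (metis abs_minus_cancel abs_mult abs_of_pos)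
    also have "\<dots> \<le> \<bar>A\<bar> * \<bar>J p - D p * k\<bar> + \<bar>B\<bar> * \<bar>J q - D q * k\<bar> + \<bar>C\<bar> * \<bar>J r - D r * k\<bar>"
      by (simp flip: abs_mult)
    also have "\<dots> \<le> \<bar>A\<bar> * (e * k) + \<bar>B\<bar> * (e * k) + \<bar>C\<bar> * (e * k)"
      using Jx[of p] Jx[of q] Jx[of r] unfolding k_def by (intro add_mono mult_left_mono) auto
    also have "\<dots> = (e * (\<bar>A\<bar> + \<bar>B\<bar> + \<bar>C\<bar>)) * k"
      by (simp add: algebra_simps)
    finally show ?thesis
      using k by simp
  qed
  have "\<bar>X\<bar> \<le> 0"
    by (rule nonpos_if_le_all_multiples[OF _ est]) simp
  then show ?thesis
    by (simp add: X_def A_def B_def C_def algebra_simps)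
qed

text \<open>By the three-point identity, \<open>D\<close> lies on the line through its values at \<open>1\<close> and \<open>2\<close>.\<close>

lemma weakly_affine:
  fixes D :: "real \<Rightarrow> real"
  assumes Dc: "continuous_on {0<..} D"
    and 0: "\<And>H \<alpha> \<beta>. smooth H \<Longrightarrow> 0 < \<alpha> \<Longrightarrow> \<alpha> \<le> \<beta> \<Longrightarrow> (\<And>t. t < \<alpha> \<Longrightarrow> H t = 0) \<Longrightarrow> (\<And>t. t > \<beta> \<Longrightarrow> H t = 0) \<Longrightarrow>
      integral {\<alpha> / 2..\<beta> + 1} (\<lambda>t. D t * deriv (deriv H) t) = 0"
  shows "\<exists>c d. \<forall>t>0. D t = c + d * t"
proof (intro exI allI impI)
  fix t :: real assume t: "t > 0"
  consider "t < 1" | "t = 1" | "1 < t" "t < 2" | "t = 2" | "2 < t" by linarith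
  then show "D t = (2 * D 1 - D 2) + (D 2 - D 1) * t"
  proof cases
    case 1
    have "(2 - 1) * D t - (2 - t) * D 1 + (1 - t) * D 2 = 0"
      by (rule weakly_affine_three_points[OF Dc _ t 1]) (rule 0, auto)
    then show ?thesis by (simp add: algebra_simps)
  next
    case 3
    have "(2 - t) * D 1 - (2 - 1) * D t + (t - 1) * D 2 = 0"
      by (rule weakly_affine_three_points[OF Dc _ _ 3]) (rule 0, auto)
    then show ?thesis by (simp add: algebra_simps)
  next
    case 5
    have "(t - 2) * D 1 - (t - 1) * D 2 + (2 - 1) * D t = 0"
      by (rule weakly_affine_three_points[OF Dc _ _ _ 5]) (rule 0, auto)
    then show ?thesis by (simp add: algebra_simps)
  qed (simp_all add: algebra_simps)
qed

lemma antiderivative_on_positive: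
  fixes f :: "real \<Rightarrow> real"
  assumes "continuous_on {0<..} f"
  shows "\<exists>F. \<forall>t>0. (F has_real_derivative f t) (at t)"
proof -
  have "isCont f x" if "0 < x" for x
    using assms that by (simp add: continuous_on_eq_continuous_at)
  then show ?thesis
    using einterval_antiderivative[of 0 "\<infinity>" f]
    by (auto simp: has_real_derivative_iff_has_vector_derivative zero_ereal_def)
qed

lemma integral_supported:
  fixes F \<phi> :: "real \<Rightarrow> real"
  assumes "continuous_on {a..b} \<phi>" "\<And>t. t \<in> {a..b} \<Longrightarrow> F t = \<phi> t" "\<And>t. t \<notin> {a..b} \<Longrightarrow> F t = 0"
  shows "(LINT t|lborel. F t) = integral {a..b} \<phi>"
proof -
  have "(LINT t|lborel. F t) = (LINT t:{a..b}|lborel. \<phi> t)"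
    unfolding set_lebesgue_integral_def
    by (rule Bochner_Integration.integral_cong) (use assms(2,3) in \<open>auto simp: indicator_def\<close>)
  also have "\<dots> = integral {a..b} \<phi>"
    by (rule set_borel_integral_eq_integral(2)[OF borel_integrable_atLeastAtMost'[OF assms(1)]])
  finally show ?thesis .
qed

text \<open>The weak equation says that \<open>4 * (t powr m * U')' = t powr (m - 1) * b\<close>. Since \<open>U'\<close> is not available,
  write \<open>t powr m * U' = (t powr m * U)' - m * t powr (m - 1) * U\<close> and let \<open>Q\<close> and \<open>R\<close> be a first and a second
  antiderivative of the terms \<open>4 * m * t powr (m - 1) * U\<close> and \<open>t powr (m - 1) * b\<close>. Integrating by parts,
  \<open>D = 4 * t powr m * U - Q - R\<close> is orthogonal to all second derivatives, hence affine. The resulting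
  formula for \<open>U\<close> can be differentiated twice.\<close>

lemma radial_regularity:
  fixes U b :: "real \<Rightarrow> real"
  assumes N: "N > 0" and U: "continuous_on {0<..} U" and b: "continuous_on {0<..} b"
    and weak: "\<And>H \<alpha> \<beta>. smooth H \<Longrightarrow> 0 < \<alpha> \<Longrightarrow> \<alpha> \<le> \<beta> \<Longrightarrow> (\<And>t. t < \<alpha> \<Longrightarrow> H t = 0) \<Longrightarrow> (\<And>t. t > \<beta> \<Longrightarrow> H t = 0) \<Longrightarrow>
      (LINT t|lborel. radial_density N t * (U t * (2 * real N * deriv H t + 4 * t * deriv (deriv H) t))) =
      (LINT t|lborel. radial_density N t * (b t * H t))"
  shows "\<exists>U1 U2. (\<forall>t>0. (U has_real_derivative U1 t) (at t)) \<and> (\<forall>t>0. (U1 has_real_derivative U2 t) (at t)) \<and>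
    continuous_on {0<..} U2 \<and> (\<forall>t>0. 4 * t * U2 t + 2 * real N * U1 t = b t)"
proof -
  define m where "m = real N / 2"
  have m: "m > 0" "2 * real N = 4 * m"
    using N by (simp_all add: m_def)
  define \<kappa> where "\<kappa> = unit_ball_vol (real N) * m"
  have \<kappa>: "\<kappa> > 0"
    using m by (simp add: \<kappa>_def)
  have dens: "radial_density N t = \<kappa> * t powr (m - 1)" if "t > 0" for t
    using that by (simp add: radial_density_def \<kappa>_def m_def)
  have pc: "continuous_on {0<..} (\<lambda>t::real. t powr a)" for a
    by (intro continuous_intros) auto
  have "continuous_on {0<..} (\<lambda>t. 4 * m * (t powr (m - 1) * U t))"
    by (intro continuous_on_mult continuous_on_const pc U)
  then obtain Q where Q: "\<And>t. t > 0 \<Longrightarrow> (Q has_real_derivative 4 * m * (t powr (m - 1) * U t)) (at t)"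
    using antiderivative_on_positive by blast
  obtain R1 where R1: "\<And>t. t > 0 \<Longrightarrow> (R1 has_real_derivative t powr (m - 1) * b t) (at t)"
    using antiderivative_on_positive[OF continuous_on_mult[OF pc b]] by blast
  have cont: "continuous_on {0<..} f" if "\<And>t. t > 0 \<Longrightarrow> (f has_real_derivative f' t) (at t)" for f f' :: "real \<Rightarrow> real"
    using DERIV_isCont[OF that] by (intro continuous_at_imp_continuous_on) auto
  obtain R where R: "\<And>t. t > 0 \<Longrightarrow> (R has_real_derivative R1 t) (at t)"
    using antiderivative_on_positive[OF cont[OF R1]] by blast
  define D where "D t = 4 * (t powr m * U t) - Q t - R t" for t
  have Dc: "continuous_on {0<..} D"
    unfolding D_def[abs_def]
    by (intro continuous_on_diff continuous_on_mult continuous_on_const pc U cont[OF Q] cont[OF R])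
  have "\<exists>c d. \<forall>t>0. D t = c + d * t"
  proof (rule weakly_affine[OF Dc])
    fix H :: "real \<Rightarrow> real" and \<alpha> \<beta> :: real
    assume H: "smooth H" "0 < \<alpha>" "\<alpha> \<le> \<beta>" "\<And>t. t < \<alpha> \<Longrightarrow> H t = 0" "\<And>t. t > \<beta> \<Longrightarrow> H t = 0"
    let ?S = "{\<alpha> / 2..\<beta> + 1}"
    let ?H1 = "deriv H" and ?H2 = "deriv (deriv H)"
    note d1 = smooth_deriv(1)[OF H(1)] and s1 = smooth_deriv(2)[OF H(1)]
    note d2 = smooth_deriv(1)[OF s1] and s2 = smooth_deriv(2)[OF s1]
    have H1_0: "?H1 t = 0" if "t < \<alpha> \<or> t > \<beta>" for t
      using that deriv_eq_0_outside[of "{..<\<alpha>}" H t] deriv_eq_0_outside[of "{\<beta><..}" H t] H(4,5) by auto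
    have H2_0: "?H2 t = 0" if "t < \<alpha> \<or> t > \<beta>" for t
      using that deriv_eq_0_outside[of "{..<\<alpha>}" ?H1 t] deriv_eq_0_outside[of "{\<beta><..}" ?H1 t] H1_0 by auto
    have Spos: "t > 0" if "t \<in> ?S" for t
      using that H(2) by auto
    have Ssub: "?S \<subseteq> {0<..}"
      using Spos by auto
    have out: "t < \<alpha> \<or> t > \<beta>" if "t \<notin> ?S" for t
      using that H(2) by auto
    define f1 where "f1 t = t powr (m - 1) * (U t * (2 * real N * ?H1 t + 4 * t * ?H2 t))" for t
    define f2 where "f2 t = t powr (m - 1) * (b t * H t)" for t
    note cS = continuous_on_subset[OF _ Ssub]
    have f1c: "continuous_on ?S f1"
      unfolding f1_def
      by (intro continuous_on_mult continuous_on_add continuous_on_const continuous_on_id cS[OF pc] cS[OF U]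
          smooth_continuous s1 s2)
    have f2c: "continuous_on ?S f2"
      unfolding f2_def by (intro continuous_on_mult cS[OF pc] cS[OF b] smooth_continuous H(1))
    have i1: "(LINT t|lborel. radial_density N t * (U t * (2 * real N * ?H1 t + 4 * t * ?H2 t))) = integral ?S (\<lambda>t. \<kappa> * f1 t)"
    proof (rule integral_supported)
      show "continuous_on ?S (\<lambda>t. \<kappa> * f1 t)"
        by (intro continuous_on_mult continuous_on_const f1c)
      show "radial_density N t * (U t * (2 * real N * ?H1 t + 4 * t * ?H2 t)) = \<kappa> * f1 t" if "t \<in> ?S" for t
        by (simp add: dens[OF Spos[OF that]] f1_def)
      show "radial_density N t * (U t * (2 * real N * ?H1 t + 4 * t * ?H2 t)) = 0" if "t \<notin> ?S" for t
        using H1_0[OF out[OF that]] H2_0[OF out[OF that]] by simp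
    qed
    have i2: "(LINT t|lborel. radial_density N t * (b t * H t)) = integral ?S (\<lambda>t. \<kappa> * f2 t)"
    proof (rule integral_supported)
      show "continuous_on ?S (\<lambda>t. \<kappa> * f2 t)"
        by (intro continuous_on_mult continuous_on_const f2c)
      show "radial_density N t * (b t * H t) = \<kappa> * f2 t" if "t \<in> ?S" for t
        by (simp add: dens[OF Spos[OF that]] f2_def)
      show "radial_density N t * (b t * H t) = 0" if "t \<notin> ?S" for t
        using out[OF that] H(4,5) by auto
    qed
    have "\<kappa> * integral ?S f1 = \<kappa> * integral ?S f2"
      using weak[OF H] unfolding i1 i2 by simp
    then have eq: "integral ?S f1 = integral ?S f2"
      using \<kappa> by simp
    \<comment> \<open>The boundary terms of the two integrations by parts.\<close>
    define P where "P t = Q t * ?H1 t + (R t * ?H1 t - R1 t * H t)" for t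
    define P' where "P' t = (4 * m * (t powr (m - 1) * U t) * ?H1 t + ?H2 t * Q t) +
      ((R1 t * ?H1 t + ?H2 t * R t) - (t powr (m - 1) * b t * H t + ?H1 t * R1 t))" for t
    have dP: "(P has_real_derivative P' t) (at t)" if "t > 0" for t
      unfolding P_def[abs_def] P'_def
      by (rule DERIV_add[OF DERIV_mult[OF Q[OF that] d2] DERIV_diff[OF DERIV_mult[OF R[OF that] d2] DERIV_mult[OF R1[OF that] d1]]])
    have "(P' has_integral P (\<beta> + 1) - P (\<alpha> / 2)) ?S"
    proof (rule fundamental_theorem_of_calculus)
      show "\<alpha> / 2 \<le> \<beta> + 1"
        using H(2,3) by simp
      show "(P has_vector_derivative P' t) (at t within ?S)" if "t \<in> ?S" for t
        using has_field_derivative_at_within[OF dP[OF Spos[OF that]]]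
        by (simp only: has_real_derivative_iff_has_vector_derivative)
    qed
    moreover have "P (\<beta> + 1) = 0" "P (\<alpha> / 2) = 0"
      using H(2) by (simp_all add: P_def H1_0 H(4,5))
    ultimately have P0: "(P' has_integral 0) ?S"
      by simp
    have "((\<lambda>t. f1 t - f2 t - P' t) has_integral (integral ?S f1 - integral ?S f2 - 0)) ?S"
      by (intro has_integral_diff integrable_integral P0 integrable_continuous_interval f1c f2c)
    moreover have "f1 t - f2 t - P' t = D t * ?H2 t" if "t \<in> ?S" for t
    proof -
      have "t powr m = t powr (m - 1) * t"
        using Spos[OF that] powr_add[of t "m - 1" 1] by simp
      then show ?thesis
        unfolding f1_def f2_def P'_def D_def m(2) by (simp add: algebra_simps)
    qed
    ultimately have "((\<lambda>t. D t * ?H2 t) has_integral (integral ?S f1 - integral ?S f2 - 0)) ?S"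
      using has_integral_cong[of ?S "\<lambda>t. f1 t - f2 t - P' t" "\<lambda>t. D t * ?H2 t"] by simp
    then show "integral ?S (\<lambda>t. D t * ?H2 t) = 0"
      using eq by (simp add: integral_unique)
  qed
  then obtain c d where cd: "\<And>t. t > 0 \<Longrightarrow> D t = c + d * t"
    by blast
  define X where "X t = Q t + R t + (c + d * t)" for t
  have X: "X t = 4 * (t powr m * U t)" if "t > 0" for t
    using cd[OF that] by (simp add: X_def D_def)
  have dX: "(X has_real_derivative 4 * m * (t powr (m - 1) * U t) + R1 t + d) (at t)" if "t > 0" for t
    unfolding X_def[abs_def] by (rule derivative_eq_intros Q[OF that] R[OF that] refl | simp)+
  have pw: "((\<lambda>t. t powr a) has_real_derivative a * t powr (a - 1)) (at t)" if "t > 0" for a t :: real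
    using that by (rule has_real_derivative_powr)
  define U1 where "U1 t = (R1 t + d) * t powr (- m) / 4" for t
  define U2 where "U2 t = (b t - 4 * m * U1 t) / (4 * t)" for t
  have one: "t powr m * t powr (- m) = 1" "t powr (- m - 1) = t powr (- m) / t" "t powr (m - 1) = t powr m / t"
    if "t > 0" for t
    using that by (simp_all add: powr_diff flip: powr_add)
  have "(U has_real_derivative U1 t) (at t)" if t: "t > 0" for t
  proof (rule has_field_derivative_transform_within_open[of "\<lambda>t. X t * t powr (- m) / 4" _ t "{0<..}"])
    have "((\<lambda>t. X t * t powr (- m) / 4) has_real_derivative
        ((4 * m * (t powr (m - 1) * U t) + R1 t + d) * t powr (- m) + (- m * t powr (- m - 1)) * X t) / 4) (at t)"
      by (rule DERIV_cdivide[OF DERIV_mult[OF dX[OF t] pw[OF t]]])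
    also have "((4 * m * (t powr (m - 1) * U t) + R1 t + d) * t powr (- m) + (- m * t powr (- m - 1)) * X t) / 4 = U1 t"
      unfolding U1_def X[OF t] one(2,3)[OF t] by (simp add: algebra_simps)
    finally show "((\<lambda>t. X t * t powr (- m) / 4) has_real_derivative U1 t) (at t)" .
    show "X s * s powr (- m) / 4 = U s" if "s \<in> {0<..}" for s
    proof -
      have "X s * s powr (- m) / 4 = (s powr m * s powr (- m)) * U s"
        using that by (simp add: X)
      then show ?thesis
        using that one(1)[of s] by simp
    qed
  qed (use t in auto)
  moreover have dU1: "(U1 has_real_derivative U2 t) (at t)" if t: "t > 0" for t
  proof -
    have "(U1 has_real_derivative
        ((t powr (m - 1) * b t + 0) * t powr (- m) + (- m * t powr (- m - 1)) * (R1 t + d)) / 4) (at t)"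
      unfolding U1_def[abs_def]
      by (rule DERIV_cdivide[OF DERIV_mult[OF DERIV_add[OF R1[OF t] DERIV_const] pw[OF t]]])
    also have "((t powr (m - 1) * b t + 0) * t powr (- m) + (- m * t powr (- m - 1)) * (R1 t + d)) / 4 =
        ((t powr m * t powr (- m)) * b t - 4 * m * U1 t) / (4 * t)"
      using t unfolding U1_def one(2,3)[OF t] by (simp add: field_simps)
    also have "\<dots> = U2 t"
      by (simp add: one(1)[OF t] U2_def)
    finally show ?thesis .
  qed
  moreover have "continuous_on {0<..} U2"
    unfolding U2_def[abs_def]
    by (intro continuous_on_divide continuous_on_diff continuous_on_mult continuous_on_const continuous_on_id b cont[OF dU1]) auto
  moreover have "4 * t * U2 t + 2 * real N * U1 t = b t" if "t > 0" for t
    using that by (simp add: U2_def m(2))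
  ultimately show ?thesis
    by blast
qed

section \<open>The quasilinear equation\<close>

lemma chg'_square: "(chg' t)\<^sup>2 * (1 + 2 * (chg t)\<^sup>2) = 1"
proof -
  have "1 + 2 * (chg t)\<^sup>2 > 0"
    by (simp add: add_pos_nonneg)
  then show ?thesis
    by (simp add: chg'_def power_divide)
qed

lemma chg'_DERIV: "(chg' has_real_derivative - 2 * chg t * (chg' t) ^ 4) (at t)"
proof -
  define q where "q = 1 + 2 * (chg t)\<^sup>2"
  have q: "q > 0"
    by (simp add: q_def add_pos_nonneg)
  have "((\<lambda>t. 1 + 2 * (chg t)\<^sup>2) has_real_derivative 4 * chg t * chg' t) (at t)"
    by (auto intro!: derivative_eq_intros chg_DERIV)
  from DERIV_chain2[OF DERIV_real_sqrt[OF q[unfolded q_def]] this]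
  have "((\<lambda>t. sqrt (1 + 2 * (chg t)\<^sup>2)) has_real_derivative inverse (sqrt q) / 2 * (4 * chg t * chg' t)) (at t)"
    unfolding q_def .
  from DERIV_inverse'[OF this] have "((\<lambda>t. inverse (sqrt (1 + 2 * (chg t)\<^sup>2))) has_real_derivative
      - (inverse (sqrt q) * (inverse (sqrt q) / 2 * (4 * chg t * chg' t)) * inverse (sqrt q))) (at t)"
    using q by (simp add: q_def)
  moreover have "(\<lambda>t. inverse (sqrt (1 + 2 * (chg t)\<^sup>2))) = chg'"
    by (simp add: fun_eq_iff chg'_def inverse_eq_divide)
  moreover have "inverse (sqrt q) = chg' t"
    by (simp add: chg'_def q_def inverse_eq_divide)
  ultimately show ?thesis
    by (simp add: power4_eq_xxxx mult_ac)
qed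

text \<open>Both Laplacians are computed from the radial derivatives. Multiplying the equation for \<open>U\<close> by
  \<open>1 / chg' U\<close> gives the terms without derivatives, and the terms quadratic in \<open>W1\<close> cancel by
  \<open>chg'_square\<close>.\<close>

lemma classical_solution_of_radial_equation:
  fixes U U1 U2 V K g :: "real \<Rightarrow> real"
  assumes U1: "\<And>t. t > 0 \<Longrightarrow> (U has_real_derivative U1 t) (at t)"
    and U2: "\<And>t. t > 0 \<Longrightarrow> (U1 has_real_derivative U2 t) (at t)" and U2c: "continuous_on {0<..} U2"
    and ode: "\<And>t. t > 0 \<Longrightarrow> 4 * t * U2 t + 2 * real CARD('n) * U1 t =
      V (sqrt t) * (chg (U t) * chg' (U t)) - K (sqrt t) * (g (chg (U t)) * chg' (U t))"
  defines "w \<equiv> \<lambda>x::real^'n. chg (U (x \<bullet> x))"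
  shows "Ck_on 2 w (- {0})"
    and "x \<noteq> 0 \<Longrightarrow> - laplacian w x + V (norm x) * w x - w x * laplacian (\<lambda>y. (w y)\<^sup>2) x = K (norm x) * g (w x)"
proof -
  define W W1 W2 where "W t = chg (U t)" and "W1 t = chg' (U t) * U1 t"
    and "W2 t = (- 2 * chg (U t) * (chg' (U t)) ^ 4 * U1 t) * U1 t + U2 t * chg' (U t)" for t
  have W1: "(W has_real_derivative W1 t) (at t)" if "t > 0" for t
    unfolding W_def[abs_def] W1_def by (rule DERIV_chain2[OF chg_DERIV U1[OF that]])
  have W2: "(W1 has_real_derivative W2 t) (at t)" if "t > 0" for t
    unfolding W1_def[abs_def] W2_def
    by (rule DERIV_mult[OF DERIV_chain2[OF chg'_DERIV U1[OF that]] U2[OF that]])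
  have Uc: "continuous_on {0<..} U" and U1c: "continuous_on {0<..} U1"
    using DERIV_isCont[OF U1] DERIV_isCont[OF U2] by (auto intro!: continuous_at_imp_continuous_on)
  have W2c: "continuous_on {0<..} W2"
    unfolding W2_def[abs_def]
    by (intro continuous_on_add continuous_on_mult continuous_on_power continuous_on_const U1c U2c
        continuous_on_compose2[OF continuous_chg Uc subset_UNIV] continuous_on_compose2[OF continuous_chg' Uc subset_UNIV])
  have w: "w = (\<lambda>x. W (x \<bullet> x))"
    by (simp add: w_def W_def)
  show "Ck_on 2 w (- {0})"
    unfolding w by (rule C2_radial[OF W1 W2 W2c])
  assume x: "x \<noteq> 0"
  define t where "t = x \<bullet> x"
  have t: "t > 0"
    using x by (simp add: t_def)
  have lap: "laplacian w x = 2 * real CARD('n) * W1 t + 4 * t * W2 t"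
    unfolding w t_def by (rule laplacian_radial[OF W1 W2 x])
  have sq1: "((\<lambda>t. (W t)\<^sup>2) has_real_derivative 2 * W t * W1 t) (at t)" if "t > 0" for t
    using DERIV_mult[OF W1[OF that] W1[OF that]] by (simp add: power2_eq_square mult_ac)
  have sq2: "((\<lambda>t. 2 * W t * W1 t) has_real_derivative 2 * (W1 t * W1 t + W2 t * W t)) (at t)" if "t > 0" for t
    using DERIV_cmult[OF DERIV_mult[OF W1[OF that] W2[OF that]], of 2] by (simp add: mult.assoc)
  have lap2: "laplacian (\<lambda>y. (w y)\<^sup>2) x = 2 * real CARD('n) * (2 * W t * W1 t) + 4 * t * (2 * (W1 t * W1 t + W2 t * W t))"
    unfolding w t_def by (rule laplacian_radial[OF sq1 sq2 x])
  define P where "P = chg' (U t)"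
  define n where "n = real CARD('n)"
  define k v where "k = K (norm x)" and "v = V (norm x)"
  have nx: "norm x = sqrt t"
    by (simp add: t_def norm_eq_sqrt_inner)
  have P: "P\<^sup>2 * (1 + 2 * (W t)\<^sup>2) = 1"
    using chg'_square[of "U t"] by (simp add: P_def W_def)
  have ode': "4 * t * U2 t + 2 * n * U1 t = P * (v * W t - k * g (W t))"
    using ode[OF t] by (simp add: P_def W_def k_def v_def n_def nx algebra_simps)
  have lapP: "2 * n * W1 t + 4 * t * W2 t = P * (4 * t * U2 t + 2 * n * U1 t) - P\<^sup>2 * (8 * t * W t * (W1 t)\<^sup>2)"
    unfolding W1_def W2_def W_def P_def by (simp add: power2_eq_square power4_eq_xxxx algebra_simps)
  have "laplacian w x + w x * laplacian (\<lambda>y. (w y)\<^sup>2) x =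
      (1 + 2 * (W t)\<^sup>2) * (2 * n * W1 t + 4 * t * W2 t) + 8 * t * W t * (W1 t)\<^sup>2"
    unfolding lap lap2 by (simp add: w t_def n_def power2_eq_square algebra_simps)
  also have "\<dots> = (P\<^sup>2 * (1 + 2 * (W t)\<^sup>2)) * (v * W t - k * g (W t) - 8 * t * W t * (W1 t)\<^sup>2) + 8 * t * W t * (W1 t)\<^sup>2"
    unfolding lapP ode' by (simp add: power2_eq_square algebra_simps)
  also have "\<dots> = v * W t - k * g (W t)"
    unfolding P by simp
  finally show "- laplacian w x + V (norm x) * w x - w x * laplacian (\<lambda>y. (w y)\<^sup>2) x = K (norm x) * g (w x)"
    by (simp add: v_def k_def w t_def)
qed

theorem theorem6p3:
  fixes V K g :: "real \<Rightarrow> real" and q1 q2 :: real and u :: "real^'n \<Rightarrow> real"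
  assumes "CARD('n) \<ge> 3"
    and "continuous_on {0<..} V" and "\<forall>r>0. V r \<ge> 0"
    and "continuous_on {0<..} K" and "\<forall>r>0. K r > 0"
    and "\<exists>C>0. \<forall>r. 0 < r \<and> r < 1 \<longrightarrow> V r \<le> C / r\<^sup>2"
    and "q1 > 1" and "q2 > 1"
    and "\<exists>R1>0. S_zero TYPE('n) V K q1 R1 < \<infinity>"
    and "\<exists>R2>0. S_infty TYPE('n) V K q2 R2 < \<infinity>"
    and "continuous_on UNIV g"
    and "\<exists>\<theta>>2. \<forall>t. 0 \<le> 2 * \<theta> * primitive g t \<and> 2 * \<theta> * primitive g t \<le> g t * t"
    and "\<exists>t0>0. primitive g t0 > 0"
    and "\<exists>C>0. \<forall>t. \<bar>g t\<bar> \<le> C * min (\<bar>t\<bar> powr (q1 - 1)) (\<bar>t\<bar> powr (q2 - 1))"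
    and "critical_point V (energy V K g) u"
  shows "\<exists>w. (AE x in lebesgue. w x = chg (u x)) \<and>
           Ck_on 2 w (- {0}) \<and>
           (\<forall>x. x \<noteq> 0 \<longrightarrow>
              - laplacian w x + V (norm x) * w x - w x * laplacian (\<lambda>y. (w y)\<^sup>2) x
                = K (norm x) * g (w x))"
proof -
  note N = assms(1) and V = assms(2) and Vnn = assms(3) and K = assms(4) and Kpos = assms(5)
    and q = assms(7,8) and g = assms(11) and crit = assms(15)
  have uE: "u \<in> Espace V"
    using crit by (simp add: critical_point_def)
  obtain U where U: "continuous_on {0<..} U" and uU: "AE x in lebesgue. u x = U (x \<bullet> x)"
    using radial_representative[OF N Espace_D12_rad[OF uE]] by blast
  obtain R1 R2 where R: "R1 > 0" "R2 > 0" "S_zero TYPE('n) V K q1 R1 < \<infinity>" "S_infty TYPE('n) V K q2 R2 < \<infinity>"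
    using assms(9,10) by blast
  obtain C where C: "C > 0" "\<forall>t. \<bar>g t\<bar> \<le> C * min (\<bar>t\<bar> powr (q1 - 1)) (\<bar>t\<bar> powr (q2 - 1))"
    using assms(14) by blast
  have KG: "integrable lebesgue (\<lambda>x. K (norm x) * primitive g (chg (u x)))"
    by (rule nonlinear_term_integrable[OF N V K Kpos q R g C(2,1) uE U uU])
  define b where "b t = V (sqrt t) * (chg (U t) * chg' (U t)) - K (sqrt t) * (g (chg (U t)) * chg' (U t))" for t
  have bc: "continuous_on {0<..} b"
  proof -
    have s: "continuous_on {0<..} (\<lambda>t. h (sqrt t))" if "continuous_on {0<..} h" for h :: "real \<Rightarrow> real"
      by (rule continuous_on_compose2[OF that]) (auto intro!: continuous_intros)
    note cU = continuous_on_compose2[OF continuous_chg U subset_UNIV]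
    show ?thesis
      unfolding b_def[abs_def]
      by (intro continuous_on_diff continuous_on_mult s[OF V] s[OF K] cU
          continuous_on_compose2[OF continuous_chg' U subset_UNIV] continuous_on_compose2[OF g cU subset_UNIV])
  qed
  have "\<exists>U1 U2. (\<forall>t>0. (U has_real_derivative U1 t) (at t)) \<and> (\<forall>t>0. (U1 has_real_derivative U2 t) (at t)) \<and>
    continuous_on {0<..} U2 \<and> (\<forall>t>0. 4 * t * U2 t + 2 * real CARD('n) * U1 t = b t)"
  proof (rule radial_regularity[OF _ U bc])
    fix H :: "real \<Rightarrow> real" and \<alpha> \<beta> :: real
    assume H: "smooth H" "0 < \<alpha>" "\<alpha> \<le> \<beta>" "\<And>t. t < \<alpha> \<Longrightarrow> H t = 0" "\<And>t. t > \<beta> \<Longrightarrow> H t = 0"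
    define h where "h x = H (x \<bullet> x)" for x :: "real^'n"
    note s1 = smooth_deriv(2)[OF H(1)]
    note s2 = smooth_deriv(2)[OF s1]
    define p1 where "p1 t = indicator {0<..} t *\<^sub>R (U t * (2 * real CARD('n) * deriv H t + 4 * t * deriv (deriv H) t))" for t
    define p2 where "p2 t = indicator {0<..} t *\<^sub>R (b t * H t)" for t
    have p1m: "p1 \<in> borel_measurable borel"
      unfolding p1_def[abs_def]
      by (rule borel_measurable_continuous_on_indicator)
        (simp, intro continuous_on_mult continuous_on_add continuous_on_const continuous_on_id U smooth_continuous s1 s2)
    have p2m: "p2 \<in> borel_measurable borel"
      unfolding p2_def[abs_def]
      by (rule borel_measurable_continuous_on_indicator) (simp, intro continuous_on_mult bc smooth_continuous H(1))
    have r: "sqrt \<alpha> > 0"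
      using H(2) by simp
    have h0: "h x = 0" if "x \<in> ball 0 (sqrt \<alpha>)" for x
    proof -
      have "(norm x)\<^sup>2 < (sqrt \<alpha>)\<^sup>2"
        using that by (intro power_strict_mono) auto
      then show ?thesis
        using H(2) by (simp add: h_def H(4) dot_square_norm)
    qed
    have ph0: "partial i h x = 0" if "x \<in> ball 0 (sqrt \<alpha>)" for i x
      by (rule partial_eq_0_outside[OF open_ball h0 that])
    have lap0: "laplacian h 0 = 0"
    proof -
      have "partial i (partial i h) 0 = 0" for i
        by (rule partial_eq_0_outside[of "ball 0 (sqrt \<alpha>)"]) (use ph0 r in auto)
      then show ?thesis
        by (simp add: laplacian_def)
    qed
    have e1: "U (x \<bullet> x) * laplacian h x = p1 (x \<bullet> x)" for x :: "real^'n"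
    proof (cases "x = 0")
      case False
      have "laplacian h x = 2 * real CARD('n) * deriv H (x \<bullet> x) + 4 * (x \<bullet> x) * deriv (deriv H) (x \<bullet> x)"
        unfolding h_def[abs_def]
        by (rule laplacian_radial[OF smooth_deriv(1)[OF H(1)] smooth_deriv(1)[OF s1] False])
      then show ?thesis
        using False by (simp add: p1_def)
    qed (simp add: lap0 p1_def)
    have e2: "(V (norm x) * (chg (U (x \<bullet> x)) * chg' (U (x \<bullet> x)))
        - K (norm x) * (g (chg (U (x \<bullet> x))) * chg' (U (x \<bullet> x)))) * H (x \<bullet> x) = p2 (x \<bullet> x)" for x :: "real^'n"
      using H(2) H(4)[of 0] by (cases "x = 0") (simp_all add: p2_def b_def norm_eq_sqrt_inner)
    have "(LINT x|lebesgue. p1 ((x::real^'n) \<bullet> x)) = (LINT x|lebesgue. p2 ((x::real^'n) \<bullet> x))"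
      using radial_euler_lagrange[OF N V Vnn K g crit KG U uU H(1) _ H(5) r] H(2,4)
      unfolding e2 h_def[abs_def, symmetric] e1 by simp
    then have "(LINT t|lborel. radial_density CARD('n) t * p1 t) = (LINT t|lborel. radial_density CARD('n) t * p2 t)"
      by (simp only: integral_radial[OF p1m] integral_radial[OF p2m])
    moreover have "radial_density CARD('n) t * p1 t =
        radial_density CARD('n) t * (U t * (2 * real CARD('n) * deriv H t + 4 * t * deriv (deriv H) t))"
      "radial_density CARD('n) t * p2 t = radial_density CARD('n) t * (b t * H t)" for t
      by (simp_all add: p1_def p2_def radial_density_def)
    ultimately show "(LINT t|lborel. radial_density CARD('n) t * (U t * (2 * real CARD('n) * deriv H t + 4 * t * deriv (deriv H) t))) =
        (LINT t|lborel. radial_density CARD('n) t * (b t * H t))"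
      by simp
  qed simp
  then obtain U1 U2 where U1: "\<And>t. t > 0 \<Longrightarrow> (U has_real_derivative U1 t) (at t)"
    and U2: "\<And>t. t > 0 \<Longrightarrow> (U1 has_real_derivative U2 t) (at t)" and U2c: "continuous_on {0<..} U2"
    and ode: "\<And>t. t > 0 \<Longrightarrow> 4 * t * U2 t + 2 * real CARD('n) * U1 t =
      V (sqrt t) * (chg (U t) * chg' (U t)) - K (sqrt t) * (g (chg (U t)) * chg' (U t))"
    unfolding b_def by blast
  note sol = classical_solution_of_radial_equation[where 'n = 'n and V = V and K = K and g = g, OF U1 U2 U2c ode]
  show ?thesis
  proof (intro exI[of _ "\<lambda>x. chg (U (x \<bullet> x))"] conjI allI impI)
    show "AE x in lebesgue. chg (U (x \<bullet> x)) = chg (u x)"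
      using uU by eventually_elim simp
    show "Ck_on 2 (\<lambda>x::real^'n. chg (U (x \<bullet> x))) (- {0})"
      by (rule sol(1))
  qed (rule sol(2))
qed

end
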